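(* Let $\Gamma$ be a connected graph with $k\ge 2$ vertices and $m=k-1$ edges (a tree). Let $A\subseteq\mathbb{R}^d$ be open with $\mathrm{Leb}(\partial A)=0$, and suppose $\lim_{n\to\infty} r_n=0$. Let $\theta$ be the volume of the unit ball in $\mathbb{R}^d$ and $d(n)=n\theta r_n^d p_n$. Then: (i) If $p_n\equiv p$ is constant, then $$\lim_{n\to\infty}\frac{E(G'_{n,A}(\Gamma))}{n}\left(\frac{\theta}{d(n)}\right)^{k-1}\ \ge\ \mu_{\Gamma,A}+(1-p)^{\binom{k}{2}-(k-1)}\mu'_{\Gamma,A}.$$ (ii) If $n^2p_n\to\alpha\in(0,\infty)$, then $$\lim_{n\to\infty}\frac{E(G'_{n,A}(\Gamma))}{n}\left(\frac{\theta}{d(n)}\right)^{k-1}\ \ge\ \mu_{\Gamma,A}+e^{-\alpha/2}\mu'_{\Gamma,A}.$$ (iii) If $n^2p_n\to 0$, then $$\lim_{n\to\infty}\frac{E(G'_{n,A}(\Gamma))}{n}\left(\frac{\theta}{d(n)}\right)^{k-1}\ \ge\ \mu_{\Gamma,A}+\mu'_{\Gamma,A}.$$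
   Context: Let $f:\mathbb{R}^d\to[0,\infty)$ be a bounded measurable probability density, and let $X_1,X_2,\dots$ be i.i.d. random points in $\mathbb{R}^d$ with density $f$. Put $\mathcal{X}_n=\{X_1,\dots,X_n\}$. Let $r_n>0$ and $p_n\in(0,1]$ be sequences. For a finite set $\mathcal{Y}\subset\mathbb{R}^d$ and $r>0$, $G(\mathcal{Y};r)$ is the graph with vertex set $\mathcal{Y}$ in which two distinct points are joined by an edge iff their Euclidean distance is at most $r$. The percolated random geometric graph $G(\mathcal{X}_n;p_n,r_n)$ is obtained from $G(\mathcal{X}_n;r_n)$ by keeping each edge with probability $p_n$ and deleting it otherwise, independently for all edges (and independently of the points). $G'_{n,A}(\Gamma)$ is the number of induced subgraphs of $G(\mathcal{X}_n;p_n,r_n)$ that are isomorphic to $\Gamma$ and whose vertex set has its left-most point (the point with smallest first coordinate) in $A$. For a finite set $\mathcal{Y}\subset\mathbb{R}^d$ with $k$ elements, $h_\Gamma(\mathcal{Y})=1$ if $G(\mathcal{Y};1)\cong\Gamma$ and $h_\Gamma(\mathcal{Y})=0$ otherwise; $g_\Gamma(\mathcal{Y})=1$ if $G(\mathcal{Y};1)$ strictly contains $\Gamma$ (i.e. has a subgraph isomorphic to $\Gamma$ but is not itself isomorphic to $\Gamma$), and $g_\Gamma(\mathcal{Y})=0$ otherwise. Both are $0$ if $\mathcal{Y}$ does not have exactly $k$ elements. Set $$\mu_{\Gamma,A}=\frac{1}{k!}\int_A f(x)^k\,dx\int_{(\mathbb{R}^d)^{k-1}}h_\Gamma(\{0,x_1,\dots,x_{k-1}\})\,d(x_1,\dots,x_{k-1}),$$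 $$\mu'_{\Gamma,A}=\frac{1}{k!}\int_A f(x)^k\,dx\int_{(\mathbb{R}^d)^{k-1}}g_\Gamma(\{0,x_1,\dots,x_{k-1}\})\,d(x_1,\dots,x_{k-1}).$$ *)

theory Defs
  imports "HOL-Probability.Probability"
begin

type_synonym 'v ugraph = "'v set \<times> 'v set set"

abbreviation verts :: "'v ugraph \<Rightarrow> 'v set" where "verts \<equiv> fst"
abbreviation edges :: "'v ugraph \<Rightarrow> 'v set set" where "edges \<equiv> snd"

definition simple_graph :: "'v ugraph \<Rightarrow> bool" where
  "simple_graph G \<longleftrightarrow>
     finite (verts G) \<and> (\<forall>e \<in> edges G. e \<subseteq> verts G \<and> card e = 2)"

definition connected_graph :: "'v ugraph \<Rightarrow> bool" where
  "connected_graph G \<longleftrightarrow> verts G \<noteq> {} \<and>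
     (\<forall>u \<in> verts G. \<forall>v \<in> verts G. (u, v) \<in> {(x, y). {x, y} \<in> edges G}\<^sup>*)"

definition graph_iso :: "'v ugraph \<Rightarrow> 'w ugraph \<Rightarrow> bool" where
  "graph_iso G H \<longleftrightarrow>
     (\<exists>\<phi>. bij_betw \<phi> (verts G) (verts H) \<and> (\<lambda>e. \<phi> ` e) ` edges G = edges H)"

definition subgraph :: "'v ugraph \<Rightarrow> 'v ugraph \<Rightarrow> bool" where
  "subgraph H G \<longleftrightarrow> simple_graph H \<and> verts H \<subseteq> verts G \<and> edges H \<subseteq> edges G"

definition induced :: "'v ugraph \<Rightarrow> 'v set \<Rightarrow> 'v ugraph" where
  "induced G S = (S, {e \<in> edges G. e \<subseteq> S})"

definition rgg :: "'a::metric_space set \<Rightarrow> real \<Rightarrow> 'a ugraph" where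
  "rgg Y r = (Y, {{x, y} | x y. x \<in> Y \<and> y \<in> Y \<and> x \<noteq> y \<and> dist x y \<le> r})"

definition sample :: "(nat \<Rightarrow> 'o \<Rightarrow> 'a) \<Rightarrow> nat \<Rightarrow> 'o \<Rightarrow> 'a set" where
  "sample X n \<omega> = (\<lambda>i. X i \<omega>) ` {1..n}"

definition index_pairs :: "nat \<Rightarrow> nat set set" where
  "index_pairs n = {b. b \<subseteq> {1..n} \<and> card b = 2}"

text \<open>The mark \<open>B n {i, j}\<close> decides whether a possible edge between the \<open>i\<close>-th and the
  \<open>j\<close>-th point is kept in the \<open>n\<close>-th graph. Different index pairs give different point pairs
  unless two sample points coincide, which has probability zero when they have a density.\<close>

definition percolated_rgg ::
  "(nat \<Rightarrow> 'o \<Rightarrow> 'a::metric_space) \<Rightarrow> (nat \<Rightarrow> nat set \<Rightarrow> 'o \<Rightarrow> bool) \<Rightarrow> (nat \<Rightarrow> real) \<Rightarrow> nat \<Rightarrow> 'o \<Rightarrow> 'a ugraph"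
where
  "percolated_rgg X B r n \<omega> =
     (sample X n \<omega>,
      edges (rgg (sample X n \<omega>) (r n)) \<inter>
        {(\<lambda>i. X i \<omega>) ` b | b. b \<in> index_pairs n \<and> B n b \<omega>})"

text \<open>The points and the marks of the \<open>n\<close>-th graph are jointly independent, for each \<open>n\<close>; no
  relation between the marks used for different \<open>n\<close> is imposed.\<close>

locale percolated_sample = prob_space M
  for M :: "'o measure"
    and f :: "real ^ 'd \<Rightarrow> real"
    and X :: "nat \<Rightarrow> 'o \<Rightarrow> real ^ 'd"
    and p :: "nat \<Rightarrow> real"
    and B :: "nat \<Rightarrow> nat set \<Rightarrow> 'o \<Rightarrow> bool" +
  assumes density_measurable: "f \<in> borel_measurable borel"
    and density_nonneg: "0 \<le> f x"
    and density_bounded: "bounded (range f)"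
    and density_integral: "has_bochner_integral lborel f 1"
    and points_distributed: "1 \<le> i \<Longrightarrow> distributed M lborel (X i) (\<lambda>x. ennreal (f x))"
    and points_indep: "indep_vars (\<lambda>_. borel) X {1..}"
    and retention_range: "1 \<le> n \<Longrightarrow> 0 < p n \<and> p n \<le> 1"
    and marks_prob: "1 \<le> n \<Longrightarrow> b \<in> index_pairs n \<Longrightarrow> prob {\<omega> \<in> space M. B n b \<omega>} = p n"
    and marks_indep: "1 \<le> n \<Longrightarrow> indep_vars (\<lambda>_. count_space UNIV) (B n) (index_pairs n)"
    and points_marks_indep: "1 \<le> n \<Longrightarrow>
      indep_set
        (sets (vimage_algebra (space M) (\<lambda>\<omega>. \<lambda>i\<in>{1..n}. X i \<omega>)
          (PiM {1..n} (\<lambda>_. borel))))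
        (sets (vimage_algebra (space M) (\<lambda>\<omega>. \<lambda>b\<in>index_pairs n. B n b \<omega>)
          (PiM (index_pairs n) (\<lambda>_. count_space UNIV))))"

definition first_coord :: "real ^ 'd::{finite, linorder} \<Rightarrow> real" where
  "first_coord x = x $ Min UNIV"

text \<open>A set with several points of minimal first coordinate has no left-most point; for
  points with a density such ties have probability zero.\<close>

definition leftmost_in :: "(real ^ 'd::{finite, linorder}) set \<Rightarrow> (real ^ 'd::{finite, linorder}) set \<Rightarrow> bool" where
  "leftmost_in A S \<longleftrightarrow> (\<exists>x \<in> S. x \<in> A \<and> (\<forall>y \<in> S - {x}. first_coord x < first_coord y))"

definition induced_count ::
  "'v ugraph \<Rightarrow> (real ^ 'd::{finite, linorder}) set \<Rightarrow> (real ^ 'd::{finite, linorder}) ugraph \<Rightarrow> nat"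
where
  "induced_count \<Gamma> A G =
     card {S. S \<subseteq> verts G \<and> graph_iso (induced G S) \<Gamma> \<and> leftmost_in A S}"

definition h_ind :: "'v ugraph \<Rightarrow> (real ^ 'd) set \<Rightarrow> real" where
  "h_ind \<Gamma> Y = (if finite Y \<and> card Y = card (verts \<Gamma>) \<and> graph_iso (rgg Y 1) \<Gamma> then 1 else 0)"

definition g_ind :: "'v ugraph \<Rightarrow> (real ^ 'd) set \<Rightarrow> real" where
  "g_ind \<Gamma> Y = (if finite Y \<and> card Y = card (verts \<Gamma>) \<and>
      (\<exists>H. subgraph H (rgg Y 1) \<and> graph_iso H \<Gamma>) \<and> \<not> graph_iso (rgg Y 1) \<Gamma> then 1 else 0)"

definition mu :: "(real ^ 'd \<Rightarrow> real) \<Rightarrow> 'v ugraph \<Rightarrow> (real ^ 'd) set \<Rightarrow> real" where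
  "mu f \<Gamma> A = (let k = card (verts \<Gamma>) in
     1 / fact k * (LINT x:A|lborel. f x ^ k) *
     (LINT x|PiM {1..k - 1} (\<lambda>_. lborel :: (real ^ 'd) measure). h_ind \<Gamma> (insert 0 (x ` {1..k - 1}))))"

definition mu' :: "(real ^ 'd \<Rightarrow> real) \<Rightarrow> 'v ugraph \<Rightarrow> (real ^ 'd) set \<Rightarrow> real" where
  "mu' f \<Gamma> A = (let k = card (verts \<Gamma>) in
     1 / fact k * (LINT x:A|lborel. f x ^ k) *
     (LINT x|PiM {1..k - 1} (\<lambda>_. lborel :: (real ^ 'd) measure). g_ind \<Gamma> (insert 0 (x ` {1..k - 1}))))"

end

theory Submission
  imports Defs
begin

text \<open>
  The expected count is a sum over the \<open>k\<close>-element index sets, and all of them contribute equally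
  (\<open>expected_induced_count\<close>), so everything reduces to \<open>k\<close> points. For these, let \<open>T\<close> be the set of
  index pairs whose points are within distance \<open>r\<close>, and \<open>E\<close> the set of index pairs whose marks keep
  the edge. Both take finitely many values, they are independent, and the event in question says
  that the graph on \<open>{1..k}\<close> with edge set \<open>E \<inter> T\<close> is isomorphic to \<open>\<Gamma>\<close> and that the left-most point
  lies in \<open>A\<close>. Its probability is therefore a finite sum of products of two factors.

  The factor from the marks is elementary. The power \<open>p ^ (k - 1)\<close> that the normalisation removes can
  be extracted from it because \<open>E\<close> must have at least \<open>k - 1\<close> elements; what is left is the polynomial
  \<open>percolation_weight\<close> in \<open>p\<close>, which is continuous, also at \<open>p = 0\<close>.

  The factor from the points is the probability that the pattern of close pairs is \<open>T\<close> and the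
  left-most point lies in \<open>A\<close>. Writing the points as \<open>x\<close> and \<open>x + r y\<^sub>1, \<dots>, x + r y\<^sub>k\<^sub>-\<^sub>1\<close>, where \<open>x\<close> is the
  point with index \<open>k\<close>, produces the factor \<open>r\<close> to the power \<open>dim * (k - 1)\<close>, and the pattern no longer
  depends on \<open>x\<close> and \<open>r\<close>. Since \<open>T\<close> contains a copy of the connected graph \<open>\<Gamma>\<close>, the \<open>y\<close> are confined
  to a bounded set, so dominated convergence reduces the limit to fixed \<open>y\<close>. For a
  density \<open>f\<close> that is merely bounded and measurable, convergence of \<open>f (x + h)\<close> to \<open>f x\<close> as \<open>h\<close> tends
  to \<open>0\<close> is available in \<open>L\<^sup>1\<close> (\<open>L1_translation_continuous\<close>), and boundedness carries it over to
  products; as the boundary of \<open>A\<close> is a null set, the condition on the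
  left-most point becomes \<open>x \<in> A\<close> in the limit. This gives \<open>pattern_prob_tendsto\<close>: the limit is
  \<open>\<integral>\<^sub>A f ^ k\<close> times the volume of the configurations with pattern \<open>T\<close>.

  Hence the normalised mean converges whenever \<open>p\<^sub>n\<close> does (\<open>normalized_mean_tendsto\<close>), and the limit is
  a sum over patterns \<open>T\<close> of weight times volume. Patterns that are copies of \<open>\<Gamma>\<close> make up the constant
  \<open>mu\<close> and have weight at least \<open>1\<close>. Patterns that strictly contain \<open>\<Gamma>\<close> make up \<open>mu'\<close>; choosing \<open>E\<close> to
  be one copy of \<open>\<Gamma>\<close> inside \<open>T\<close> shows that their weight is at least
  \<open>(1 - p) ^ ((k choose 2) - (k - 1))\<close>. In the two sparse regimes \<open>p\<^sub>n\<close> tends to \<open>0\<close>, where this is \<open>1\<close>.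
\<close>

section \<open>Graphs on sample points and on indices\<close>

text \<open>Isomorphism to \<open>\<Gamma>\<close> can be tested on indices instead of points, as long as different
  indices carry different points.\<close>

lemma graph_iso_image:
  assumes inj: "inj_on \<phi> V" and sub: "\<And>e. e \<in> Es \<Longrightarrow> e \<subseteq> V"
  shows "graph_iso (\<phi> ` V, (`) \<phi> ` Es) H \<longleftrightarrow> graph_iso (V, Es) H"
proof
  assume "graph_iso (\<phi> ` V, (`) \<phi> ` Es) H"
  then obtain \<psi> where \<psi>: "bij_betw \<psi> (\<phi> ` V) (verts H)"
    and e: "(`) \<psi> ` (`) \<phi> ` Es = edges H"
    unfolding graph_iso_def by auto
  have "bij_betw (\<psi> \<circ> \<phi>) V (verts H)"
    using \<psi> inj by (meson bij_betw_trans bij_betw_imageI)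
  moreover have "(`) (\<psi> \<circ> \<phi>) ` Es = edges H"
    using e by (simp add: image_image image_comp)
  ultimately show "graph_iso (V, Es) H"
    unfolding graph_iso_def fst_conv snd_conv by blast
next
  assume "graph_iso (V, Es) H"
  then obtain \<psi> where \<psi>: "bij_betw \<psi> V (verts H)" and e: "(`) \<psi> ` Es = edges H"
    unfolding graph_iso_def by auto
  have b: "bij_betw (\<psi> \<circ> inv_into V \<phi>) (\<phi> ` V) (verts H)"
    using \<psi> inj by (meson bij_betw_trans bij_betw_imageI bij_betw_inv_into)
  have "(\<psi> \<circ> inv_into V \<phi>) ` \<phi> ` d = \<psi> ` d" if "d \<in> Es" for d
    using sub[OF that] inj by (metis image_comp inv_into_image_cancel)
  then have "(`) (\<psi> \<circ> inv_into V \<phi>) ` (`) \<phi> ` Es = edges H"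
    unfolding e[symmetric] image_image[of "(`) (\<psi> \<circ> inv_into V \<phi>)"] by (intro image_cong) auto
  with b show "graph_iso (\<phi> ` V, (`) \<phi> ` Es) H"
    unfolding graph_iso_def fst_conv snd_conv by blast
qed

lemma graph_iso_card:
  assumes "graph_iso G H" and sub: "\<And>e. e \<in> edges G \<Longrightarrow> e \<subseteq> verts G"
  shows "card (verts G) = card (verts H)" "card (edges G) = card (edges H)"
proof -
  from assms(1) obtain \<phi> where \<phi>: "bij_betw \<phi> (verts G) (verts H)"
    and e: "(`) \<phi> ` edges G = edges H"
    unfolding graph_iso_def by auto
  show "card (verts G) = card (verts H)" using \<phi> by (rule bij_betw_same_card)
  have "inj_on ((`) \<phi>) (edges G)"
    using inj_on_subset[OF inj_on_image_Pow[OF bij_betw_imp_inj_on[OF \<phi>]]] sub by blast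
  then show "card (edges G) = card (edges H)" using e card_image by metis
qed

lemma graph_iso_connected:
  assumes "graph_iso G H" and sub: "\<And>e. e \<in> edges G \<Longrightarrow> e \<subseteq> verts G"
    and H: "connected_graph H"
  shows "connected_graph G"
proof -
  from assms(1) obtain \<phi> where \<phi>: "bij_betw \<phi> (verts G) (verts H)"
    and e: "(`) \<phi> ` edges G = edges H"
    unfolding graph_iso_def by auto
  define \<psi> where "\<psi> = inv_into (verts G) \<phi>"
  have inv: "\<psi> (\<phi> u) = u" if "u \<in> verts G" for u
    using \<phi> that by (simp add: \<psi>_def bij_betw_def)
  have step: "{\<psi> x, \<psi> y} \<in> edges G" if xy: "{x, y} \<in> edges H" for x y
  proof -
    obtain d where d: "d \<in> edges G" "\<phi> ` d = {x, y}" using e xy by (metis imageE)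
    have "\<psi> ` \<phi> ` d = d"
      using sub[OF d(1)] inv by (auto simp: image_image subset_iff image_iff)
    with d show ?thesis by simp
  qed
  have path: "(x, y) \<in> {(x, y). {x, y} \<in> edges H}\<^sup>* \<Longrightarrow>
      (\<psi> x, \<psi> y) \<in> {(x, y). {x, y} \<in> edges G}\<^sup>*" for x y
    by (induction rule: rtrancl_induct) (auto intro: rtrancl_into_rtrancl dest: step)
  show ?thesis
    unfolding connected_graph_def
  proof (intro conjI ballI)
    show "verts G \<noteq> {}" using H \<phi> by (auto simp: connected_graph_def bij_betw_def)
    fix u v assume uv: "u \<in> verts G" "v \<in> verts G"
    then have "\<phi> u \<in> verts H" "\<phi> v \<in> verts H" using \<phi> by (auto simp: bij_betw_def)
    with H path have "(\<psi> (\<phi> u), \<psi> (\<phi> v)) \<in> {(x, y). {x, y} \<in> edges G}\<^sup>*"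
      unfolding connected_graph_def by blast
    then show "(u, v) \<in> {(x, y). {x, y} \<in> edges G}\<^sup>*" using uv inv by simp
  qed
qed

lemma connected_mono:
  assumes "connected_graph (V, E)" "E \<subseteq> T"
  shows "connected_graph (V, T)"
proof -
  have "{(x, y). {x, y} \<in> E}\<^sup>* \<subseteq> {(x, y). {x, y} \<in> T}\<^sup>*"
    using assms(2) by (intro rtrancl_mono) auto
  then show ?thesis using assms(1) unfolding connected_graph_def by auto
qed

lemma finite_index_pairs: "finite (index_pairs k)"
  by (rule finite_subset[of _ "Pow {1..k}"]) (auto simp: index_pairs_def)

lemma card_index_pairs: "card (index_pairs k) = k choose 2"
  using n_subsets[of "{1..k}" 2] by (simp add: index_pairs_def)

lemma index_graph_card_edges:
  assumes "graph_iso ({1..k}, E) \<Gamma>" "E \<subseteq> index_pairs k"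
  shows "card E = card (edges \<Gamma>)"
proof -
  have "e \<subseteq> {1..k}" if "e \<in> E" for e using assms(2) that unfolding index_pairs_def by blast
  then show ?thesis using graph_iso_card(2)[OF assms(1)] by simp
qed

text \<open>If \<open>T\<close> is the edge set before percolation and every pair in \<open>index_pairs k\<close> is marked independently
  with probability \<open>p\<close>, then \<open>p ^ (k - 1)\<close> times this number is the probability that the marked part
  of \<open>T\<close> is isomorphic to the tree \<open>\<Gamma>\<close>. Only sets \<open>E\<close> with at least \<open>k - 1\<close> elements
  contribute, so the power of \<open>p\<close> is divided out in each summand; the result is a polynomial
  in \<open>p\<close>, with a meaningful value at \<open>p = 0\<close>.\<close>

definition percolation_weight :: "'v ugraph \<Rightarrow> nat \<Rightarrow> real \<Rightarrow> nat set set \<Rightarrow> real" where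
  "percolation_weight \<Gamma> k p T =
     (\<Sum>E\<in>Pow (index_pairs k). of_bool (graph_iso ({1..k}, E \<inter> T) \<Gamma>) *
        (p ^ (card E - (k - 1)) * (1 - p) ^ card (index_pairs k - E)))"

lemma percolation_weight_nonneg: "0 \<le> p \<Longrightarrow> p \<le> 1 \<Longrightarrow> 0 \<le> percolation_weight \<Gamma> k p T"
  unfolding percolation_weight_def by (intro sum_nonneg mult_nonneg_nonneg) auto

text \<open>If \<open>T\<close> is itself a copy of the tree, then so is \<open>E \<inter> T\<close> for every \<open>E = T \<union> F\<close> with \<open>F\<close> disjoint from
  \<open>T\<close>. The weights of these \<open>E\<close> form a full binomial expansion of \<open>(p + (1 - p)) ^ n\<close>, where \<open>n\<close> is the
  number of pairs outside \<open>T\<close>.\<close>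

lemma percolation_weight_iso:
  assumes T: "T \<subseteq> index_pairs k" and iso: "graph_iso ({1..k}, T) \<Gamma>"
    and m: "card (edges \<Gamma>) = k - 1" and p: "0 \<le> p" "p \<le> 1"
  shows "percolation_weight \<Gamma> k p T \<ge> 1"
proof -
  let ?P = "index_pairs k"
  have fin: "finite ?P" by (rule finite_index_pairs)
  have finT: "finite T" using fin T finite_subset by blast
  have cT: "card T = k - 1"
    using index_graph_card_edges[OF iso T] m by (rule trans)
  let ?t = "\<lambda>E. of_bool (graph_iso ({1..k}, E \<inter> T) \<Gamma>) *
        (p ^ (card E - (k - 1)) * (1 - p) ^ card (?P - E))"
  have "(1::real) = (\<Prod>i\<in>?P - T. p + (1 - p))" by simp
  also have "\<dots> = (\<Sum>F\<in>Pow (?P - T). p ^ card F * (1 - p) ^ card (?P - T - F))"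
    using fin by (subst prod_add) auto
  also have "\<dots> = (\<Sum>F\<in>Pow (?P - T). ?t (T \<union> F))"
  proof (intro sum.cong refl)
    fix F assume F: "F \<in> Pow (?P - T)"
    then have "finite F" using fin by (auto intro: finite_subset)
    then have "card (T \<union> F) = card T + card F"
      using F finT by (intro card_Un_disjoint) auto
    moreover have "(T \<union> F) \<inter> T = T" "?P - (T \<union> F) = ?P - T - F" by auto
    ultimately show "p ^ card F * (1 - p) ^ card (?P - T - F) = ?t (T \<union> F)"
      using iso cT by simp
  qed
  also have "\<dots> = sum ?t ((\<union>) T ` Pow (?P - T))"
    by (subst sum.reindex) (auto intro!: inj_onI)
  also have "\<dots> \<le> sum ?t (Pow ?P)"
    using fin p T by (intro sum_mono2) auto
  finally show ?thesis unfolding percolation_weight_def .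
qed

text \<open>The summand with \<open>E = H\<close> alone suffices: the marked pairs are exactly the edges of one copy of the
  tree, and every other pair is unmarked.\<close>

lemma percolation_weight_contains:
  assumes T: "T \<subseteq> index_pairs k" and H: "H \<subseteq> T" and iso: "graph_iso ({1..k}, H) \<Gamma>"
    and m: "card (edges \<Gamma>) = k - 1" and p: "0 \<le> p" "p \<le> 1"
  shows "percolation_weight \<Gamma> k p T \<ge> (1 - p) ^ ((k choose 2) - (k - 1))"
proof -
  let ?P = "index_pairs k"
  have fin: "finite ?P" by (rule finite_index_pairs)
  have HP: "H \<subseteq> ?P" using T H by blast
  then have finH: "finite H" using fin finite_subset by blast
  have cH: "card H = k - 1"
    using index_graph_card_edges[OF iso HP] m by (rule trans)
  define t where "t E = of_bool (graph_iso ({1..k}, E \<inter> T) \<Gamma>) *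
        (p ^ (card E - (k - 1)) * (1 - p) ^ card (?P - E))" for E
  have HT: "H \<inter> T = H" using H by blast
  have cD: "card (?P - H) = (k choose 2) - (k - 1)"
    unfolding card_Diff_subset[OF finH HP] cH card_index_pairs ..
  have "(1 - p) ^ ((k choose 2) - (k - 1)) = t H"
    unfolding t_def HT cD cH by (simp only: iso of_bool_eq diff_self_eq_0 power_0 mult_1)
  also have "\<dots> \<le> sum t (Pow ?P)"
  proof (rule member_le_sum)
    show "H \<in> Pow ?P" using HP by blast
    show "finite (Pow ?P)" using fin by simp
    show "0 \<le> t E" for E unfolding t_def using p by simp
  qed
  finally show ?thesis unfolding percolation_weight_def t_def .
qed

lemma sum_percolation_weight:
  assumes T: "T \<subseteq> index_pairs k" and m: "card (edges \<Gamma>) = k - 1"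
  shows "(\<Sum>E\<in>Pow (index_pairs k). of_bool (graph_iso ({1..k}, E \<inter> T) \<Gamma>) *
      (q ^ card E * (1 - q) ^ card (index_pairs k - E))) = q ^ (k - 1) * percolation_weight \<Gamma> k q T"
  unfolding percolation_weight_def sum_distrib_left
proof (intro sum.cong refl)
  fix E assume E: "E \<in> Pow (index_pairs k)"
  show "of_bool (graph_iso ({1..k}, E \<inter> T) \<Gamma>) * (q ^ card E * (1 - q) ^ card (index_pairs k - E)) =
      q ^ (k - 1) * (of_bool (graph_iso ({1..k}, E \<inter> T) \<Gamma>) *
        (q ^ (card E - (k - 1)) * (1 - q) ^ card (index_pairs k - E)))"
  proof (cases "graph_iso ({1..k}, E \<inter> T) \<Gamma>")
    case True
    have "finite E" using E finite_index_pairs finite_subset by blast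
    then have "card (E \<inter> T) \<le> card E" by (intro card_mono) auto
    moreover have "card (E \<inter> T) = k - 1"
      using index_graph_card_edges[OF True] T m by (metis inf.coboundedI2)
    ultimately have "q ^ card E = q ^ (k - 1) * q ^ (card E - (k - 1))"
      by (simp flip: power_add)
    then show ?thesis using True by simp
  qed simp
qed

text \<open>Only connected patterns can contain the tree. This confines the limit argument to patterns
  whose configurations have finite volume.\<close>

lemma percolation_weight_disconnected:
  assumes \<Gamma>: "connected_graph \<Gamma>" and T: "T \<subseteq> index_pairs k" and nc: "\<not> connected_graph ({1..k}, T)"
  shows "percolation_weight \<Gamma> k q T = 0"
proof -
  have "\<not> graph_iso ({1..k}, E \<inter> T) \<Gamma>" for E
  proof
    assume "graph_iso ({1..k}, E \<inter> T) \<Gamma>"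
    then have "connected_graph ({1..k}, E \<inter> T)"
      by (rule graph_iso_connected[OF _ _ \<Gamma>]) (use T in \<open>auto simp: index_pairs_def\<close>)
    then show False using nc connected_mono by blast
  qed
  then show ?thesis unfolding percolation_weight_def by simp
qed

text \<open>The edge set of the random geometric graph, transported to indices. It makes sense for coinciding
  points too.\<close>

definition close_pairs :: "nat \<Rightarrow> real \<Rightarrow> (nat \<Rightarrow> 'a::metric_space) \<Rightarrow> nat set set" where
  "close_pairs k r x = {e \<in> index_pairs k. \<forall>i\<in>e. \<forall>j\<in>e. dist (x i) (x j) \<le> r}"

lemma index_pairs_eq: "index_pairs k = {{i, j} | i j. i \<in> {1..k} \<and> j \<in> {1..k} \<and> i \<noteq> j}"
proof -
  have "b \<in> index_pairs k \<longleftrightarrow> (\<exists>i j. b = {i, j} \<and> i \<in> {1..k} \<and> j \<in> {1..k} \<and> i \<noteq> j)" for b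
    unfolding index_pairs_def mem_Collect_eq card_2_iff by blast
  then show ?thesis by blast
qed

lemma pair_in_close_pairs_iff:
  "0 \<le> r \<Longrightarrow> {i, j} \<in> close_pairs k r x \<longleftrightarrow>
     i \<in> {1..k} \<and> j \<in> {1..k} \<and> i \<noteq> j \<and> dist (x i) (x j) \<le> r"
proof -
  assume r: "0 \<le> r"
  have c: "card {i, j} = 2 \<longleftrightarrow> i \<noteq> j" by (cases "i = j") auto
  show ?thesis
    unfolding close_pairs_def index_pairs_def mem_Collect_eq c using r by (simp add: dist_commute)
qed

lemma close_pairs_eq:
  assumes "0 \<le> r"
  shows "close_pairs k r x = {{i, j} | i j. i \<in> {1..k} \<and> j \<in> {1..k} \<and> i \<noteq> j \<and> dist (x i) (x j) \<le> r}"
proof -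
  have "close_pairs k r x \<subseteq> index_pairs k" by (auto simp: close_pairs_def)
  then show ?thesis
    unfolding index_pairs_eq
  proof (intro equalityI subsetI)
    fix e assume sub: "close_pairs k r x \<subseteq> {{i, j} |i j. i \<in> {1..k} \<and> j \<in> {1..k} \<and> i \<noteq> j}"
      and e: "e \<in> close_pairs k r x"
    then obtain i j where ij: "e = {i, j}" by blast
    show "e \<in> {{i, j} |i j. i \<in> {1..k} \<and> j \<in> {1..k} \<and> i \<noteq> j \<and> dist (x i) (x j) \<le> r}"
      using e unfolding ij pair_in_close_pairs_iff[OF assms] by blast
  next
    fix e assume "e \<in> {{i, j} |i j. i \<in> {1..k} \<and> j \<in> {1..k} \<and> i \<noteq> j \<and> dist (x i) (x j) \<le> r}"
    then obtain i j where ij: "e = {i, j}" "i \<in> {1..k} \<and> j \<in> {1..k} \<and> i \<noteq> j \<and> dist (x i) (x j) \<le> r"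
      by blast
    then show "e \<in> close_pairs k r x"
      using pair_in_close_pairs_iff[OF assms, of i j k x] by simp
  qed
qed

lemma rgg_edge_iff:
  "{u, v} \<in> edges (rgg Y s) \<longleftrightarrow> u \<in> Y \<and> v \<in> Y \<and> u \<noteq> v \<and> dist u v \<le> s"
proof
  assume "{u, v} \<in> edges (rgg Y s)"
  then obtain x y where "{u, v} = {x, y}" "x \<in> Y" "y \<in> Y" "x \<noteq> y" "dist x y \<le> s"
    unfolding rgg_def by auto
  then show "u \<in> Y \<and> v \<in> Y \<and> u \<noteq> v \<and> dist u v \<le> s"
    by (metis dist_commute doubleton_eq_iff)
next
  assume "u \<in> Y \<and> v \<in> Y \<and> u \<noteq> v \<and> dist u v \<le> s"
  then show "{u, v} \<in> edges (rgg Y s)" unfolding rgg_def snd_conv by blast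
qed

text \<open>The geometric graph joins distinct points and \<open>close_pairs\<close> joins distinct indices; this
  is where injectivity makes the two agree.\<close>

lemma rgg_image:
  assumes inj: "inj_on x {1..k}" and r: "0 \<le> r"
  shows "rgg (x ` {1..k}) r = (x ` {1..k}, (`) x ` close_pairs k r x)"
proof -
  have ne: "x i \<noteq> x j \<longleftrightarrow> i \<noteq> j" if "i \<in> {1..k}" "j \<in> {1..k}" for i j
    using inj that by (meson inj_onD)
  have "{{u, v} |u v. u \<in> x ` {1..k} \<and> v \<in> x ` {1..k} \<and> u \<noteq> v \<and> dist u v \<le> r} =
      {x ` {i, j} | i j. i \<in> {1..k} \<and> j \<in> {1..k} \<and> i \<noteq> j \<and> dist (x i) (x j) \<le> r}"
    (is "?L = ?R")
  proof
    show "?L \<subseteq> ?R"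
    proof
      fix e assume "e \<in> ?L"
      then obtain i j where "i \<in> {1..k}" "j \<in> {1..k}" "e = {x i, x j}" "x i \<noteq> x j" "dist (x i) (x j) \<le> r"
        by blast
      then have "e = x ` {i, j} \<and> i \<in> {1..k} \<and> j \<in> {1..k} \<and> i \<noteq> j \<and> dist (x i) (x j) \<le> r"
        by auto
      then show "e \<in> ?R" by blast
    qed
    show "?R \<subseteq> ?L"
    proof
      fix e assume "e \<in> ?R"
      then obtain i j where ij: "i \<in> {1..k}" "j \<in> {1..k}" "e = x ` {i, j}" "i \<noteq> j" "dist (x i) (x j) \<le> r"
        by blast
      then have "e = {x i, x j} \<and> x i \<in> x ` {1..k} \<and> x j \<in> x ` {1..k} \<and> x i \<noteq> x j \<and> dist (x i) (x j) \<le> r"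
        using ne by simp
      then show "e \<in> ?L" by blast
    qed
  qed
  also have "\<dots> = (`) x ` close_pairs k r x"
    unfolding close_pairs_eq[OF r] by blast
  finally show ?thesis by (simp add: rgg_def)
qed

text \<open>The enumeration \<open>\<sigma>\<close> of the chosen indices by \<open>{1..k}\<close> brings all \<open>k\<close>-element index sets
  to the same finite set of possible edge sets.\<close>

lemma induced_percolated_rgg:
  assumes inj: "inj_on (\<lambda>i. X i \<omega>) {1..n}" and r: "0 \<le> r n"
    and \<sigma>: "inj_on \<sigma> {1..k}" "\<sigma> ` {1..k} \<subseteq> {1..n}"
  defines "x \<equiv> \<lambda>i. X (\<sigma> i) \<omega>"
  shows "induced (percolated_rgg X B r n \<omega>) (x ` {1..k}) =
    (x ` {1..k}, (`) x ` ({e \<in> index_pairs k. B n (\<sigma> ` e) \<omega>} \<inter> close_pairs k (r n) x))"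
proof -
  let ?X = "\<lambda>i. X i \<omega>"
  have ximg: "x ` e = ?X ` \<sigma> ` e" for e by (simp add: x_def image_image)
  have e1: "edges (rgg (sample X n \<omega>) (r n)) = (`) ?X ` close_pairs n (r n) ?X"
    unfolding sample_def using rgg_image[OF inj r] by simp
  have sub: "close_pairs n (r n) ?X \<subseteq> Pow {1..n}" "index_pairs n \<subseteq> Pow {1..n}"
    by (auto simp: close_pairs_def index_pairs_def)
  have injP: "inj_on ((`) ?X) (Pow {1..n})" using inj by (rule inj_on_image_Pow)
  have e2: "edges (percolated_rgg X B r n \<omega>) =
      (`) ?X ` (close_pairs n (r n) ?X \<inter> {b \<in> index_pairs n. B n b \<omega>})"
  proof -
    have "{?X ` b | b. b \<in> index_pairs n \<and> B n b \<omega>} = (`) ?X ` {b \<in> index_pairs n. B n b \<omega>}"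
      by auto
    moreover have "{b \<in> index_pairs n. B n b \<omega>} \<subseteq> Pow {1..n}" using sub(2) by blast
    ultimately show ?thesis
      unfolding percolated_rgg_def e1 snd_conv by (simp only: inj_on_image_Int[OF injP sub(1)])
  qed
  have "{e \<in> edges (percolated_rgg X B r n \<omega>). e \<subseteq> x ` {1..k}} =
     (`) x ` ({e \<in> index_pairs k. B n (\<sigma> ` e) \<omega>} \<inter> close_pairs k (r n) x)" (is "?L = ?R")
  proof
    show "?R \<subseteq> ?L"
    proof
      fix d assume "d \<in> ?R"
      then obtain e where e: "d = x ` e" "e \<in> index_pairs k" "B n (\<sigma> ` e) \<omega>" "e \<in> close_pairs k (r n) x"
        by auto
      have e': "e \<subseteq> {1..k}" "card e = 2" using e by (auto simp: index_pairs_def)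
      have "\<sigma> ` e \<in> index_pairs n"
        using e' \<sigma>(2) card_image[OF inj_on_subset[OF \<sigma>(1) e'(1)]] by (auto simp: index_pairs_def)
      moreover from this have "\<sigma> ` e \<in> close_pairs n (r n) ?X"
        using e(4) by (simp add: close_pairs_def x_def)
      ultimately have "?X ` \<sigma> ` e \<in> edges (percolated_rgg X B r n \<omega>)"
        unfolding e2 using e(3) by blast
      moreover have "x ` e \<subseteq> x ` {1..k}" using e'(1) by blast
      ultimately show "d \<in> ?L" unfolding e(1) ximg by blast
    qed
    show "?L \<subseteq> ?R"
    proof
      fix d assume "d \<in> ?L"
      then obtain b where b: "d = ?X ` b" "b \<in> close_pairs n (r n) ?X" "b \<in> index_pairs n" "B n b \<omega>"
        and d: "d \<subseteq> ?X ` \<sigma> ` {1..k}" unfolding e2 ximg by blast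
      have "b \<subseteq> \<sigma> ` {1..k}"
        using d b(1,3) \<sigma>(2) inj_on_image_subset_iff[OF inj, of b "\<sigma> ` {1..k}"]
        by (simp add: index_pairs_def)
      then obtain e where e: "e \<subseteq> {1..k}" "b = \<sigma> ` e" by (meson subset_imageE)
      have c2: "card e = 2"
        using b(3) e(2) card_image[OF inj_on_subset[OF \<sigma>(1) e(1)]] by (simp add: index_pairs_def)
      have eP: "e \<in> index_pairs k" using e c2 by (simp add: index_pairs_def)
      have "e \<in> close_pairs k (r n) x"
        using b(2) e eP by (simp add: close_pairs_def x_def)
      moreover have "d = x ` e" unfolding ximg b(1) e(2) ..
      ultimately show "d \<in> ?R" using b(4) e eP by simp
    qed
  qed
  then show ?thesis by (simp add: induced_def)
qed

section \<open>Continuity of translations in the mean\<close>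

lemma nn_integral_lborel_affine:
  fixes c :: real and t :: "'a::euclidean_space"
  assumes [measurable]: "g \<in> borel_measurable borel" and c: "0 < c"
  shows "(\<integral>\<^sup>+x. g x \<partial>lborel) = ennreal (c ^ DIM('a)) * (\<integral>\<^sup>+y. g (t + c *\<^sub>R y) \<partial>lborel)"
  using c by (subst lborel_affine[of c t])
     (auto simp: nn_integral_density nn_integral_distr nn_integral_cmult ennreal_power)

lemma lborel_integral_translate:
  fixes g :: "'a::euclidean_space \<Rightarrow> real"
  assumes "integrable lborel g"
  shows "integrable lborel (\<lambda>x. g (x + h))" "(LINT x|lborel. g (x + h)) = (LINT x|lborel. g x)"
proof -
  have d: "distr lborel borel (\<lambda>x. x + h) = (lborel :: 'a measure)"
    using lborel_distr_plus[of h] by (simp add: add.commute[of h] cong: distr_cong)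
  have [measurable]: "g \<in> borel_measurable borel" using assms by simp
  show "integrable lborel (\<lambda>x. g (x + h))"
    using assms integrable_distr_eq[of "\<lambda>x. x + h" lborel borel g] d by simp
  show "(LINT x|lborel. g (x + h)) = (LINT x|lborel. g x)"
    using integral_distr[of "\<lambda>x. x + h" lborel borel g] d by simp
qed

text \<open>Functions whose translates converge in the mean form a closed set in \<open>L\<^sup>1\<close>: translating the
  approximation error does not change its norm, which leaves three errors of size \<open>e / 3\<close>.\<close>

lemma L1_translation_approx:
  fixes g :: "'a::euclidean_space \<Rightarrow> real"
  assumes g: "integrable lborel g"
    and approx: "\<And>e. 0 < e \<Longrightarrow> \<exists>u. integrable lborel u \<and> (LINT x|lborel. \<bar>g x - u x\<bar>) < e \<and>
       (\<lambda>n. LINT x|lborel. \<bar>u (x + h n) - u x\<bar>) \<longlonglongrightarrow> 0"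
  shows "(\<lambda>n. LINT x|lborel. \<bar>g (x + h n) - g x\<bar>) \<longlonglongrightarrow> 0"
proof (rule LIMSEQ_I)
  fix e :: real assume e: "0 < e"
  then obtain u where u: "integrable lborel u" and gu: "(LINT x|lborel. \<bar>g x - u x\<bar>) < e / 3"
    and lim: "(\<lambda>n. LINT x|lborel. \<bar>u (x + h n) - u x\<bar>) \<longlonglongrightarrow> 0"
    using approx[of "e / 3"] by auto
  from LIMSEQ_D[OF lim, of "e / 3"] e obtain N
    where N: "\<And>n. n \<ge> N \<Longrightarrow> (LINT x|lborel. \<bar>u (x + h n) - u x\<bar>) < e / 3"
    by (auto simp: abs_less_iff)
  have "norm ((LINT x|lborel. \<bar>g (x + h n) - g x\<bar>) - 0) < e" if "n \<ge> N" for n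
  proof -
    note [simp] = g u lborel_integral_translate(1)
    have d: "integrable lborel (\<lambda>x. \<bar>g x - u x\<bar>)" by simp
    have "(LINT x|lborel. \<bar>g (x + h n) - g x\<bar>) \<le>
        (LINT x|lborel. \<bar>g (x + h n) - u (x + h n)\<bar> + \<bar>u (x + h n) - u x\<bar> + \<bar>g x - u x\<bar>)"
      by (intro integral_mono) auto
    also have "\<dots> = (LINT x|lborel. \<bar>g x - u x\<bar>) + (LINT x|lborel. \<bar>u (x + h n) - u x\<bar>)
        + (LINT x|lborel. \<bar>g x - u x\<bar>)"
      using lborel_integral_translate(2)[OF d, of "h n"] by simp
    also have "\<dots> < e" using N[OF that] gu by linarith
    finally show ?thesis by (simp add: abs_of_nonneg)
  qed
  then show "\<exists>N. \<forall>n\<ge>N. norm ((LINT x|lborel. \<bar>g (x + h n) - g x\<bar>) - 0) < e" by blast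
qed

text \<open>Where the translated indicator falls below the original one, openness of \<open>U\<close> makes the
  difference vanish eventually at each point, and the original dominates it. The positive and the
  negative part of the difference have equal integrals because translations preserve volume, so this
  one-sided convergence suffices.\<close>

lemma L1_translation_open:
  fixes U :: "'a::euclidean_space set"
  assumes U: "open U" and fin: "emeasure lborel U < \<infinity>" and h: "h \<longlonglongrightarrow> 0"
  shows "(\<lambda>n. LINT x|lborel. \<bar>indicat_real U (x + h n) - indicat_real U x\<bar>) \<longlonglongrightarrow> 0"
proof -
  let ?i = "indicat_real U"
  have [measurable]: "U \<in> sets borel" using U by simp
  have i: "integrable lborel ?i" using fin by simp
  note [simp] = lborel_integral_translate[OF i]
  have "(LINT x|lborel. \<bar>?i (x + h n) - ?i x\<bar>) = 2 * (LINT x|lborel. max 0 (?i x - ?i (x + h n)))" for n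
  proof -
    have "(LINT x|lborel. \<bar>?i (x + h n) - ?i x\<bar>) =
        (LINT x|lborel. 2 * max 0 (?i x - ?i (x + h n)) + (?i (x + h n) - ?i x))"
      by (intro Bochner_Integration.integral_cong) (auto simp: max_def)
    also have "\<dots> = 2 * (LINT x|lborel. max 0 (?i x - ?i (x + h n)))"
      using i by (subst Bochner_Integration.integral_add) auto
    finally show ?thesis .
  qed
  moreover have "(\<lambda>n. LINT x|lborel. max 0 (?i x - ?i (x + h n))) \<longlonglongrightarrow> (LINT x|(lborel :: 'a measure). (0 :: real))"
  proof (rule integral_dominated_convergence[where w = ?i])
    show "AE x in lborel. (\<lambda>n. max 0 (?i x - ?i (x + h n))) \<longlonglongrightarrow> 0"
    proof (rule AE_I2)
      fix x :: 'a
      have lim: "(\<lambda>n. x + h n) \<longlonglongrightarrow> x" using tendsto_add[OF tendsto_const h, of x] by simp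
      have "\<forall>\<^sub>F n in sequentially. max 0 (?i x - ?i (x + h n)) = 0"
      proof (cases "x \<in> U")
        case True
        from topological_tendstoD[OF lim U True] show ?thesis
          by eventually_elim (use True in simp)
      qed (simp add: indicator_def)
      then show "(\<lambda>n. max 0 (?i x - ?i (x + h n))) \<longlonglongrightarrow> 0"
        by (simp add: tendsto_eventually)
    qed
  qed (use i in \<open>auto simp: indicator_def\<close>)
  ultimately show ?thesis by (auto intro: tendsto_eq_intros)
qed

text \<open>By outer regularity a Borel set of finite measure is close to an open set in measure, which covers
  indicators; linear combinations and limits in the mean give all integrable functions.\<close>

lemma L1_translation_continuous:
  fixes g :: "'a::euclidean_space \<Rightarrow> real"
  assumes "integrable lborel g" and h: "h \<longlonglongrightarrow> 0"
  shows "(\<lambda>n. LINT x|lborel. \<bar>g (x + h n) - g x\<bar>) \<longlonglongrightarrow> 0"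
  using assms(1)
proof (induction rule: integrable_induct)
  case (base A c)
  have A: "A \<in> sets borel" "emeasure lborel A < \<infinity>" using base by auto
  have iA: "integrable lborel (indicat_real A)" using A by simp
  have ind: "(\<lambda>n. LINT x|lborel. \<bar>indicat_real A (x + h n) - indicat_real A x\<bar>) \<longlonglongrightarrow> 0"
  proof (rule L1_translation_approx[OF iA])
    fix e :: real assume e: "0 < e"
    then obtain U where U: "open U" "A \<subseteq> U" "emeasure lborel (U - A) < ennreal e"
      using outer_regular_lborel[OF A(1), of e] by auto
    have "emeasure lborel U = emeasure lborel A + emeasure lborel (U - A)"
      using U A by (subst plus_emeasure) (auto simp: Un_absorb1)
    also have "\<dots> < \<infinity>" using A U by (auto simp: less_top[symmetric])
    finally have fU: "emeasure lborel U < \<infinity>" .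
    have "(LINT x|lborel. \<bar>indicat_real A x - indicat_real U x\<bar>) = (LINT x|lborel. indicat_real (U - A) x)"
      using U(2) by (intro Bochner_Integration.integral_cong) (auto simp: indicator_def)
    also have "\<dots> = measure lborel (U - A)" by simp
    also have "\<dots> < e" using U(3) e
      by (metis emeasure_eq_ennreal_measure ennreal_less_iff infinity_ennreal_def measure_nonneg order.strict_trans2 top_greatest order_less_irrefl)
    finally show "\<exists>u. integrable lborel u \<and> (LINT x|lborel. \<bar>indicat_real A x - u x\<bar>) < e \<and>
       (\<lambda>n. LINT x|lborel. \<bar>u (x + h n) - u x\<bar>) \<longlonglongrightarrow> 0"
      using L1_translation_open[OF U(1) fU h] fU U(1) by (intro exI[of _ "indicat_real U"]) simp
  qed
  have "\<bar>indicat_real A (x + h n) *\<^sub>R c - indicat_real A x *\<^sub>R c\<bar> =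
      \<bar>c\<bar> * \<bar>indicat_real A (x + h n) - indicat_real A x\<bar>" for x n
    by (simp add: indicator_def)
  then show ?case using tendsto_mult_left[OF ind, of "\<bar>c\<bar>"] by simp
next
  case (add u v)
  note [simp] = add(1,2) lborel_integral_translate(1)
  show ?case
  proof (rule tendsto_sandwich[of "\<lambda>_. 0" _ _ "\<lambda>n. (LINT x|lborel. \<bar>u (x + h n) - u x\<bar>) + (LINT x|lborel. \<bar>v (x + h n) - v x\<bar>)"])
    show "\<forall>\<^sub>F n in sequentially. (LINT x|lborel. \<bar>u (x + h n) + v (x + h n) - (u x + v x)\<bar>)
      \<le> (LINT x|lborel. \<bar>u (x + h n) - u x\<bar>) + (LINT x|lborel. \<bar>v (x + h n) - v x\<bar>)"
    proof (intro always_eventually allI)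
      fix n
      have "(LINT x|lborel. \<bar>u (x + h n) + v (x + h n) - (u x + v x)\<bar>)
          \<le> (LINT x|lborel. \<bar>u (x + h n) - u x\<bar> + \<bar>v (x + h n) - v x\<bar>)"
        by (intro integral_mono) auto
      then show "(LINT x|lborel. \<bar>u (x + h n) + v (x + h n) - (u x + v x)\<bar>)
          \<le> (LINT x|lborel. \<bar>u (x + h n) - u x\<bar>) + (LINT x|lborel. \<bar>v (x + h n) - v x\<bar>)"
        by simp
    qed
    show "(\<lambda>n. (LINT x|lborel. \<bar>u (x + h n) - u x\<bar>) + (LINT x|lborel. \<bar>v (x + h n) - v x\<bar>)) \<longlonglongrightarrow> 0"
      using tendsto_add[OF add(3,4)] by simp
  qed auto
next
  case (lim g s)
  show ?case
  proof (rule L1_translation_approx)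
    fix e :: real assume e: "0 < e"
    have [measurable]: "g \<in> borel_measurable borel" using lim by simp
    have [measurable]: "s i \<in> borel_measurable borel" for i using lim(1)[of i] by simp
    have "(\<lambda>i. LINT x|lborel. \<bar>g x - s i x\<bar>) \<longlonglongrightarrow> (LINT x|(lborel :: 'a measure). (0::real))"
    proof (rule integral_dominated_convergence[where w = "\<lambda>x. 3 * \<bar>g x\<bar>"])
      show "AE x in lborel. (\<lambda>i. \<bar>g x - s i x\<bar>) \<longlonglongrightarrow> 0"
        using lim(2) by (auto intro!: AE_I2 tendsto_eq_intros)
      show "AE x in lborel. norm \<bar>g x - s i x\<bar> \<le> 3 * \<bar>g x\<bar>" for i
      proof (rule AE_I2)
        fix x :: 'a show "norm \<bar>g x - s i x\<bar> \<le> 3 * \<bar>g x\<bar>" using lim(3)[of x i] by simp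
      qed
    qed (use lim in auto)
    from LIMSEQ_D[OF this e] obtain i where "(LINT x|lborel. \<bar>g x - s i x\<bar>) < e"
      by (auto simp: abs_less_iff)
    then show "\<exists>u. integrable lborel u \<and> (LINT x|lborel. \<bar>g x - u x\<bar>) < e \<and>
       (\<lambda>n. LINT x|lborel. \<bar>u (x + h n) - u x\<bar>) \<longlonglongrightarrow> 0"
      using lim(1,5) by blast
  qed (use lim in auto)
qed

section \<open>Products of measures with densities\<close>

text \<open>A substitution rule for one coordinate extends to finite products by applying it to one coordinate
  after the other, with Tonelli's theorem.\<close>

lemma nn_integral_PiM_change:
  fixes \<nu> \<mu> :: "'a measure" and w :: "'a \<Rightarrow> ennreal"
  assumes "sigma_finite_measure \<nu>" "sigma_finite_measure \<mu>"
    and T[measurable]: "T \<in> \<mu> \<rightarrow>\<^sub>M \<nu>" and w[measurable]: "w \<in> borel_measurable \<mu>"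
    and eq: "\<And>g. g \<in> borel_measurable \<nu> \<Longrightarrow> (\<integral>\<^sup>+v. g v \<partial>\<nu>) = (\<integral>\<^sup>+v. w v * g (T v) \<partial>\<mu>)"
    and "finite (I :: 'i set)" and "g \<in> borel_measurable (PiM I (\<lambda>_. \<nu>))"
  shows "(\<integral>\<^sup>+x. g x \<partial>PiM I (\<lambda>_. \<nu>)) =
     (\<integral>\<^sup>+y. (\<Prod>i\<in>I. w (y i)) * g (\<lambda>i\<in>I. T (y i)) \<partial>PiM I (\<lambda>_. \<mu>))"
  using \<open>finite I\<close> \<open>g \<in> _\<close>
proof (induction I arbitrary: g rule: finite_induct)
  case empty
  show ?case by (simp add: PiM_empty nn_integral_count_space_finite)
next
  case (insert i I)
  interpret \<nu>: product_sigma_finite "\<lambda>_::'i. \<nu>" by (rule product_sigma_finite.intro) fact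
  interpret \<mu>: product_sigma_finite "\<lambda>_::'i. \<mu>" by (rule product_sigma_finite.intro) fact
  interpret \<mu>1: sigma_finite_measure \<mu> by fact
  note g[measurable] = insert.prems
  have "(\<integral>\<^sup>+x. g x \<partial>PiM (insert i I) (\<lambda>_. \<nu>)) = (\<integral>\<^sup>+x. (\<integral>\<^sup>+v. g (x(i := v)) \<partial>\<nu>) \<partial>PiM I (\<lambda>_. \<nu>))"
    by (rule \<nu>.product_nn_integral_insert) (use insert in auto)
  also have "\<dots> = (\<integral>\<^sup>+x. (\<integral>\<^sup>+v. w v * g (x(i := T v)) \<partial>\<mu>) \<partial>PiM I (\<lambda>_. \<nu>))"
    by (intro nn_integral_cong eq) measurable
  also have "\<dots> = (\<integral>\<^sup>+y. (\<Prod>j\<in>I. w (y j)) * (\<integral>\<^sup>+v. w v * g ((\<lambda>j\<in>I. T (y j))(i := T v)) \<partial>\<mu>) \<partial>PiM I (\<lambda>_. \<mu>))"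
    by (rule insert.IH) measurable
  also have "\<dots> = (\<integral>\<^sup>+y. (\<integral>\<^sup>+v. (\<Prod>j\<in>insert i I. w ((y(i := v)) j)) *
       g (\<lambda>j\<in>insert i I. T ((y(i := v)) j)) \<partial>\<mu>) \<partial>PiM I (\<lambda>_. \<mu>))"
  proof (intro nn_integral_cong)
    fix y assume y[measurable]: "y \<in> space (PiM I (\<lambda>_. \<mu>))"
    have 1: "(\<Prod>j\<in>insert i I. w ((y(i := v)) j)) = w v * (\<Prod>j\<in>I. w (y j))" for v
    proof -
      have "(\<Prod>j\<in>I. w ((y(i := v)) j)) = (\<Prod>j\<in>I. w (y j))"
        using insert.hyps by (intro prod.cong) auto
      then show ?thesis using insert.hyps by simp
    qed
    have 2: "(\<lambda>j\<in>insert i I. T ((y(i := v)) j)) = (\<lambda>j\<in>I. T (y j))(i := T v)" for v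
      using insert.hyps by (auto simp: restrict_def)
    have [measurable]: "(\<lambda>j\<in>I. T (y j)) \<in> space (PiM I (\<lambda>_. \<nu>))"
      using y measurable_space[OF T] by (auto simp: space_PiM PiE_iff)
    have m: "(\<lambda>v. w v * g ((\<lambda>j\<in>I. T (y j))(i := T v))) \<in> borel_measurable \<mu>" by measurable
    show "(\<Prod>j\<in>I. w (y j)) * (\<integral>\<^sup>+v. w v * g ((\<lambda>j\<in>I. T (y j))(i := T v)) \<partial>\<mu>) =
        (\<integral>\<^sup>+v. (\<Prod>j\<in>insert i I. w ((y(i := v)) j)) * g (\<lambda>j\<in>insert i I. T ((y(i := v)) j)) \<partial>\<mu>)"
      unfolding 1 2 nn_integral_cmult[OF m, symmetric] by (intro nn_integral_cong) (simp add: ac_simps)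
  qed
  also have "\<dots> = (\<integral>\<^sup>+y. (\<Prod>j\<in>insert i I. w (y j)) * g (\<lambda>j\<in>insert i I. T (y j)) \<partial>PiM (insert i I) (\<lambda>_. \<mu>))"
    by (rule \<mu>.product_nn_integral_insert[symmetric]) (use insert in auto)
  finally show ?case .
qed

lemma sigma_finite_density_real:
  fixes f :: "'a::euclidean_space \<Rightarrow> real"
  assumes "f \<in> borel_measurable borel"
  shows "sigma_finite_measure (density lborel (\<lambda>x. ennreal (f x)))"
  using assms by (intro sigma_finite_measure.sigma_finite_iff_density_finite[THEN iffD2])
    (auto intro: lborel.sigma_finite_measure_axioms)

text \<open>The points of a sample are expressed through their displacements from \<open>c\<close> in units of \<open>r\<close>; each
  point contributes one Jacobian \<open>r ^ DIM('a)\<close>.\<close>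

lemma nn_integral_PiM_density_affine:
  fixes f :: "'a::euclidean_space \<Rightarrow> real" and c :: 'a
  assumes [measurable]: "f \<in> borel_measurable borel" and f: "\<And>x. 0 \<le> f x"
    and r: "0 < r" and I: "finite (I :: 'i set)"
    and g: "g \<in> borel_measurable (PiM I (\<lambda>_. borel))"
  shows "(\<integral>\<^sup>+x. g x \<partial>PiM I (\<lambda>_. density lborel (\<lambda>x. ennreal (f x)))) =
     ennreal (r ^ (DIM('a) * card I)) *
     (\<integral>\<^sup>+y. ennreal (\<Prod>i\<in>I. f (c + r *\<^sub>R y i)) * g (\<lambda>i\<in>I. c + r *\<^sub>R y i) \<partial>PiM I (\<lambda>_. lborel))"
proof -
  let ?\<nu> = "density lborel (\<lambda>x. ennreal (f x))"
  let ?w = "\<lambda>y. ennreal (r ^ DIM('a)) * ennreal (f (c + r *\<^sub>R y))"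
  have [measurable_cong]: "sets (PiM I (\<lambda>_. lborel :: 'a measure)) = sets (PiM I (\<lambda>_. borel :: 'a measure))"
    by (intro sets_PiM_cong) auto
  have \<nu>: "sigma_finite_measure ?\<nu>" by (rule sigma_finite_density_real) simp
  have g': "g \<in> borel_measurable (PiM I (\<lambda>_. ?\<nu>))"
    using g by (subst measurable_cong_sets[OF sets_PiM_cong[OF refl] refl]) auto
  have "(\<integral>\<^sup>+x. g x \<partial>PiM I (\<lambda>_. ?\<nu>)) =
     (\<integral>\<^sup>+y. (\<Prod>i\<in>I. ?w (y i)) * g (\<lambda>i\<in>I. c + r *\<^sub>R y i) \<partial>PiM I (\<lambda>_. lborel))"
  proof (rule nn_integral_PiM_change[OF \<nu> _ _ _ _ I g'])
    fix u :: "'a \<Rightarrow> ennreal" assume "u \<in> borel_measurable ?\<nu>"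
    then have [measurable]: "u \<in> borel_measurable borel" by simp
    show "(\<integral>\<^sup>+v. u v \<partial>?\<nu>) = (\<integral>\<^sup>+v. ?w v * u (c + r *\<^sub>R v) \<partial>lborel)"
    proof -
      have "(\<integral>\<^sup>+v. u v \<partial>?\<nu>) = (\<integral>\<^sup>+v. ennreal (f v) * u v \<partial>lborel)"
        by (rule nn_integral_density) auto
      also have "\<dots> = ennreal (r ^ DIM('a)) * (\<integral>\<^sup>+v. ennreal (f (c + r *\<^sub>R v)) * u (c + r *\<^sub>R v) \<partial>lborel)"
        by (rule nn_integral_lborel_affine) (use r in auto)
      also have "\<dots> = (\<integral>\<^sup>+v. ?w v * u (c + r *\<^sub>R v) \<partial>lborel)"
        unfolding mult.assoc by (rule nn_integral_cmult[symmetric]) auto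
      finally show ?thesis .
    qed
  qed (auto intro: lborel.sigma_finite_measure_axioms)
  also have "\<dots> = (\<integral>\<^sup>+y. ennreal (r ^ (DIM('a) * card I)) *
      (ennreal (\<Prod>i\<in>I. f (c + r *\<^sub>R y i)) * g (\<lambda>i\<in>I. c + r *\<^sub>R y i)) \<partial>PiM I (\<lambda>_. lborel))"
    using f r by (intro nn_integral_cong)
      (simp add: prod.distrib prod_ennreal ennreal_power power_mult mult.assoc)
  also have "\<dots> = ennreal (r ^ (DIM('a) * card I)) *
     (\<integral>\<^sup>+y. ennreal (\<Prod>i\<in>I. f (c + r *\<^sub>R y i)) * g (\<lambda>i\<in>I. c + r *\<^sub>R y i) \<partial>PiM I (\<lambda>_. lborel))"
  proof (intro nn_integral_cmult)
    note g[measurable]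
    show "(\<lambda>y. ennreal (\<Prod>i\<in>I. f (c + r *\<^sub>R y i)) * g (\<lambda>i\<in>I. c + r *\<^sub>R y i))
        \<in> borel_measurable (PiM I (\<lambda>_. lborel))"
      by measurable
  qed
  finally show ?thesis .
qed

text \<open>By Tonelli, a set is null as soon as its sections in one coordinate are.\<close>

lemma AE_PiM_section:
  fixes \<nu> :: "'a measure"
  assumes "sigma_finite_measure \<nu>" and I: "finite (I :: 'i set)" "i \<in> I"
    and P[measurable]: "Measurable.pred (PiM I (\<lambda>_. \<nu>)) P"
    and ae: "\<And>y. AE v in \<nu>. P (y(i := v))"
  shows "AE y in PiM I (\<lambda>_. \<nu>). P y"
proof -
  interpret \<nu>: product_sigma_finite "\<lambda>_::'i. \<nu>" by (rule product_sigma_finite.intro) fact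
  let ?g = "\<lambda>y. of_bool (\<not> P y) :: ennreal"
  have ins: "insert i (I - {i}) = I" using I by auto
  have [measurable]: "?g \<in> borel_measurable (PiM I (\<lambda>_. \<nu>))"
  proof -
    have "?g = indicator {y. \<not> P y}" by (auto simp: indicator_def)
    then show ?thesis by (simp add: borel_measurable_indicator_iff)
  qed
  have "(\<integral>\<^sup>+y. ?g y \<partial>PiM I (\<lambda>_. \<nu>)) = (\<integral>\<^sup>+y. (\<integral>\<^sup>+v. ?g (y(i := v)) \<partial>\<nu>) \<partial>PiM (I - {i}) (\<lambda>_. \<nu>))"
    using \<nu>.product_nn_integral_insert[of "I - {i}" i ?g] I unfolding ins by simp
  also have "\<dots> = (\<integral>\<^sup>+y. 0 \<partial>PiM (I - {i}) (\<lambda>_. \<nu>))"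
  proof (intro nn_integral_cong)
    fix y
    have "(\<integral>\<^sup>+v. ?g (y(i := v)) \<partial>\<nu>) = (\<integral>\<^sup>+v. 0 \<partial>\<nu>)"
      using ae[of y] by (intro nn_integral_cong_AE) auto
    then show "(\<integral>\<^sup>+v. ?g (y(i := v)) \<partial>\<nu>) = 0" by simp
  qed
  finally have "(\<integral>\<^sup>+y. ?g y \<partial>PiM I (\<lambda>_. \<nu>)) = 0" by simp
  then have "AE y in PiM I (\<lambda>_. \<nu>). ?g y = 0"
    by (subst (asm) nn_integral_0_iff_AE) auto
  then show ?thesis by eventually_elim simp
qed

lemma AE_PiM_distinct_coords:
  fixes \<nu> :: "'a measure" and u :: "'a \<Rightarrow> real"
  assumes \<nu>: "sigma_finite_measure \<nu>" and I: "finite (I :: 'i set)"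
    and u[measurable]: "u \<in> borel_measurable \<nu>" and ae: "\<And>c. AE v in \<nu>. u v \<noteq> c"
  shows "AE y in PiM I (\<lambda>_. \<nu>). inj_on (\<lambda>i. u (y i)) I \<and> (\<forall>i\<in>I. u (y i) \<noteq> c)"
proof -
  have "AE y in PiM I (\<lambda>_. \<nu>). u (y i) \<noteq> u (y j)" if ij: "i \<in> I" "j \<in> I" "i \<noteq> j" for i j
  proof (rule AE_PiM_section[OF \<nu> I ij(1)])
    note ij(1,2)[measurable]
    have [measurable]: "(\<lambda>y. u (y i)) \<in> borel_measurable (PiM I (\<lambda>_. \<nu>))"
      "(\<lambda>y. u (y j)) \<in> borel_measurable (PiM I (\<lambda>_. \<nu>))"
      by measurable
    show "Measurable.pred (PiM I (\<lambda>_. \<nu>)) (\<lambda>y. u (y i) \<noteq> u (y j))"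
      unfolding neq_iff by measurable
  qed (use ij ae in auto)
  then have "AE y in PiM I (\<lambda>_. \<nu>). \<forall>i\<in>I. \<forall>j\<in>I. i \<noteq> j \<longrightarrow> u (y i) \<noteq> u (y j)"
    using I by (intro AE_finite_allI) auto
  moreover have "AE y in PiM I (\<lambda>_. \<nu>). u (y i) \<noteq> c" if i: "i \<in> I" for i
  proof (rule AE_PiM_section[OF \<nu> I i])
    note i[measurable]
    have [measurable]: "(\<lambda>y. u (y i)) \<in> borel_measurable (PiM I (\<lambda>_. \<nu>))"
      by measurable
    show "Measurable.pred (PiM I (\<lambda>_. \<nu>)) (\<lambda>y. u (y i) \<noteq> c)" by measurable
  qed (use i ae in auto)
  then have "AE y in PiM I (\<lambda>_. \<nu>). \<forall>i\<in>I. u (y i) \<noteq> c"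
    using I by (intro AE_finite_allI) auto
  ultimately show ?thesis by eventually_elim (auto simp: inj_on_def)
qed

lemma first_coord_measurable[measurable]: "first_coord \<in> borel_measurable borel"
  unfolding first_coord_def[abs_def] by measurable

lemma AE_first_coord_neq: "AE v in lborel. first_coord (v :: real ^ 'd::{finite, linorder}) \<noteq> c"
proof -
  let ?H = "{v :: real ^ 'd::{finite, linorder}. axis (Min UNIV) 1 \<bullet> v = c}"
  have "negligible {v :: real ^ 'd::{finite, linorder}. v \<bullet> axis (Min UNIV) 1 = c}"
    by (rule negligible_standard_hyperplane) (auto simp: axis_in_Basis_iff)
  then have "?H \<in> null_sets lebesgue" by (simp add: negligible_iff_null_sets inner_commute)
  moreover have "?H \<in> sets lborel" by measurable
  ultimately have "?H \<in> null_sets lborel" by (simp add: null_sets_completion_iff)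
  then have "AE v in lborel. v \<notin> ?H" by (rule AE_not_in)
  then show ?thesis by eventually_elim (simp add: first_coord_def inner_axis')
qed

section \<open>Products of translates of a bounded density\<close>

lemma abs_prod_diff_le:
  fixes a b :: "'i \<Rightarrow> real"
  assumes "finite I" and K: "1 \<le> K"
    and "\<And>i. i \<in> I \<Longrightarrow> 0 \<le> a i \<and> a i \<le> K" "\<And>i. i \<in> I \<Longrightarrow> 0 \<le> b i \<and> b i \<le> K"
  shows "\<bar>(\<Prod>i\<in>I. a i) - (\<Prod>i\<in>I. b i)\<bar> \<le> K ^ card I * (\<Sum>i\<in>I. \<bar>a i - b i\<bar>)"
proof -
  \<comment> \<open>Division by \<open>K\<close> reduces the claim to factors in the unit interval.\<close>
  have nz: "K \<noteq> 0" "K > 0" using K by auto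
  have le: "\<bar>(\<Prod>i\<in>I. a i / K) - (\<Prod>i\<in>I. b i / K)\<bar> \<le> (\<Sum>i\<in>I. \<bar>a i / K - b i / K\<bar>)"
    using norm_prod_diff[of I "\<lambda>i. a i / K" "\<lambda>i. b i / K"] assms nz by simp
  have "(\<Prod>i\<in>I. a i) - (\<Prod>i\<in>I. b i) = K ^ card I * ((\<Prod>i\<in>I. a i / K) - (\<Prod>i\<in>I. b i / K))"
    using nz by (simp add: prod_dividef right_diff_distrib)
  then have "\<bar>(\<Prod>i\<in>I. a i) - (\<Prod>i\<in>I. b i)\<bar> = K ^ card I * \<bar>(\<Prod>i\<in>I. a i / K) - (\<Prod>i\<in>I. b i / K)\<bar>"
    using nz by (simp add: abs_mult)
  also have "\<dots> \<le> K ^ card I * (\<Sum>i\<in>I. \<bar>a i / K - b i / K\<bar>)"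
    using le nz by (intro mult_left_mono) auto
  also have "\<dots> \<le> K ^ card I * (\<Sum>i\<in>I. \<bar>a i - b i\<bar>)"
  proof (intro mult_left_mono sum_mono)
    fix i
    have "\<bar>a i / K - b i / K\<bar> = \<bar>a i - b i\<bar> / K"
      using nz by (simp add: diff_divide_distrib[symmetric])
    also have "\<dots> \<le> \<bar>a i - b i\<bar> / 1" using K by (intro divide_left_mono) auto
    finally show "\<bar>a i / K - b i / K\<bar> \<le> \<bar>a i - b i\<bar>" by simp
  qed (use nz in auto)
  finally show ?thesis .
qed

text \<open>Off the boundary of \<open>A\<close> the indicator is locally constant, so the integrand is eventually \<open>0\<close> almost
  everywhere.\<close>

lemma shifted_indicator_integral:
  fixes f :: "'a::euclidean_space \<Rightarrow> real"
  assumes f: "integrable lborel f" and A: "open A" "emeasure lborel (frontier A) = 0"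
    and v: "v \<longlonglongrightarrow> 0"
  shows "(\<lambda>n. LINT x|lborel. f x * \<bar>indicat_real A (x + v n) - indicat_real A x\<bar>) \<longlonglongrightarrow> 0"
proof -
  have [measurable]: "A \<in> sets borel" "f \<in> borel_measurable borel" using A f by auto
  have "(\<lambda>n. LINT x|lborel. f x * \<bar>indicat_real A (x + v n) - indicat_real A x\<bar>)
      \<longlonglongrightarrow> (LINT x|(lborel :: 'a measure). (0 :: real))"
  proof (rule integral_dominated_convergence[where w = "\<lambda>x. norm (f x)"])
    have "frontier A \<in> null_sets lborel"
      using A(2) by (simp add: null_sets_def borel_closed)
    then have "AE x in lborel. x \<notin> frontier A" by (rule AE_not_in)
    then show "AE x in lborel. (\<lambda>n. f x * \<bar>indicat_real A (x + v n) - indicat_real A x\<bar>) \<longlonglongrightarrow> 0"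
    proof eventually_elim
      case (elim x)
      have lim: "(\<lambda>n. x + v n) \<longlonglongrightarrow> x" using tendsto_add[OF tendsto_const v, of x] by simp
      have "\<forall>\<^sub>F n in sequentially. f x * \<bar>indicat_real A (x + v n) - indicat_real A x\<bar> = 0"
      proof (cases "x \<in> A")
        case True
        from topological_tendstoD[OF lim A(1) True] show ?thesis
          by eventually_elim (use True in simp)
      next
        case False
        then have "x \<in> - closure A" using elim A(1) by (simp add: frontier_def interior_open)
        from topological_tendstoD[OF lim _ this] have "\<forall>\<^sub>F n in sequentially. x + v n \<in> - closure A"
          by (simp add: open_Compl)
        then show ?thesis
          by eventually_elim (use False closure_subset in \<open>auto simp: indicator_def\<close>)
      qed
      then show ?case by (simp add: tendsto_eventually)
    qed
    show "AE x in lborel. norm (f x * \<bar>indicat_real A (x + v n) - indicat_real A x\<bar>) \<le> norm (f x)" for n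
      by (intro AE_I2) (auto simp: indicator_def)
  qed (use f in auto)
  then show ?thesis by simp
qed

text \<open>As \<open>f\<close> is bounded, replacing the factors \<open>f (x + h n i)\<close> by \<open>f x\<close> costs at most a constant times the
  sum of the \<open>L\<^sup>1\<close> distances between \<open>f\<close> and its translates. The shift in the indicator of \<open>A\<close>
  is treated separately, with \<open>f\<close> as the dominating function.\<close>

lemma shifted_product_integral:
  fixes f :: "'a::euclidean_space \<Rightarrow> real"
  assumes f: "integrable lborel f" "\<And>x. 0 \<le> f x" "\<And>x. f x \<le> K" and K: "1 \<le> K"
    and A: "open A" "emeasure lborel (frontier A) = 0"
    and I: "finite I" and h: "\<And>i. i \<in> I \<Longrightarrow> (\<lambda>n. h n i) \<longlonglongrightarrow> 0" and v: "v \<longlonglongrightarrow> 0"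
  shows "(\<lambda>n. LINT x|lborel. f x * (\<Prod>i\<in>I. f (x + h n i)) * indicat_real A (x + v n)) \<longlonglongrightarrow>
     (LINT x|lborel. f x ^ Suc (card I) * indicat_real A x)"
proof -
  let ?F = "\<lambda>n x. f x * (\<Prod>i\<in>I. f (x + h n i)) * indicat_real A (x + v n)"
  let ?G = "\<lambda>x. f x ^ Suc (card I) * indicat_real A x"
  let ?m = "card I"
  let ?B = "\<lambda>n x. K ^ Suc ?m * (\<Sum>i\<in>I. \<bar>f (x + h n i) - f x\<bar>) +
      K ^ ?m * (f x * \<bar>indicat_real A (x + v n) - indicat_real A x\<bar>)"
  have [measurable]: "A \<in> sets borel" "f \<in> borel_measurable borel" using A f by auto
  have pK: "(\<Prod>i\<in>I. g i) \<le> K ^ ?m" "0 \<le> (\<Prod>i\<in>I. g i)" if "\<And>i. 0 \<le> g i \<and> g i \<le> K" for g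
    using prod_mono[of I g "\<lambda>_. K"] prod_nonneg[of I g] that by auto
  have iF: "integrable lborel (?F n)" for n
  proof (rule Bochner_Integration.integrable_bound[where f = "\<lambda>x. K ^ ?m * f x"])
    show "AE x in lborel. norm (?F n x) \<le> norm (K ^ ?m * f x)"
    proof (intro AE_I2)
      fix x
      have "norm (?F n x) \<le> f x * (\<Prod>i\<in>I. f (x + h n i)) * 1"
        using f pK[of "\<lambda>i. f (x + h n i)"] by (simp add: indicator_def)
      also have "\<dots> \<le> f x * K ^ ?m"
        using f pK[of "\<lambda>i. f (x + h n i)"] by (auto intro!: mult_left_mono)
      finally show "norm (?F n x) \<le> norm (K ^ ?m * f x)" using f K by (simp add: mult.commute abs_mult)
    qed
  qed (use f in auto)
  have iG: "integrable lborel ?G"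
  proof (rule Bochner_Integration.integrable_bound[where f = "\<lambda>x. K ^ ?m * f x"])
    show "AE x in lborel. norm (?G x) \<le> norm (K ^ ?m * f x)"
    proof (intro AE_I2)
      fix x
      have "norm (?G x) \<le> f x ^ Suc ?m" using f by (simp add: indicator_def)
      also have "\<dots> \<le> K ^ ?m * f x"
        using f power_mono[of "f x" K ?m] by (simp add: mult.commute[of "K ^ ?m"] mult_left_mono)
      finally show "norm (?G x) \<le> norm (K ^ ?m * f x)" using f K by (simp add: abs_mult)
    qed
  qed (use f in auto)
  have iS: "integrable lborel (\<lambda>x. \<bar>f (x + h n i) - f x\<bar>)" for n i
    using f(1) lborel_integral_translate(1)[OF f(1)] by simp
  have iV: "integrable lborel (\<lambda>x. f x * \<bar>indicat_real A (x + v n) - indicat_real A x\<bar>)" for n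
    by (rule Bochner_Integration.integrable_bound[OF f(1)]) (auto simp: indicator_def f(2))
  have le: "\<bar>?F n x - ?G x\<bar> \<le> ?B n x" for n x
  proof -
    let ?P = "\<Prod>i\<in>I. f (x + h n i)"
    have "?F n x - ?G x = f x * ((?P - f x ^ ?m) * indicat_real A (x + v n)) +
        f x ^ ?m * (f x * (indicat_real A (x + v n) - indicat_real A x))"
      by (simp add: algebra_simps)
    also have "\<bar>\<dots>\<bar> \<le> f x * \<bar>?P - f x ^ ?m\<bar> +
        f x ^ ?m * (f x * \<bar>indicat_real A (x + v n) - indicat_real A x\<bar>)"
      using f by (intro order_trans[OF abs_triangle_ineq] add_mono) (auto simp: abs_mult indicator_def)
    also have "\<dots> \<le> K * (K ^ ?m * (\<Sum>i\<in>I. \<bar>f (x + h n i) - f x\<bar>)) +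
        K ^ ?m * (f x * \<bar>indicat_real A (x + v n) - indicat_real A x\<bar>)"
    proof (intro add_mono mult_mono)
      show "\<bar>?P - f x ^ ?m\<bar> \<le> K ^ ?m * (\<Sum>i\<in>I. \<bar>f (x + h n i) - f x\<bar>)"
        using abs_prod_diff_le[OF I K, of "\<lambda>i. f (x + h n i)" "\<lambda>_. f x"] f by simp
    qed (use f K in \<open>auto intro!: power_mono\<close>)
    finally show ?thesis by (simp add: mult.assoc)
  qed
  have "(\<lambda>n. (LINT x|lborel. ?F n x) - (LINT x|lborel. ?G x)) \<longlonglongrightarrow> 0"
  proof (rule tendsto_rabs_zero_cancel, rule tendsto_sandwich[of "\<lambda>_. 0" _ _ "\<lambda>n. LINT x|lborel. ?B n x"])
    have "\<bar>(LINT x|lborel. ?F n x) - (LINT x|lborel. ?G x)\<bar> \<le> (LINT x|lborel. ?B n x)" for n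
    proof -
      have "\<bar>(LINT x|lborel. ?F n x) - (LINT x|lborel. ?G x)\<bar> = \<bar>LINT x|lborel. ?F n x - ?G x\<bar>"
        using iF iG by simp
      also have "\<dots> \<le> (LINT x|lborel. \<bar>?F n x - ?G x\<bar>)" by (rule integral_abs_bound)
      also have "\<dots> \<le> (LINT x|lborel. ?B n x)"
        by (rule integral_mono) (use iF iG iS iV le in auto)
      finally show ?thesis .
    qed
    then show "\<forall>\<^sub>F n in sequentially. \<bar>(LINT x|lborel. ?F n x) - (LINT x|lborel. ?G x)\<bar> \<le> (LINT x|lborel. ?B n x)"
      by simp
    have "(LINT x|lborel. ?B n x) = K ^ Suc ?m * (\<Sum>i\<in>I. LINT x|lborel. \<bar>f (x + h n i) - f x\<bar>) +
      K ^ ?m * (LINT x|lborel. f x * \<bar>indicat_real A (x + v n) - indicat_real A x\<bar>)" for n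
      using iS iV by simp
    moreover have "(\<lambda>n. K ^ Suc ?m * (\<Sum>i\<in>I. LINT x|lborel. \<bar>f (x + h n i) - f x\<bar>) +
      K ^ ?m * (LINT x|lborel. f x * \<bar>indicat_real A (x + v n) - indicat_real A x\<bar>))
      \<longlonglongrightarrow> K ^ Suc ?m * (\<Sum>i\<in>I. 0) + K ^ ?m * 0"
      using L1_translation_continuous[OF f(1) h] shifted_indicator_integral[OF f(1) A v]
      by (intro tendsto_intros) auto
    ultimately show "(\<lambda>n. LINT x|lborel. ?B n x) \<longlonglongrightarrow> 0" by simp
  qed auto
  then show ?thesis by (simp add: LIM_zero_iff)
qed

section \<open>Rescaling a configuration of points\<close>

lemma pred_close_pairs:
  fixes z :: "'o \<Rightarrow> nat \<Rightarrow> 'a::euclidean_space"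
  assumes "\<And>i. i \<in> {1..k} \<Longrightarrow> (\<lambda>\<omega>. z \<omega> i) \<in> borel_measurable N"
  shows "Measurable.pred N (\<lambda>\<omega>. close_pairs k r (z \<omega>) = T)"
proof -
  have eq: "close_pairs k r (z \<omega>) = T \<longleftrightarrow> T \<subseteq> index_pairs k \<and>
      (\<forall>e\<in>index_pairs k. e \<in> T \<longleftrightarrow> (\<forall>i\<in>e. \<forall>j\<in>e. dist (z \<omega> i) (z \<omega> j) \<le> r))" for \<omega>
    by (auto simp: close_pairs_def)
  have m: "Measurable.pred N (\<lambda>\<omega>. dist (z \<omega> i) (z \<omega> j) \<le> r)"
    if "e \<in> index_pairs k" "i \<in> e" "j \<in> e" for e i j
  proof -
    have "i \<in> {1..k}" "j \<in> {1..k}" using that by (auto simp: index_pairs_def)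
    from this[THEN assms, measurable] show ?thesis by measurable
  qed
  have fin: "finite e" if "e \<in> index_pairs k" for e
    using that finite_subset by (fastforce simp: index_pairs_def)
  show ?thesis
    unfolding eq
    by (intro pred_intros_logic pred_intros_finite finite_index_pairs fin m) auto
qed

lemma leftmost_in_image_iff:
  "leftmost_in A (z ` J) \<longleftrightarrow>
     (\<exists>i\<in>J. z i \<in> A \<and> (\<forall>j\<in>J. z j = z i \<or> first_coord (z i) < first_coord (z j)))"
  unfolding leftmost_in_def by (auto; blast)

lemma pred_leftmost_in:
  fixes z :: "'o \<Rightarrow> nat \<Rightarrow> real ^ 'd::{finite, linorder}"
  assumes A[measurable]: "A \<in> sets borel" and J: "finite J"
    and "\<And>i. i \<in> J \<Longrightarrow> (\<lambda>\<omega>. z \<omega> i) \<in> borel_measurable N"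
  shows "Measurable.pred N (\<lambda>\<omega>. leftmost_in A (z \<omega> ` J))"
proof -
  have "Measurable.pred N (\<lambda>\<omega>. z \<omega> i \<in> A)" if "i \<in> J" for i
    using assms(3)[OF that, measurable] by measurable
  moreover have "Measurable.pred N (\<lambda>\<omega>. z \<omega> j = z \<omega> i)"
      "Measurable.pred N (\<lambda>\<omega>. first_coord (z \<omega> i) < first_coord (z \<omega> j))"
    if "i \<in> J" "j \<in> J" for i j
  proof -
    note that[THEN assms(3), measurable]
    have "Measurable.pred N (\<lambda>\<omega>. dist (z \<omega> j) (z \<omega> i) \<le> 0)" by measurable
    then show "Measurable.pred N (\<lambda>\<omega>. z \<omega> j = z \<omega> i)" by simp
    show "Measurable.pred N (\<lambda>\<omega>. first_coord (z \<omega> i) < first_coord (z \<omega> j))" by measurable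
  qed
  ultimately show ?thesis
    unfolding leftmost_in_image_iff by (intro pred_intros_logic pred_intros_finite J) auto
qed

lemma close_pairs_cong:
  "(\<And>i. i \<in> {1..k} \<Longrightarrow> x i = y i) \<Longrightarrow> close_pairs k s x = close_pairs k s y"
  unfolding close_pairs_def index_pairs_def by (intro Collect_cong) (auto simp: subset_iff)

lemma close_pairs_affine:
  fixes c :: "'a::euclidean_space"
  assumes "0 < r" "\<And>i. i \<in> {1..k} \<Longrightarrow> z i = c + r *\<^sub>R y i"
  shows "close_pairs k r z = close_pairs k 1 y"
proof -
  have "dist (z i) (z j) \<le> r \<longleftrightarrow> dist (y i) (y j) \<le> 1" if "i \<in> {1..k}" "j \<in> {1..k}" for i j
  proof -
    have "dist (z i) (z j) = r * dist (y i) (y j)"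
      using assms that by (simp add: dist_norm scaleR_diff_right[symmetric])
    then show ?thesis using assms(1) by simp
  qed
  then show ?thesis unfolding close_pairs_def index_pairs_def by blast
qed

text \<open>Which point is left-most depends only on the shape \<open>y\<close>, so that the condition concerns
  a single shifted point. The assumption on \<open>y\<close> excludes ties.\<close>

lemma leftmost_in_affine:
  fixes x :: "real ^ 'd::{finite, linorder}"
  assumes r: "0 < r" and j: "j \<in> J" "\<And>i. i \<in> J \<Longrightarrow> i \<noteq> j \<Longrightarrow> first_coord (y j) < first_coord (y i)"
  shows "leftmost_in A ((\<lambda>i. x + r *\<^sub>R y i) ` J) \<longleftrightarrow> x + r *\<^sub>R y j \<in> A"
proof -
  have fc: "first_coord (x + r *\<^sub>R y i) = first_coord x + r * first_coord (y i)" for i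
    by (simp add: first_coord_def)
  have lt: "first_coord (x + r *\<^sub>R y j) < first_coord (x + r *\<^sub>R y i)" if "i \<in> J" "i \<noteq> j" for i
    using r j(2)[OF that] by (simp add: fc)
  show ?thesis
    unfolding leftmost_in_image_iff
  proof
    assume "x + r *\<^sub>R y j \<in> A"
    then show "\<exists>i\<in>J. x + r *\<^sub>R y i \<in> A \<and> (\<forall>j\<in>J. x + r *\<^sub>R y j = x + r *\<^sub>R y i \<or>
        first_coord (x + r *\<^sub>R y i) < first_coord (x + r *\<^sub>R y j))"
      using j(1) lt by (intro bexI[of _ j]) auto
  next
    assume "\<exists>i\<in>J. x + r *\<^sub>R y i \<in> A \<and> (\<forall>j\<in>J. x + r *\<^sub>R y j = x + r *\<^sub>R y i \<or>
        first_coord (x + r *\<^sub>R y i) < first_coord (x + r *\<^sub>R y j))"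
    then obtain i where i: "i \<in> J" "x + r *\<^sub>R y i \<in> A"
      "x + r *\<^sub>R y j = x + r *\<^sub>R y i \<or> first_coord (x + r *\<^sub>R y i) < first_coord (x + r *\<^sub>R y j)"
      using j(1) by blast
    have "i = j"
      using i lt[of i] by (metis less_asym less_irrefl)
    with i show "x + r *\<^sub>R y j \<in> A" by simp
  qed
qed

text \<open>A point is joined to the base point by a path whose edges have length at most \<open>1\<close>. The bound
  may be taken from one fixed path in \<open>T\<close>, hence is uniform over all configurations with pattern \<open>T\<close>.\<close>

lemma connected_close_pairs_bounded:
  assumes conn: "connected_graph ({1..k}, T)" and k: "1 \<le> k"
  shows "\<exists>R. \<forall>(y :: nat \<Rightarrow> 'a::euclidean_space) i. y k = 0 \<longrightarrow> close_pairs k 1 y = T \<longrightarrow>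
    i \<in> {1..k} \<longrightarrow> norm (y i) \<le> R i"
proof -
  have path: "\<exists>R. \<forall>y :: nat \<Rightarrow> 'a. close_pairs k 1 y = T \<longrightarrow> dist (y u) (y v) \<le> R"
    if "(u, v) \<in> {(x, y). {x, y} \<in> T}\<^sup>*" for u v
    using that
  proof (induction rule: rtrancl_induct)
    case base
    show ?case by (intro exI[of _ 0]) simp
  next
    case (step v w)
    then obtain R where R: "\<And>y :: nat \<Rightarrow> 'a. close_pairs k 1 y = T \<Longrightarrow> dist (y u) (y v) \<le> R"
      by blast
    have "dist (y u) (y w) \<le> R + 1" if y: "close_pairs k 1 y = T" for y :: "nat \<Rightarrow> 'a"
    proof -
      have "dist (y v) (y w) \<le> 1" using step(2) y by (auto simp: close_pairs_def)
      then show ?thesis using R[OF y] dist_triangle[of "y u" "y w" "y v"] by linarith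
    qed
    then show ?case by blast
  qed
  have "\<forall>i\<in>{1..k}. \<exists>R. \<forall>y :: nat \<Rightarrow> 'a. close_pairs k 1 y = T \<longrightarrow> dist (y i) (y k) \<le> R"
    using conn k by (intro ballI path) (auto simp: connected_graph_def)
  then have "\<exists>R. \<forall>i\<in>{1..k}. \<forall>y :: nat \<Rightarrow> 'a. close_pairs k 1 y = T \<longrightarrow> dist (y i) (y k) \<le> R i"
    by (rule bchoice)
  then obtain R where R: "\<forall>i\<in>{1..k}. \<forall>y :: nat \<Rightarrow> 'a. close_pairs k 1 y = T \<longrightarrow> dist (y i) (y k) \<le> R i" ..
  show ?thesis
  proof (intro exI[of _ R] allI impI)
    fix y :: "nat \<Rightarrow> 'a" and i
    assume "y k = 0" "close_pairs k 1 y = T" "i \<in> {1..k}"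
    with R have "dist (y i) 0 \<le> R i" by metis
    then show "norm (y i) \<le> R i" by simp
  qed
qed

section \<open>The probability of a pattern of close pairs\<close>

lemma borel_measurable_of_bool_pred:
  "Measurable.pred N P \<Longrightarrow> (\<lambda>\<omega>. of_bool (P \<omega>) :: 'b::{topological_space, zero_neq_one}) \<in> borel_measurable N"
  unfolding of_bool_def by measurable

definition pattern_prob ::
  "(real ^ 'd::{finite, linorder} \<Rightarrow> real) \<Rightarrow> (real ^ 'd::{finite, linorder}) set \<Rightarrow> nat \<Rightarrow> nat set set \<Rightarrow> real \<Rightarrow> real"
where
  "pattern_prob f A k T r =
     measure (PiM {1..k} (\<lambda>_. density lborel (\<lambda>x. ennreal (f x))))
       {x \<in> space (PiM {1..k} (\<lambda>_. density lborel (\<lambda>x. ennreal (f x)))).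
          close_pairs k r x = T \<and> leftmost_in A (x ` {1..k})}"

text \<open>Up to the Jacobian, the density at the displacements \<open>y\<close>, in units of \<open>r\<close> from the point with
  index \<open>k\<close>, of configurations with left-most point in \<open>A\<close>; the position \<open>x\<close> of the point with
  index \<open>k\<close> is integrated out. The update \<open>y(k := 0)\<close> adds this point to the configuration.\<close>

definition rescaled_density ::
  "(real ^ 'd::{finite, linorder} \<Rightarrow> real) \<Rightarrow> (real ^ 'd::{finite, linorder}) set \<Rightarrow> nat \<Rightarrow> real \<Rightarrow> (nat \<Rightarrow> real ^ 'd::{finite, linorder}) \<Rightarrow> real"
where
  "rescaled_density f A k r y = (LINT x|lborel. f x * (\<Prod>i\<in>{1..k - 1}. f (x + r *\<^sub>R y i)) *
     of_bool (leftmost_in A ((\<lambda>i. x + r *\<^sub>R (y(k := 0)) i) ` {1..k})))"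

text \<open>The base point \<open>0\<close> gets the index \<open>k\<close>, so that the free points keep the indices \<open>{1..k - 1}\<close>
  over which \<open>mu\<close> and \<open>mu'\<close> integrate.\<close>

definition pattern_volume :: "(real ^ 'd::{finite, linorder}) itself \<Rightarrow> nat \<Rightarrow> nat set set \<Rightarrow> real" where
  "pattern_volume _ k T =
     measure (PiM {1..k - 1} (\<lambda>_. lborel))
       {y \<in> space (PiM {1..k - 1} (\<lambda>_. lborel :: (real ^ 'd::{finite, linorder}) measure)). close_pairs k 1 (y(k := 0)) = T}"

lemma rescaled_coordinate_measurable:
  fixes k :: nat and r :: real
  assumes "i \<in> {1..k}"
  shows "(\<lambda>w. fst w + r *\<^sub>R ((snd w)(k := 0 :: 'a::euclidean_space)) i) \<in> borel_measurable (lborel \<Otimes>\<^sub>M PiM {1..k - 1} (\<lambda>_. lborel))"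
    "(\<lambda>y. (y(k := 0 :: 'a)) i) \<in> borel_measurable (PiM {1..k - 1} (\<lambda>_. lborel))"
proof -
  have "i = k \<or> i \<in> {1..k - 1}" using assms by (cases "i = k") auto
  then show "(\<lambda>w. fst w + r *\<^sub>R ((snd w)(k := 0 :: 'a)) i) \<in> borel_measurable (lborel \<Otimes>\<^sub>M PiM {1..k - 1} (\<lambda>_. lborel))"
    "(\<lambda>y. (y(k := 0 :: 'a)) i) \<in> borel_measurable (PiM {1..k - 1} (\<lambda>_. lborel))"
  proof (atomize(full), elim disjE)
    assume "i = k"
    then show "(\<lambda>w. fst w + r *\<^sub>R ((snd w)(k := 0 :: 'a)) i) \<in> borel_measurable (lborel \<Otimes>\<^sub>M PiM {1..k - 1} (\<lambda>_. lborel))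
      \<and> (\<lambda>y. (y(k := 0 :: 'a)) i) \<in> borel_measurable (PiM {1..k - 1} (\<lambda>_. lborel))"
      by simp
  next
    assume i[measurable]: "i \<in> {1..k - 1}"
    then have ne: "i \<noteq> k" using assms by auto
    have c[measurable]: "(\<lambda>y. y i) \<in> borel_measurable (PiM {1..k - 1} (\<lambda>_. lborel :: 'a measure))"
      using measurable_component_singleton[OF i, of "\<lambda>_. lborel :: 'a measure"] by simp
    have [measurable]: "(\<lambda>w. snd w i) \<in> borel_measurable (lborel \<Otimes>\<^sub>M PiM {1..k - 1} (\<lambda>_. lborel :: 'a measure))"
      by (rule measurable_compose[OF measurable_snd c])
    show "(\<lambda>w. fst w + r *\<^sub>R ((snd w)(k := 0 :: 'a)) i) \<in> borel_measurable (lborel \<Otimes>\<^sub>M PiM {1..k - 1} (\<lambda>_. lborel))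
      \<and> (\<lambda>y. (y(k := 0 :: 'a)) i) \<in> borel_measurable (PiM {1..k - 1} (\<lambda>_. lborel))"
      unfolding fun_upd_other[OF ne] by (intro conjI) measurable
  qed
qed

lemma rescaled_density_measurable:
  fixes f :: "real ^ 'd::{finite, linorder} \<Rightarrow> real"
  assumes [measurable]: "f \<in> borel_measurable borel" "A \<in> sets borel"
  shows "rescaled_density f A k r \<in> borel_measurable (PiM {1..k - 1} (\<lambda>_. lborel))"
    "(\<lambda>w. f (fst w) * (\<Prod>i\<in>{1..k - 1}. f (fst w + r *\<^sub>R snd w i)) *
     of_bool (leftmost_in A ((\<lambda>i. fst w + r *\<^sub>R ((snd w)(k := 0)) i) ` {1..k}))) \<in>
     borel_measurable (lborel \<Otimes>\<^sub>M PiM {1..k - 1} (\<lambda>_. lborel))" (is "?F \<in> _")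
proof -
  have [measurable]: "(\<lambda>w. of_bool (leftmost_in A ((\<lambda>i. fst w + r *\<^sub>R ((snd w)(k := 0)) i) ` {1..k})) :: real)
      \<in> borel_measurable (lborel \<Otimes>\<^sub>M PiM {1..k - 1} (\<lambda>_. lborel))"
    using rescaled_coordinate_measurable(1)[where k = k and r = r]
    by (intro borel_measurable_of_bool_pred pred_leftmost_in) auto
  show F[measurable]: "?F \<in> borel_measurable (lborel \<Otimes>\<^sub>M PiM {1..k - 1} (\<lambda>_. lborel))"
    by measurable
  have "(\<lambda>w. ?F (snd w, fst w)) \<in> borel_measurable (PiM {1..k - 1} (\<lambda>_. lborel) \<Otimes>\<^sub>M lborel)"
    by measurable
  then have "(\<lambda>y. LINT x|lborel. ?F (x, y)) \<in> borel_measurable (PiM {1..k - 1} (\<lambda>_. lborel))"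
    by (intro lborel.borel_measurable_lebesgue_integral) (simp add: case_prod_unfold)
  then show "rescaled_density f A k r \<in> borel_measurable (PiM {1..k - 1} (\<lambda>_. lborel))"
    unfolding rescaled_density_def[abs_def] by simp
qed

lemma rescaled_density_bound:
  fixes f :: "real ^ 'd::{finite, linorder} \<Rightarrow> real"
  assumes f: "integrable lborel f" "\<And>x. 0 \<le> f x" "\<And>x. f x \<le> K" and A: "A \<in> sets borel"
    and y: "y \<in> space (PiM {1..k - 1} (\<lambda>_. lborel :: (real ^ 'd::{finite, linorder}) measure))"
  shows "integrable lborel (\<lambda>x. f x * (\<Prod>i\<in>{1..k - 1}. f (x + r *\<^sub>R y i)) *
     of_bool (leftmost_in A ((\<lambda>i. x + r *\<^sub>R (y(k := 0)) i) ` {1..k})))" (is "integrable _ ?F")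
    and "0 \<le> rescaled_density f A k r y"
    and "rescaled_density f A k r y \<le> K ^ (k - 1) * (LINT x|lborel. f x)"
proof -
  have [measurable]: "f \<in> borel_measurable borel" using f by simp
  note y[measurable]
  have mF: "?F \<in> borel_measurable lborel"
    using measurable_compose[OF measurable_Pair2'[OF y, of "lborel :: (real ^ 'd::{finite, linorder}) measure"]
        rescaled_density_measurable(2)[where f = f and A = A and k = k and r = r]] A
    by simp
  have pos: "0 \<le> ?F x" for x using f by (auto intro!: mult_nonneg_nonneg prod_nonneg)
  have le: "?F x \<le> K ^ (k - 1) * f x" for x
  proof -
    have "(\<Prod>i\<in>{1..k - 1}. f (x + r *\<^sub>R y i)) \<le> (\<Prod>i\<in>{1..k - 1}. K)"
      using f by (intro prod_mono) auto
    then have "f x * (\<Prod>i\<in>{1..k - 1}. f (x + r *\<^sub>R y i)) \<le> f x * K ^ (k - 1)"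
      using f by (intro mult_left_mono) auto
    moreover have "?F x \<le> f x * (\<Prod>i\<in>{1..k - 1}. f (x + r *\<^sub>R y i))"
      using f by (auto simp: of_bool_def intro!: mult_nonneg_nonneg prod_nonneg)
    ultimately show ?thesis by (simp add: mult.commute)
  qed
  show int: "integrable lborel ?F"
  proof (rule Bochner_Integration.integrable_bound[where f = "\<lambda>x. K ^ (k - 1) * f x"])
    show "integrable lborel (\<lambda>x. K ^ (k - 1) * f x)" using f by simp
    show "AE x in lborel. norm (?F x) \<le> norm (K ^ (k - 1) * f x)"
    proof (intro AE_I2)
      fix x show "norm (?F x) \<le> norm (K ^ (k - 1) * f x)"
        unfolding real_norm_def using pos[of x] le[of x] by linarith
    qed
  qed (rule mF)
  show "0 \<le> rescaled_density f A k r y"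
    unfolding rescaled_density_def using pos by (intro integral_nonneg_AE AE_I2)
  show "rescaled_density f A k r y \<le> K ^ (k - 1) * (LINT x|lborel. f x)"
    unfolding rescaled_density_def integral_mult_right_zero[symmetric]
    by (rule integral_mono[OF int]) (use f le in auto)
qed

text \<open>Substituting \<open>x\<^sub>i = x\<^sub>k + r y\<^sub>i\<close> turns the pattern at scale \<open>r\<close> into the pattern of \<open>y\<close> at scale \<open>1\<close>.
  It no longer involves \<open>x\<^sub>k\<close>, and by Tonelli the integral over \<open>x\<^sub>k\<close> can be taken first.\<close>

lemma pattern_emeasure:
  fixes f :: "real ^ 'd::{finite, linorder} \<Rightarrow> real"
  assumes f: "integrable lborel f" "\<And>x. 0 \<le> f x" "\<And>x. f x \<le> K" and A: "A \<in> sets borel"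
    and r: "0 < r" and k: "1 \<le> k"
  shows "emeasure (PiM {1..k} (\<lambda>_. density lborel (\<lambda>x. ennreal (f x))))
       {x \<in> space (PiM {1..k} (\<lambda>_. density lborel (\<lambda>x. ennreal (f x)))).
          close_pairs k r x = T \<and> leftmost_in A (x ` {1..k})} =
     ennreal (r ^ (CARD('d) * (k - 1))) *
     (\<integral>\<^sup>+y. ennreal (of_bool (close_pairs k 1 (y(k := 0)) = T) * rescaled_density f A k r y)
        \<partial>PiM {1..k - 1} (\<lambda>_. lborel))"
proof -
  let ?\<nu> = "density lborel (\<lambda>x. ennreal (f x)) :: (real ^ 'd::{finite, linorder}) measure"
  let ?I = "{1..k - 1}"
  let ?L = "PiM ?I (\<lambda>_. lborel :: (real ^ 'd::{finite, linorder}) measure)"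
  let ?g = "\<lambda>x. of_bool (close_pairs k r x = T \<and> leftmost_in A (x ` {1..k})) :: ennreal"
  have [measurable]: "f \<in> borel_measurable borel" using f by simp
  note A[measurable]
  have \<nu>: "sigma_finite_measure ?\<nu>" by (rule sigma_finite_density_real) simp
  interpret \<nu>: product_sigma_finite "\<lambda>_::nat. ?\<nu>" by (rule product_sigma_finite.intro) (rule \<nu>)
  interpret l: product_sigma_finite "\<lambda>_::nat. lborel :: (real ^ 'd::{finite, linorder}) measure" ..
  interpret L: sigma_finite_measure ?L by (rule l.sigma_finite) simp
  interpret P: pair_sigma_finite lborel ?L ..
  have ins: "insert k ?I = {1..k}" and kI: "k \<notin> ?I" using k by auto
  have comp: "(\<lambda>x. x i) \<in> borel_measurable (PiM {1..k} (\<lambda>_. ?\<nu>))" if "i \<in> {1..k}" for i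
    using measurable_component_singleton[OF that, of "\<lambda>_. ?\<nu>"] by simp
  have pr[measurable]: "Measurable.pred (PiM {1..k} (\<lambda>_. ?\<nu>)) (\<lambda>x. close_pairs k r x = T \<and> leftmost_in A (x ` {1..k}))"
    using comp by (intro pred_intros_logic pred_close_pairs pred_leftmost_in) auto
  have g: "?g \<in> borel_measurable (PiM {1..k} (\<lambda>_. ?\<nu>))"
    by (rule borel_measurable_of_bool_pred[OF pr])
  have sets_eq: "sets (PiM J (\<lambda>_. ?\<nu>)) = sets (PiM J (\<lambda>_. borel))" for J :: "nat set"
    by (intro sets_PiM_cong) auto
  have g': "(\<lambda>z. ?g (z(k := x))) \<in> borel_measurable (PiM ?I (\<lambda>_. borel))" for x
  proof -
    have "(\<lambda>z. z(k := x)) \<in> PiM ?I (\<lambda>_. ?\<nu>) \<rightarrow>\<^sub>M PiM (insert k ?I) (\<lambda>_. ?\<nu>)"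
      by measurable
    from measurable_compose[OF this[unfolded ins] g]
    show ?thesis by (subst (asm) measurable_cong_sets[OF sets_eq refl])
  qed
  have agree: "?g ((\<lambda>i\<in>?I. x + r *\<^sub>R y i)(k := x)) =
      ennreal (of_bool (close_pairs k 1 (y(k := 0)) = T) *
        of_bool (leftmost_in A ((\<lambda>i. x + r *\<^sub>R (y(k := 0)) i) ` {1..k})))" for x y
  proof -
    let ?z = "(\<lambda>i\<in>?I. x + r *\<^sub>R y i)(k := x)"
    have z: "?z i = x + r *\<^sub>R (y(k := 0)) i" if "i \<in> {1..k}" for i
      using that by auto
    have 1: "close_pairs k r ?z = close_pairs k 1 (y(k := 0))"
      by (rule close_pairs_affine[OF r z])
    have 2: "?z ` {1..k} = (\<lambda>i. x + r *\<^sub>R (y(k := 0)) i) ` {1..k}"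
      by (rule image_cong[OF refl z])
    show ?thesis unfolding 1 2 by (simp add: of_bool_def)
  qed
  define H :: "(real ^ 'd::{finite, linorder}) \<times> (nat \<Rightarrow> real ^ 'd::{finite, linorder}) \<Rightarrow> real" where
    "H = (\<lambda>w. (\<Prod>i\<in>?I. f (fst w + r *\<^sub>R snd w i)) * (of_bool (close_pairs k 1 ((snd w)(k := 0)) = T) *
        of_bool (leftmost_in A ((\<lambda>i. fst w + r *\<^sub>R ((snd w)(k := 0)) i) ` {1..k}))))"
  have [measurable]: "(\<lambda>w. of_bool (leftmost_in A ((\<lambda>i. fst w + r *\<^sub>R ((snd w)(k := 0)) i) ` {1..k})) :: real)
      \<in> borel_measurable (lborel \<Otimes>\<^sub>M ?L)"
    using rescaled_coordinate_measurable(1)[where k = k and r = r]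
    by (intro borel_measurable_of_bool_pred pred_leftmost_in) auto
  have [measurable]: "(\<lambda>w. of_bool (close_pairs k 1 ((snd w)(k := 0)) = T) :: real)
      \<in> borel_measurable (lborel \<Otimes>\<^sub>M ?L)"
    by (intro borel_measurable_of_bool_pred pred_close_pairs
        measurable_compose[OF measurable_snd rescaled_coordinate_measurable(2)])
  have [measurable]: "H \<in> borel_measurable (lborel \<Otimes>\<^sub>M ?L)" unfolding H_def by measurable
  have "emeasure (PiM {1..k} (\<lambda>_. ?\<nu>)) {x \<in> space (PiM {1..k} (\<lambda>_. ?\<nu>)).
      close_pairs k r x = T \<and> leftmost_in A (x ` {1..k})} = (\<integral>\<^sup>+x. ?g x \<partial>PiM {1..k} (\<lambda>_. ?\<nu>))"
    by (subst nn_integral_indicator[OF predE[OF pr], symmetric])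
      (rule nn_integral_cong, simp add: indicator_def)
  also have "\<dots> = (\<integral>\<^sup>+x. (\<integral>\<^sup>+z. ?g (z(k := x)) \<partial>PiM ?I (\<lambda>_. ?\<nu>)) \<partial>?\<nu>)"
    using \<nu>.product_nn_integral_insert_rev[OF _ kI] g unfolding ins by simp
  also have "\<dots> = (\<integral>\<^sup>+x. ennreal (r ^ (CARD('d) * (k - 1))) * (\<integral>\<^sup>+y. ennreal (\<Prod>i\<in>?I. f (x + r *\<^sub>R y i)) *
      ?g ((\<lambda>i\<in>?I. x + r *\<^sub>R y i)(k := x)) \<partial>?L) \<partial>?\<nu>)"
    by (intro nn_integral_cong, subst nn_integral_PiM_density_affine[OF _ f(2) r _ g']) auto
  also have "\<dots> = (\<integral>\<^sup>+x. ennreal (r ^ (CARD('d) * (k - 1))) * (\<integral>\<^sup>+y. ennreal (H (x, y)) \<partial>?L) \<partial>?\<nu>)"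
  proof (intro nn_integral_cong arg_cong2[where f = "(*)"] refl)
    fix x and y :: "nat \<Rightarrow> real ^ 'd::{finite, linorder}"
    have "0 \<le> (\<Prod>i\<in>?I. f (x + r *\<^sub>R y i))" using f by (intro prod_nonneg) auto
    then show "ennreal (\<Prod>i\<in>?I. f (x + r *\<^sub>R y i)) * ?g ((\<lambda>i\<in>?I. x + r *\<^sub>R y i)(k := x)) = ennreal (H (x, y))"
      unfolding agree H_def fst_conv snd_conv by (simp add: ennreal_mult[symmetric] mult.assoc del: fun_upd_apply)
  qed
  also have "\<dots> = (\<integral>\<^sup>+x. ennreal (f x) * (ennreal (r ^ (CARD('d) * (k - 1))) * (\<integral>\<^sup>+y. ennreal (H (x, y)) \<partial>?L)) \<partial>lborel)"
    by (rule nn_integral_density) measurable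
  also have "\<dots> = ennreal (r ^ (CARD('d) * (k - 1))) * (\<integral>\<^sup>+x. (\<integral>\<^sup>+y. ennreal (f x) * ennreal (H (x, y)) \<partial>?L) \<partial>lborel)"
  proof -
    have "(\<integral>\<^sup>+y. ennreal (f x) * ennreal (H (x, y)) \<partial>?L) = ennreal (f x) * (\<integral>\<^sup>+y. ennreal (H (x, y)) \<partial>?L)" for x
      by (rule nn_integral_cmult) measurable
    then show ?thesis
      by (simp only: mult.left_commute[of "ennreal (f _)"]) (rule nn_integral_cmult, measurable)
  qed
  also have "\<dots> = ennreal (r ^ (CARD('d) * (k - 1))) * (\<integral>\<^sup>+y. (\<integral>\<^sup>+x. ennreal (f x) * ennreal (H (x, y)) \<partial>lborel) \<partial>?L)"
  proof -
    have m: "(\<lambda>(x, y). ennreal (f x) * ennreal (H (x, y))) \<in> borel_measurable (lborel \<Otimes>\<^sub>M ?L)"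
      unfolding case_prod_unfold prod.collapse by measurable
    show ?thesis unfolding P.Fubini'[OF m] ..
  qed
  also have "\<dots> = ennreal (r ^ (CARD('d) * (k - 1))) * (\<integral>\<^sup>+y. ennreal (of_bool (close_pairs k 1 (y(k := 0)) = T) *
      rescaled_density f A k r y) \<partial>?L)"
  proof (intro arg_cong2[where f = "(*)"] refl nn_integral_cong)
    fix y assume y: "y \<in> space ?L"
    note F = rescaled_density_bound[OF f A y, of r]
    let ?c = "of_bool (close_pairs k 1 (y(k := 0)) = T) :: real"
    let ?F = "\<lambda>x. f x * (\<Prod>i\<in>{1..k - 1}. f (x + r *\<^sub>R y i)) *
     of_bool (leftmost_in A ((\<lambda>i. x + r *\<^sub>R (y(k := 0)) i) ` {1..k}))"
    have "(\<integral>\<^sup>+x. ennreal (f x) * ennreal (H (x, y)) \<partial>lborel) = (\<integral>\<^sup>+x. ennreal (?c * ?F x) \<partial>lborel)"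
      using f unfolding H_def fst_conv snd_conv
      by (intro nn_integral_cong) (simp add: ennreal_mult'[symmetric] mult_ac del: fun_upd_apply)
    also have "\<dots> = ennreal (LINT x|lborel. ?c * ?F x)"
      using f by (intro nn_integral_eq_integral integrable_mult_right F(1) AE_I2)
        (auto intro!: mult_nonneg_nonneg prod_nonneg)
    also have "(LINT x|lborel. ?c * ?F x) = ?c * rescaled_density f A k r y"
      unfolding rescaled_density_def by simp
    finally show "(\<integral>\<^sup>+x. ennreal (f x) * ennreal (H (x, y)) \<partial>lborel) = ennreal (?c * rescaled_density f A k r y)" .
  qed
  finally show ?thesis .
qed

lemma finite_pattern_volume:
  assumes conn: "connected_graph ({1..k}, T)" and k: "1 \<le> k"
  shows "emeasure (PiM {1..k - 1} (\<lambda>_. lborel))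
       {y \<in> space (PiM {1..k - 1} (\<lambda>_. lborel :: 'a::euclidean_space measure)). close_pairs k 1 (y(k := 0)) = T} < \<infinity>"
    (is "emeasure ?L ?U < _")
proof -
  interpret l: product_sigma_finite "\<lambda>_::nat. lborel :: 'a measure" ..
  obtain R where "\<forall>(y :: nat \<Rightarrow> 'a) i. y k = 0 \<longrightarrow> close_pairs k 1 y = T \<longrightarrow>
    i \<in> {1..k} \<longrightarrow> norm (y i) \<le> R i"
    using connected_close_pairs_bounded[OF conn k] ..
  then have R: "norm (y i) \<le> R i"
    if "y k = 0" "close_pairs k 1 y = T" "i \<in> {1..k}" for y :: "nat \<Rightarrow> 'a" and i
    using that by blast
  have "?U \<subseteq> PiE {1..k - 1} (\<lambda>i. cball 0 (R i))"
  proof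
    fix y assume y: "y \<in> ?U"
    have "norm (y i) \<le> R i" if "i \<in> {1..k - 1}" for i
    proof -
      have "i \<in> {1..k}" "i \<noteq> k" using that k by auto
      then show ?thesis using R[of "y(k := 0)" i] y by simp
    qed
    then show "y \<in> PiE {1..k - 1} (\<lambda>i. cball 0 (R i))"
      using y by (auto simp: space_PiM PiE_iff)
  qed
  then have "emeasure ?L ?U \<le> emeasure ?L (PiE {1..k - 1} (\<lambda>i. cball 0 (R i)))"
    by (intro emeasure_mono sets_PiM_I_finite) auto
  also have "\<dots> = (\<Prod>i\<in>{1..k - 1}. emeasure lborel (cball (0 :: 'a) (R i)))"
    by (rule l.emeasure_PiM) auto
  also have "\<dots> < \<infinity>"
    using emeasure_lborel_cball_finite[where c = "0 :: 'a"]
    by (simp add: ennreal_prod_eq_top less_top[symmetric])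
  finally show ?thesis .
qed

text \<open>Distinct and nonzero first coordinates, which almost every configuration has, rule out ties for the
  left-most point also when the base point \<open>0\<close> is included.\<close>

lemma first_coord_extend_inj:
  fixes y :: "nat \<Rightarrow> real ^ 'd::{finite, linorder}"
  assumes k: "1 \<le> k"
    and y: "inj_on (\<lambda>i. first_coord (y i)) {1..k - 1}" "\<forall>i\<in>{1..k - 1}. first_coord (y i) \<noteq> 0"
  shows "inj_on (\<lambda>i. first_coord ((y(k := 0)) i)) {1..k}"
proof -
  have fc0: "first_coord (0 :: real ^ 'd::{finite, linorder}) = 0" by (simp add: first_coord_def)
  have ins: "{1..k} = insert k {1..k - 1}" using k by auto
  show ?thesis unfolding ins using y fc0 by (auto simp: inj_on_def)
qed

text \<open>For a shape without ties the left-most point has a fixed index \<open>j\<close>, so the integrand is a product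
  of translates of \<open>f\<close> with one translate of the indicator of \<open>A\<close>, all by shifts of order \<open>r\<close>.\<close>

lemma rescaled_density_tendsto:
  fixes f :: "real ^ 'd::{finite, linorder} \<Rightarrow> real"
  assumes f: "integrable lborel f" "\<And>x. 0 \<le> f x" "\<And>x. f x \<le> K" and K: "1 \<le> K"
    and A: "open A" "emeasure lborel (frontier A) = 0" and k: "1 \<le> k"
    and r: "\<And>n. 0 < r n" "r \<longlonglongrightarrow> 0"
    and y: "inj_on (\<lambda>i. first_coord (y i)) {1..k - 1}" "\<forall>i\<in>{1..k - 1}. first_coord (y i) \<noteq> 0"
  shows "(\<lambda>n. rescaled_density f A k (r n) y) \<longlonglongrightarrow> (LINT x:A|lborel. f x ^ k)"
proof -
  let ?y = "y(k := 0)"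
  have inj: "inj_on (\<lambda>i. first_coord (?y i)) {1..k}"
    by (rule first_coord_extend_inj[OF k y])
  obtain j where j: "j \<in> {1..k}" "\<And>i. i \<in> {1..k} \<Longrightarrow> first_coord (?y j) \<le> first_coord (?y i)"
    using ex_is_arg_min_if_finite[of "{1..k}" "\<lambda>i. first_coord (?y i)"] k
    unfolding is_arg_min_linorder by auto
  have lt: "first_coord (?y j) < first_coord (?y i)" if "i \<in> {1..k}" "i \<noteq> j" for i
    using j(2)[OF that(1)] inj_onD[OF inj _ that(1) j(1)] that(2) by fastforce
  \<comment> \<open>\<open>y k\<close> is replaced by \<open>0\<close>, so \<open>j = k\<close> means that the base point itself is left-most.\<close>
  have lm: "of_bool (leftmost_in A ((\<lambda>i. x + r n *\<^sub>R ?y i) ` {1..k})) = indicat_real A (x + r n *\<^sub>R ?y j)" for n x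
    by (subst leftmost_in_affine[where y = ?y, OF r(1) j(1) lt]) (simp_all add: indicator_def)
  have "rescaled_density f A k (r n) y =
      (LINT x|lborel. f x * (\<Prod>i\<in>{1..k - 1}. f (x + r n *\<^sub>R y i)) * indicat_real A (x + r n *\<^sub>R ?y j))" for n
    unfolding rescaled_density_def lm ..
  moreover have "(\<lambda>n. LINT x|lborel. f x * (\<Prod>i\<in>{1..k - 1}. f (x + r n *\<^sub>R y i)) * indicat_real A (x + r n *\<^sub>R ?y j))
      \<longlonglongrightarrow> (LINT x|lborel. f x ^ Suc (card {1..k - 1}) * indicat_real A x)"
  proof (rule shifted_product_integral[OF f K A])
    have "(\<lambda>n. r n *\<^sub>R v) \<longlonglongrightarrow> 0" for v :: "real ^ 'd::{finite, linorder}"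
      using tendsto_scaleR[OF r(2) tendsto_const, of v] by simp
    then show "(\<lambda>n. r n *\<^sub>R y i) \<longlonglongrightarrow> 0" "(\<lambda>n. r n *\<^sub>R ?y j) \<longlonglongrightarrow> 0" for i by auto
  qed simp
  moreover have "(LINT x|lborel. f x ^ Suc (card {1..k - 1}) * indicat_real A x) = (LINT x:A|lborel. f x ^ k)"
    using k unfolding set_lebesgue_integral_def by (simp add: mult.commute)
  ultimately show ?thesis by simp
qed

text \<open>Dominated convergence over the shapes \<open>y\<close>: connectedness of \<open>T\<close> gives a bounded, hence
  finite-volume, domain, on which the rescaled densities are uniformly bounded.\<close>

lemma pattern_prob_tendsto:
  fixes f :: "real ^ 'd::{finite, linorder} \<Rightarrow> real"
  assumes f: "integrable lborel f" "\<And>x. 0 \<le> f x" "\<And>x. f x \<le> K" and K: "1 \<le> K"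
    and A: "open A" "emeasure lborel (frontier A) = 0" and k: "1 \<le> k"
    and r: "\<And>n. 0 < r n" "r \<longlonglongrightarrow> 0" and conn: "connected_graph ({1..k}, T)"
  shows "(\<lambda>n. pattern_prob f A k T (r n) / r n ^ (CARD('d) * (k - 1))) \<longlonglongrightarrow>
     (LINT x:A|lborel. f x ^ k) * pattern_volume TYPE(real ^ 'd::{finite, linorder}) k T"
proof -
  let ?L = "PiM {1..k - 1} (\<lambda>_. lborel :: (real ^ 'd::{finite, linorder}) measure)"
  let ?U = "{y \<in> space ?L. close_pairs k 1 (y(k := 0)) = T}"
  let ?c = "\<lambda>y. indicat_real ?U y"
  let ?b = "K ^ (k - 1) * (LINT x|lborel. f x)"
  have Ab: "A \<in> sets borel" using A by simp
  have fb: "f \<in> borel_measurable borel" using f by simp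
  have U[measurable]: "?U \<in> sets ?L"
    by (rule predE[OF pred_close_pairs[OF rescaled_coordinate_measurable(2)]])
  have fin: "emeasure ?L ?U < \<infinity>" by (rule finite_pattern_volume[OF conn k])
  note bd = rescaled_density_bound[OF f Ab]
  note m[measurable] = rescaled_density_measurable(1)[OF fb Ab]
  have b: "0 \<le> ?b" using f K by (intro mult_nonneg_nonneg integral_nonneg_AE) auto
  have iU: "integrable ?L (\<lambda>y. ?c y * ?b)"
    by (rule integrable_mult_left[OF integrable_real_indicator[OF U fin]])
  have bound: "norm (?c y * rescaled_density f A k s y) \<le> ?c y * ?b" if "y \<in> space ?L" for s y
    using bd(2,3)[OF that, of s] by (simp add: indicator_def)
  have int: "integrable ?L (\<lambda>y. ?c y * rescaled_density f A k s y)" for s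
  proof (rule Bochner_Integration.integrable_bound[OF iU])
    show "AE y in ?L. norm (?c y * rescaled_density f A k s y) \<le> norm (?c y * ?b)"
    proof (intro AE_I2)
      fix y assume "y \<in> space ?L"
      from bound[OF this, of s] show "norm (?c y * rescaled_density f A k s y) \<le> norm (?c y * ?b)"
        by (rule order_trans) (simp only: real_norm_def abs_ge_self)
    qed
  qed measurable
  have eq: "pattern_prob f A k T (r n) / r n ^ (CARD('d) * (k - 1)) =
      (LINT y|?L. ?c y * rescaled_density f A k (r n) y)" for n
  proof -
    have "(\<integral>\<^sup>+y. ennreal (of_bool (close_pairs k 1 (y(k := 0)) = T) * rescaled_density f A k (r n) y) \<partial>?L)
       = (\<integral>\<^sup>+y. ennreal (?c y * rescaled_density f A k (r n) y) \<partial>?L)"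
      by (intro nn_integral_cong) (simp add: indicator_def)
    also have "\<dots> = ennreal (LINT y|?L. ?c y * rescaled_density f A k (r n) y)"
      using bd(2) by (intro nn_integral_eq_integral int AE_I2) auto
    finally have "pattern_prob f A k T (r n) =
        enn2real (ennreal (r n ^ (CARD('d) * (k - 1))) * ennreal (LINT y|?L. ?c y * rescaled_density f A k (r n) y))"
      unfolding pattern_prob_def measure_def pattern_emeasure[OF f Ab r(1) k] by simp
    moreover have "0 \<le> (LINT y|?L. ?c y * rescaled_density f A k (r n) y)"
      using bd(2) by (intro integral_nonneg_AE AE_I2) auto
    ultimately show ?thesis using r(1)[of n] by (simp add: enn2real_mult)
  qed
  have "(\<lambda>n. LINT y|?L. ?c y * rescaled_density f A k (r n) y) \<longlonglongrightarrow> (LINT y|?L. ?c y * (LINT x:A|lborel. f x ^ k))"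
  proof (rule integral_dominated_convergence[where w = "\<lambda>y. ?c y * ?b"])
    have "AE y in ?L. inj_on (\<lambda>i. first_coord (y i)) {1..k - 1} \<and> (\<forall>i\<in>{1..k - 1}. first_coord (y i) \<noteq> 0)"
      by (rule AE_PiM_distinct_coords[OF lborel.sigma_finite_measure_axioms]) (auto intro: AE_first_coord_neq)
    then show "AE y in ?L. (\<lambda>n. ?c y * rescaled_density f A k (r n) y) \<longlonglongrightarrow> ?c y * (LINT x:A|lborel. f x ^ k)"
      by eventually_elim (intro tendsto_mult tendsto_const rescaled_density_tendsto[OF f K A k r], auto)
    show "AE y in ?L. norm (?c y * rescaled_density f A k (r n) y) \<le> ?c y * ?b" for n
      using bound by (intro AE_I2)
  qed (use iU in measurable)
  also have "(LINT y|?L. ?c y * (LINT x:A|lborel. f x ^ k)) =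
      (LINT x:A|lborel. f x ^ k) * pattern_volume TYPE(real ^ 'd::{finite, linorder}) k T"
  proof -
    have UU: "?U \<inter> space ?L = ?U" by blast
    show ?thesis
      unfolding pattern_volume_def integral_mult_left_zero Bochner_Integration.integral_indicator UU by (rule mult.commute)
  qed
  finally show ?thesis unfolding eq .
qed

section \<open>Counting through index sets\<close>

text \<open>Every set of values is the image of exactly one index set that is canonical in the sense that it
  contains only the least index of each of its values. In this form the formula describes the count
  on the whole sample space, including the event that points coincide.\<close>

lemma card_image_sets_eq_sum:
  fixes x :: "nat \<Rightarrow> 'a"
  shows "real (card {S. S \<subseteq> x ` {1..n} \<and> P S}) =
    (\<Sum>J\<in>Pow {1..n}. of_bool ((\<forall>j\<in>J. \<forall>i\<in>{1..<j}. x i \<noteq> x j) \<and> P (x ` J)))"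
proof -
  define C where "C = {J \<in> Pow {1..n}. (\<forall>j\<in>J. \<forall>i\<in>{1..<j}. x i \<noteq> x j) \<and> P (x ` J)}"
  have sub: "J \<subseteq> J'" if J: "J \<in> C" and J': "J' \<in> C" and eq: "x ` J = x ` J'" for J J'
  proof
    fix j assume j: "j \<in> J"
    then obtain j' where j': "j' \<in> J'" "x j = x j'" using eq by (metis imageE imageI)
    have "\<not> j < j'"
    proof
      assume "j < j'"
      then have "j \<in> {1..<j'}" using J j by (auto simp: C_def)
      then show False using J' j' by (auto simp: C_def)
    qed
    moreover have "\<not> j' < j"
    proof
      assume "j' < j"
      then have "j' \<in> {1..<j}" using J' j' by (auto simp: C_def)
      then show False using J j j'(2)[symmetric] by (auto simp: C_def)
    qed
    ultimately show "j \<in> J'" using j'(1) by (simp add: linorder_neq_iff[symmetric])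
  qed
  have inj: "inj_on ((`) x) C"
    by (intro inj_onI equalityI sub) auto
  have "{S. S \<subseteq> x ` {1..n} \<and> P S} = (`) x ` C"
  proof
    show "(`) x ` C \<subseteq> {S. S \<subseteq> x ` {1..n} \<and> P S}" by (auto simp: C_def)
    show "{S. S \<subseteq> x ` {1..n} \<and> P S} \<subseteq> (`) x ` C"
    proof
      fix S assume "S \<in> {S. S \<subseteq> x ` {1..n} \<and> P S}"
      then have S: "S \<subseteq> x ` {1..n}" "P S" by auto
      define J where "J = {j \<in> {1..n}. x j \<in> S \<and> (\<forall>i\<in>{1..<j}. x i \<noteq> x j)}"
      have "S \<subseteq> x ` J"
      proof
        fix s assume s: "s \<in> S"
        define j where "j = (LEAST j. j \<in> {1..n} \<and> x j = s)"
        have "\<exists>j. j \<in> {1..n} \<and> x j = s" using S(1) s by (metis imageE subsetD)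
        then have j: "j \<in> {1..n}" "x j = s" unfolding j_def by (metis (mono_tags, lifting) LeastI)+
        have "x i \<noteq> x j" if i: "i \<in> {1..<j}" for i
        proof
          assume "x i = x j"
          then have "i \<in> {1..n} \<and> x i = s" using i j by auto
          then have "j \<le> i" unfolding j_def by (rule Least_le)
          then show False using i by simp
        qed
        then show "s \<in> x ` J" using j s by (auto simp: J_def)
      qed
      then have "x ` J = S" by (auto simp: J_def)
      moreover have "J \<in> C" using S \<open>x ` J = S\<close> by (auto simp: C_def J_def)
      ultimately show "S \<in> (`) x ` C" by blast
    qed
  qed
  then have "real (card {S. S \<subseteq> x ` {1..n} \<and> P S}) = real (card C)"
    using card_image[OF inj] by simp
  also have "\<dots> = (\<Sum>J\<in>Pow {1..n}. of_bool ((\<forall>j\<in>J. \<forall>i\<in>{1..<j}. x i \<noteq> x j) \<and> P (x ` J)))"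
  proof -
    have "C = Pow {1..n} \<inter> {J. (\<forall>j\<in>J. \<forall>i\<in>{1..<j}. x i \<noteq> x j) \<and> P (x ` J)}"
      unfolding C_def by blast
    then show ?thesis by (simp only: sum_of_bool_eq finite_Pow_iff finite_atLeastAtMost)
  qed
  finally show ?thesis .
qed

lemma induced_image:
  assumes inj: "inj_on x J" and two: "\<And>d. d \<in> edges G \<Longrightarrow> card d = 2"
  shows "induced G (x ` J) = (x ` J, (`) x ` {e. e \<subseteq> J \<and> card e = 2 \<and> x ` e \<in> edges G})"
proof -
  have "{d \<in> edges G. d \<subseteq> x ` J} = (`) x ` {e. e \<subseteq> J \<and> card e = 2 \<and> x ` e \<in> edges G}"
  proof (intro equalityI subsetI)
    fix d assume d: "d \<in> {d \<in> edges G. d \<subseteq> x ` J}"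
    then have "d \<subseteq> x ` J" and dG: "d \<in> edges G" by auto
    from this(1) obtain e where e: "e \<subseteq> J" "d = x ` e" by (rule subset_imageE)
    have "card e = card d" unfolding e(2) by (rule card_image[OF inj_on_subset[OF inj e(1)], symmetric])
    then have "card e = 2" using two[OF dG] by (rule trans)
    then show "d \<in> (`) x ` {e. e \<subseteq> J \<and> card e = 2 \<and> x ` e \<in> edges G}" using dG e by blast
  next
    fix d assume "d \<in> (`) x ` {e. e \<subseteq> J \<and> card e = 2 \<and> x ` e \<in> edges G}"
    then obtain e where "e \<subseteq> J" "x ` e \<in> edges G" "d = x ` e" by blast
    then show "d \<in> {d \<in> edges G. d \<subseteq> x ` J}" by blast
  qed
  then show ?thesis by (simp add: induced_def)
qed

text \<open>Expressed by finitely many comparisons of distances and marks, membership in the edge set becomes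
  visibly measurable. Equality of points is written as distance at most \<open>0\<close> for this purpose.\<close>

lemma image_in_percolated_edges_iff:
  fixes X :: "nat \<Rightarrow> 'o \<Rightarrow> 'a::metric_space"
  assumes e: "e \<subseteq> {1..n}" "card e = 2"
  shows "(\<lambda>i. X i \<omega>) ` e \<in> edges (percolated_rgg X B r n \<omega>) \<longleftrightarrow>
    (\<forall>a\<in>e. \<forall>c\<in>e. a = c \<or> \<not> dist (X a \<omega>) (X c \<omega>) \<le> 0 \<and> dist (X a \<omega>) (X c \<omega>) \<le> r n) \<and>
    (\<exists>b\<in>index_pairs n. B n b \<omega> \<and> (\<forall>a\<in>b. \<exists>c\<in>e. dist (X a \<omega>) (X c \<omega>) \<le> 0) \<and>
       (\<forall>c\<in>e. \<exists>a\<in>b. dist (X a \<omega>) (X c \<omega>) \<le> 0))"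
proof -
  let ?x = "\<lambda>i. X i \<omega>"
  obtain i j where ij: "e = {i, j}" "i \<noteq> j" using e(2) by (meson card_2_iff)
  have "?x ` e \<in> edges (rgg (sample X n \<omega>) (r n)) \<longleftrightarrow> ?x i \<noteq> ?x j \<and> dist (?x i) (?x j) \<le> r n"
  proof -
    have "?x i \<in> sample X n \<omega>" "?x j \<in> sample X n \<omega>" using e(1) by (auto simp: ij(1) sample_def)
    moreover have "?x ` e = {?x i, ?x j}" by (simp add: ij(1))
    ultimately show ?thesis by (simp add: rgg_edge_iff)
  qed
  then have 1: "?x ` e \<in> edges (rgg (sample X n \<omega>) (r n)) \<longleftrightarrow>
     (\<forall>a\<in>e. \<forall>c\<in>e. a = c \<or> \<not> dist (X a \<omega>) (X c \<omega>) \<le> 0 \<and> dist (X a \<omega>) (X c \<omega>) \<le> r n)"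
    using ij(2) unfolding ij(1) by (auto simp: dist_commute[of "X j \<omega>"])
  have d0: "dist u v \<le> 0 \<longleftrightarrow> u = v" for u v :: 'a by simp
  have 2: "?x ` e = ?x ` b \<longleftrightarrow> (\<forall>a\<in>b. \<exists>c\<in>e. dist (X a \<omega>) (X c \<omega>) \<le> 0) \<and>
       (\<forall>c\<in>e. \<exists>a\<in>b. dist (X a \<omega>) (X c \<omega>) \<le> 0)" for b
  proof -
    have "?x ` e = ?x ` b \<longleftrightarrow> ?x ` b \<subseteq> ?x ` e \<and> ?x ` e \<subseteq> ?x ` b" by (rule set_eq_subset[THEN trans]) (rule conj_commute)
    also have "?x ` b \<subseteq> ?x ` e \<longleftrightarrow> (\<forall>a\<in>b. \<exists>c\<in>e. X a \<omega> = X c \<omega>)"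
      unfolding image_subset_iff image_iff ..
    also have "?x ` e \<subseteq> ?x ` b \<longleftrightarrow> (\<forall>c\<in>e. \<exists>a\<in>b. X a \<omega> = X c \<omega>)"
      unfolding image_subset_iff image_iff by (simp only: eq_commute)
    finally show ?thesis unfolding d0 .
  qed
  have 3: "(\<exists>b. ?x ` e = ?x ` b \<and> b \<in> index_pairs n \<and> B n b \<omega>) \<longleftrightarrow>
      (\<exists>b\<in>index_pairs n. B n b \<omega> \<and> ?x ` e = ?x ` b)" by blast
  show ?thesis unfolding percolated_rgg_def snd_conv Int_iff 1 mem_Collect_eq 3 unfolding 2 ..
qed

lemma percolated_edge_card:
  "d \<in> edges (percolated_rgg X B r n \<omega>) \<Longrightarrow> card d = 2"
  by (auto simp: percolated_rgg_def rgg_def)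

section \<open>Joint law of points and marks\<close>

lemma (in percolated_sample) points_measurable: "1 \<le> i \<Longrightarrow> X i \<in> borel_measurable M"
  using distributed_measurable[OF points_distributed] by simp

lemma (in percolated_sample) marks_measurable:
  "1 \<le> n \<Longrightarrow> b \<in> index_pairs n \<Longrightarrow> Measurable.pred M (B n b)"
  using marks_indep[of n] by (auto simp: indep_vars_def)

lemma (in percolated_sample) prob_space_density: "prob_space (density lborel (\<lambda>x. ennreal (f x)))"
proof -
  have "prob_space (distr M lborel (X 1))"
    using points_measurable[of 1] by (intro prob_space_distr) simp
  then show ?thesis using distributed_distr_eq_density[OF points_distributed[of 1]] by simp
qed

text \<open>Independent identically distributed points have the same joint law along every injective choice
  \<open>\<sigma>\<close> of indices; hence all \<open>k\<close>-element index sets contribute equally.\<close>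

lemma (in percolated_sample) points_joint_distr:
  fixes k n :: nat
  assumes \<sigma>: "inj_on \<sigma> {1..k}" "\<sigma> ` {1..k} \<subseteq> {1..n}" and k: "1 \<le> k"
  shows "distr M (PiM {1..k} (\<lambda>_. borel)) (\<lambda>\<omega>. \<lambda>i\<in>{1..k}. X (\<sigma> i) \<omega>) =
    PiM {1..k} (\<lambda>_. density lborel (\<lambda>x. ennreal (f x)))"
proof -
  let ?\<nu> = "density lborel (\<lambda>x. ennreal (f x))"
  have n: "{1..n} \<noteq> {}" using subsetD[OF \<sigma>(2) imageI, of 1] k by auto
  have one: "distr M borel (X i) = ?\<nu>" if "1 \<le> i" for i
    using distributed_distr_eq_density[OF points_distributed[OF that]]
    by (simp cong: distr_cong)
  have ind: "indep_vars (\<lambda>_. borel) X {1..n}"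
    by (rule indep_vars_subset[OF points_indep]) auto
  have rv: "random_variable borel (X i)" if "i \<in> {1..n}" for i
    using that by (intro points_measurable) auto
  have eqp: "PiM {1..n} (\<lambda>i. distr M borel (X i)) = PiM {1..n} (\<lambda>_. ?\<nu>)"
    by (rule PiM_cong) (use one in auto)
  have full: "distr M (PiM {1..n} (\<lambda>_. borel)) (\<lambda>\<omega>. \<lambda>i\<in>{1..n}. X i \<omega>) = PiM {1..n} (\<lambda>_. ?\<nu>)"
    using indep_vars_iff_distr_eq_PiM'[OF n, where M' = "\<lambda>_. borel" and X = X] rv ind eqp by simp
  have mX: "(\<lambda>\<omega>. \<lambda>i\<in>{1..n}. X i \<omega>) \<in> M \<rightarrow>\<^sub>M PiM {1..n} (\<lambda>_. borel)"
    by (rule measurable_restrict) (rule rv)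
  have se: "sets (PiM J (\<lambda>_. ?\<nu>)) = sets (PiM J (\<lambda>_. borel))" for J :: "nat set"
    by (intro sets_PiM_cong) auto
  have \<sigma>': "\<sigma> \<in> {1..k} \<rightarrow> {1..n}" using \<sigma>(2) by auto
  have mR: "(\<lambda>z. \<lambda>i\<in>{1..k}. z (\<sigma> i)) \<in> PiM {1..n} (\<lambda>_. borel) \<rightarrow>\<^sub>M PiM {1..k} (\<lambda>_. borel :: (real ^ 'b) measure)"
    using \<sigma>' by (intro measurable_restrict measurable_component_singleton) auto
  have "PiM {1..k} (\<lambda>_. ?\<nu>) = distr (PiM {1..n} (\<lambda>_. ?\<nu>)) (PiM {1..k} (\<lambda>_. ?\<nu>)) (\<lambda>z. \<lambda>i\<in>{1..k}. z (\<sigma> i))"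
    using distr_PiM_reindex[of "{1..n}" "\<lambda>_. ?\<nu>" \<sigma> "{1..k}"] prob_space_density \<sigma> \<sigma>' by simp
  also have "\<dots> = distr (PiM {1..n} (\<lambda>_. ?\<nu>)) (PiM {1..k} (\<lambda>_. borel)) (\<lambda>z. \<lambda>i\<in>{1..k}. z (\<sigma> i))"
    using se by (intro distr_cong) auto
  also have "\<dots> = distr M (PiM {1..k} (\<lambda>_. borel)) ((\<lambda>z. \<lambda>i\<in>{1..k}. z (\<sigma> i)) \<circ> (\<lambda>\<omega>. \<lambda>i\<in>{1..n}. X i \<omega>))"
    unfolding full[symmetric] by (rule distr_distr[OF mR mX])
  also have "\<dots> = distr M (PiM {1..k} (\<lambda>_. borel)) (\<lambda>\<omega>. \<lambda>i\<in>{1..k}. X (\<sigma> i) \<omega>)"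
    using \<sigma>' by (intro distr_cong) (auto simp: fun_eq_iff restrict_def)
  finally show ?thesis ..
qed

definition kept_pairs :: "(nat \<Rightarrow> nat set \<Rightarrow> 'o \<Rightarrow> bool) \<Rightarrow> nat \<Rightarrow> (nat \<Rightarrow> nat) \<Rightarrow> nat \<Rightarrow> 'o \<Rightarrow> nat set set" where
  "kept_pairs B n \<sigma> k \<omega> = {e \<in> index_pairs k. B n (\<sigma> ` e) \<omega>}"

lemma image_index_pairs:
  assumes \<sigma>: "inj_on \<sigma> {1..k}" "\<sigma> ` {1..k} \<subseteq> {1..n}" and e: "e \<in> index_pairs k"
  shows "\<sigma> ` e \<in> index_pairs n"
proof -
  have "e \<subseteq> {1..k}" "card e = 2" using e by (auto simp: index_pairs_def)
  then show ?thesis using \<sigma>(2) card_image[OF inj_on_subset[OF \<sigma>(1)], of e]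
    by (auto simp: index_pairs_def)
qed

lemma (in percolated_sample) kept_pairs_prob:
  assumes \<sigma>: "inj_on \<sigma> {1..k}" "\<sigma> ` {1..k} \<subseteq> {1..n}" and k: "2 \<le> k" and n: "1 \<le> n"
    and E: "E \<subseteq> index_pairs k"
  shows "prob {\<omega> \<in> space M. kept_pairs B n \<sigma> k \<omega> = E} = p n ^ card E * (1 - p n) ^ card (index_pairs k - E)"
proof -
  let ?P = "index_pairs k"
  have P: "finite ?P" by (rule finite_index_pairs)
  have "{1, 2} \<in> ?P" using k by (auto simp: index_pairs_def)
  then have ne: "?P \<noteq> {}" by blast
  have injP: "inj_on ((`) \<sigma>) ?P"
    by (rule inj_on_subset[OF inj_on_image_Pow[OF \<sigma>(1)]]) (auto simp: index_pairs_def)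
  have im: "\<sigma> ` e \<in> index_pairs n" if "e \<in> ?P" for e by (rule image_index_pairs[OF \<sigma> that])
  define S where "S b = {v. v = (b \<in> (`) \<sigma> ` E)}" for b
  have S: "B n (\<sigma> ` e) \<omega> \<in> S (\<sigma> ` e) \<longleftrightarrow> (B n (\<sigma> ` e) \<omega> \<longleftrightarrow> e \<in> E)" if "e \<in> ?P" for e \<omega>
    using inj_on_image_mem_iff[OF injP that E] by (simp add: S_def)
  have "{\<omega> \<in> space M. kept_pairs B n \<sigma> k \<omega> = E} = (\<Inter>b\<in>(`) \<sigma> ` ?P. B n b -` S b \<inter> space M)"
    using ne S E unfolding kept_pairs_def by (auto; blast)
  then have "prob {\<omega> \<in> space M. kept_pairs B n \<sigma> k \<omega> = E} = (\<Prod>b\<in>(`) \<sigma> ` ?P. prob (B n b -` S b \<inter> space M))"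
    using indep_varsD[OF marks_indep[OF n], of "(`) \<sigma> ` ?P" S] ne P im by auto
  also have "\<dots> = (\<Prod>e\<in>?P. prob (B n (\<sigma> ` e) -` S (\<sigma> ` e) \<inter> space M))"
    by (subst prod.reindex[OF injP]) simp
  also have "\<dots> = (\<Prod>e\<in>?P. if e \<in> E then p n else 1 - p n)"
  proof (intro prod.cong refl)
    fix e assume e: "e \<in> ?P"
    have pe: "prob {\<omega> \<in> space M. B n (\<sigma> ` e) \<omega>} = p n" by (rule marks_prob[OF n im[OF e]])
    have m: "{\<omega> \<in> space M. B n (\<sigma> ` e) \<omega>} \<in> events"
      using marks_measurable[OF n im[OF e]] by (rule predE)
    have "B n (\<sigma> ` e) -` S (\<sigma> ` e) \<inter> space M = (if e \<in> E then {\<omega> \<in> space M. B n (\<sigma> ` e) \<omega>}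
       else space M - {\<omega> \<in> space M. B n (\<sigma> ` e) \<omega>})"
      using S[OF e] by auto
    then show "prob (B n (\<sigma> ` e) -` S (\<sigma> ` e) \<inter> space M) = (if e \<in> E then p n else 1 - p n)"
      using pe prob_compl[OF m] by simp
  qed
  also have "\<dots> = p n ^ card E * (1 - p n) ^ card (?P - E)"
    using P E by (simp add: prod.If_cases Int_absorb1 Diff_eq)
  finally show ?thesis .
qed

lemma (in percolated_sample) kept_pairs_event:
  assumes \<sigma>: "inj_on \<sigma> {1..k}" "\<sigma> ` {1..k} \<subseteq> {1..n}"
  shows "{\<omega> \<in> space M. kept_pairs B n \<sigma> k \<omega> = E} \<in>
     sets (vimage_algebra (space M) (\<lambda>\<omega>. \<lambda>b\<in>index_pairs n. B n b \<omega>)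
          (PiM (index_pairs n) (\<lambda>_. count_space UNIV)))"
proof -
  let ?N = "PiM (index_pairs n) (\<lambda>_. count_space UNIV :: bool measure)"
  have comp: "Measurable.pred ?N (\<lambda>v. v (\<sigma> ` e))" if "e \<in> index_pairs k" for e
    by (rule measurable_component_singleton[OF image_index_pairs[OF \<sigma> that]])
  have "Measurable.pred ?N (\<lambda>v. \<forall>e\<in>index_pairs k. v (\<sigma> ` e) \<longleftrightarrow> e \<in> E)"
    using comp by (intro pred_intros_finite pred_intros_logic finite_index_pairs) auto
  then have S: "{v \<in> space ?N. (\<forall>e\<in>index_pairs k. v (\<sigma> ` e) \<longleftrightarrow> e \<in> E)} \<in> sets ?N" by (rule predE)
  show ?thesis
  proof (cases "E \<subseteq> index_pairs k")
    case True
    have eq: "{\<omega> \<in> space M. kept_pairs B n \<sigma> k \<omega> = E} =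
      (\<lambda>\<omega>. \<lambda>b\<in>index_pairs n. B n b \<omega>) -` {v \<in> space ?N. (\<forall>e\<in>index_pairs k. v (\<sigma> ` e) \<longleftrightarrow> e \<in> E)} \<inter> space M"
      using True image_index_pairs[OF \<sigma>] unfolding kept_pairs_def by (auto simp: space_PiM)
    show ?thesis unfolding eq by (rule in_vimage_algebra[OF S])
  next
    case False
    then have eq: "{\<omega> \<in> space M. kept_pairs B n \<sigma> k \<omega> = E} = {}" by (auto simp: kept_pairs_def)
    show ?thesis unfolding eq by (rule sets.empty_sets)
  qed
qed

section \<open>The expected number of induced copies\<close>

text \<open>The event splits into the disjoint events on which the pattern of close pairs is \<open>T\<close> and the set of
  kept pairs is \<open>E\<close>; on each of them independence of points and marks factors the probability.\<close>

lemma index_event_prob: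
  fixes M :: "'o measure" and f :: "real ^ 'd::{finite, linorder} \<Rightarrow> real"
    and A :: "(real ^ 'd::{finite, linorder}) set" and \<Gamma> :: "'v ugraph" and s :: real
  assumes PS: "percolated_sample M f X p B"
    and \<sigma>: "inj_on \<sigma> {1..k}" "\<sigma> ` {1..k} \<subseteq> {1..n}" and k: "2 \<le> k" and n: "1 \<le> n"
    and A: "A \<in> sets borel"
  defines "x \<equiv> \<lambda>\<omega> i. X (\<sigma> i) \<omega>"
  defines "W \<equiv> {\<omega> \<in> space M. graph_iso ({1..k}, kept_pairs B n \<sigma> k \<omega> \<inter> close_pairs k s (x \<omega>)) \<Gamma> \<and>
      leftmost_in A (x \<omega> ` {1..k})}"
  shows "W \<in> sets M"
    and "measure M W = (\<Sum>T\<in>Pow (index_pairs k). (\<Sum>E\<in>Pow (index_pairs k).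
        of_bool (graph_iso ({1..k}, E \<inter> T) \<Gamma>) * (p n ^ card E * (1 - p n) ^ card (index_pairs k - E))) *
        pattern_prob f A k T s)"
proof -
  interpret percolated_sample M f X p B by (rule PS)
  let ?P = "index_pairs k"
  let ?\<nu> = "density lborel (\<lambda>x. ennreal (f x))"
  let ?Z = "\<lambda>\<omega>. \<lambda>i\<in>{1..n}. X i \<omega>"
  let ?V = "vimage_algebra (space M) ?Z (PiM {1..n} (\<lambda>_. borel))"
  define KE where "KE E = {\<omega> \<in> space M. kept_pairs B n \<sigma> k \<omega> = E}" for E
  define XT where "XT T = {\<omega> \<in> space M. close_pairs k s (x \<omega>) = T \<and> leftmost_in A (x \<omega> ` {1..k})}" for T
  have \<sigma>i: "\<sigma> i \<in> {1..n}" if "i \<in> {1..k}" for i using \<sigma>(2) that by blast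
  have XT_sets: "XT T \<in> sets ?V" for T
  proof -
    let ?N = "PiM {1..n} (\<lambda>_. borel :: (real ^ 'd::{finite, linorder}) measure)"
    have "(\<lambda>z. z (\<sigma> i)) \<in> borel_measurable ?N" if "i \<in> {1..k}" for i
      by (rule measurable_component_singleton[OF \<sigma>i[OF that]])
    then have "Measurable.pred ?N (\<lambda>z. close_pairs k s (\<lambda>i. z (\<sigma> i)) = T \<and> leftmost_in A ((\<lambda>i. z (\<sigma> i)) ` {1..k}))"
      using A by (intro pred_intros_logic pred_close_pairs pred_leftmost_in) auto
    then have S: "{z \<in> space ?N. close_pairs k s (\<lambda>i. z (\<sigma> i)) = T \<and> leftmost_in A ((\<lambda>i. z (\<sigma> i)) ` {1..k})} \<in> sets ?N"
      (is "?S \<in> _") by (rule predE)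
    have z: "?Z \<omega> (\<sigma> i) = x \<omega> i" if "i \<in> {1..k}" for \<omega> i
      unfolding x_def using \<sigma>i[OF that] by (rule restrict_apply')
    have "close_pairs k s (\<lambda>i. ?Z \<omega> (\<sigma> i)) = close_pairs k s (x \<omega>)" for \<omega>
      by (rule close_pairs_cong[OF z])
    moreover have "(\<lambda>i. ?Z \<omega> (\<sigma> i)) ` {1..k} = x \<omega> ` {1..k}" for \<omega>
      by (rule image_cong[OF refl z])
    moreover have "?Z \<omega> \<in> space ?N" for \<omega> by (simp add: space_PiM)
    ultimately have eq: "XT T = ?Z -` ?S \<inter> space M"
      unfolding XT_def by auto
    show ?thesis unfolding eq by (rule in_vimage_algebra[OF S])
  qed
  have KE_sets: "KE E \<in> sets (vimage_algebra (space M) (\<lambda>\<omega>. \<lambda>b\<in>index_pairs n. B n b \<omega>)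
          (PiM (index_pairs n) (\<lambda>_. count_space UNIV)))" for E
    unfolding KE_def by (rule kept_pairs_event[OF \<sigma>])
  have ev: "XT T \<in> events" "KE E \<in> events" for T E
    using XT_sets KE_sets indep_setD_ev1[OF points_marks_indep[OF n]] indep_setD_ev2[OF points_marks_indep[OF n]]
    by blast+
  have XT_prob: "prob (XT T) = pattern_prob f A k T s" for T
  proof -
    let ?Q = "PiM {1..k} (\<lambda>_. ?\<nu>)"
    let ?Y = "\<lambda>\<omega>. \<lambda>i\<in>{1..k}. X (\<sigma> i) \<omega>"
    let ?S = "{z \<in> space ?Q. close_pairs k s z = T \<and> leftmost_in A (z ` {1..k})}"
    have se: "sets ?Q = sets (PiM {1..k} (\<lambda>_. borel))" by (intro sets_PiM_cong) auto
    have comp: "(\<lambda>z. z i) \<in> borel_measurable ?Q" if "i \<in> {1..k}" for i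
      using measurable_component_singleton[OF that, of "\<lambda>_. ?\<nu>"] by simp
    then have S: "?S \<in> sets ?Q"
      using A by (intro predE pred_intros_logic pred_close_pairs pred_leftmost_in) auto
    have Y: "?Y \<in> M \<rightarrow>\<^sub>M PiM {1..k} (\<lambda>_. borel)"
      using \<sigma>i by (intro measurable_restrict points_measurable) auto
    have "close_pairs k s (?Y \<omega>) = close_pairs k s (x \<omega>)" for \<omega>
      by (rule close_pairs_cong) (simp add: x_def)
    moreover have "?Y \<omega> ` {1..k} = x \<omega> ` {1..k}" for \<omega>
      by (rule image_cong) (simp_all add: x_def)
    moreover have "?Y \<omega> \<in> space ?Q" for \<omega> by (simp add: space_PiM)
    ultimately have eq: "XT T = ?Y -` ?S \<inter> space M" unfolding XT_def by auto
    have "prob (XT T) = measure (distr M (PiM {1..k} (\<lambda>_. borel)) ?Y) ?S"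
      unfolding eq by (rule measure_distr[OF Y S[unfolded se], symmetric])
    also have "\<dots> = pattern_prob f A k T s"
      using k unfolding pattern_prob_def by (subst points_joint_distr[OF \<sigma>]) auto
    finally show ?thesis .
  qed
  have KE_prob: "prob (KE E) = p n ^ card E * (1 - p n) ^ card (?P - E)" if "E \<in> Pow ?P" for E
    unfolding KE_def using kept_pairs_prob[OF \<sigma> k n] that by blast
  have prod: "prob (XT T \<inter> KE E) = prob (XT T) * prob (KE E)" for T E
    by (rule indep_setD[OF points_marks_indep[OF n] XT_sets KE_sets])
  define D where "D = {(T, E). T \<in> Pow ?P \<and> E \<in> Pow ?P \<and> graph_iso ({1..k}, E \<inter> T) \<Gamma>}"
  have finP: "finite (Pow ?P)" using finite_index_pairs by simp
  have Dsub: "D \<subseteq> Pow ?P \<times> Pow ?P" by (auto simp: D_def)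
  then have finD: "finite D" using finP finite_subset by blast
  have W: "W = (\<Union>(T, E)\<in>D. XT T \<inter> KE E)"
  proof (intro equalityI subsetI)
    fix \<omega> assume w: "\<omega> \<in> W"
    have "(close_pairs k s (x \<omega>), kept_pairs B n \<sigma> k \<omega>) \<in> D"
      using w unfolding W_def D_def close_pairs_def[of k s] kept_pairs_def by blast
    moreover have "\<omega> \<in> XT (close_pairs k s (x \<omega>)) \<inter> KE (kept_pairs B n \<sigma> k \<omega>)"
      using w unfolding W_def XT_def KE_def by blast
    ultimately show "\<omega> \<in> (\<Union>(T, E)\<in>D. XT T \<inter> KE E)" by blast
  next
    fix \<omega> assume "\<omega> \<in> (\<Union>(T, E)\<in>D. XT T \<inter> KE E)"
    then obtain T E where "(T, E) \<in> D" "\<omega> \<in> XT T" "\<omega> \<in> KE E" by blast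
    then show "\<omega> \<in> W" unfolding W_def XT_def KE_def D_def by auto
  qed
  show "W \<in> sets M" unfolding W using finD ev by auto
  have disj: "disjoint_family_on (\<lambda>(T, E). XT T \<inter> KE E) D"
    unfolding disjoint_family_on_def XT_def KE_def by auto
  have "prob W = (\<Sum>(T, E)\<in>D. prob (XT T \<inter> KE E))"
    unfolding W using finite_measure_finite_Union[OF finD _ disj] ev by (auto simp: case_prod_unfold)
  also have "\<dots> = (\<Sum>(T, E)\<in>Pow ?P \<times> Pow ?P. of_bool (graph_iso ({1..k}, E \<inter> T) \<Gamma>) * prob (XT T \<inter> KE E))"
    by (rule sum.mono_neutral_cong_left) (use finP Dsub in \<open>auto simp: D_def\<close>)
  also have "\<dots> = (\<Sum>T\<in>Pow ?P. \<Sum>E\<in>Pow ?P. of_bool (graph_iso ({1..k}, E \<inter> T) \<Gamma>) * prob (XT T \<inter> KE E))"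
    by (rule sum.cartesian_product[symmetric])
  also have "\<dots> = (\<Sum>T\<in>Pow ?P. (\<Sum>E\<in>Pow ?P. of_bool (graph_iso ({1..k}, E \<inter> T) \<Gamma>) *
      (p n ^ card E * (1 - p n) ^ card (?P - E))) * pattern_prob f A k T s)"
    unfolding prod XT_prob sum_distrib_right
    by (intro sum.cong refl) (simp add: KE_prob mult_ac)
  finally show "prob W = (\<Sum>T\<in>Pow ?P. (\<Sum>E\<in>Pow ?P. of_bool (graph_iso ({1..k}, E \<inter> T) \<Gamma>) *
      (p n ^ card E * (1 - p n) ^ card (?P - E))) * pattern_prob f A k T s)" .
qed

text \<open>The underlying probability space may be incomplete, so measurability has to hold literally,
  including the null event that sample points coincide. Summing over canonical index sets \<open>J\<close>
  achieves this: the points are distinct on \<open>J\<close>, and the graph that they span is determined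
  by the set of pairs in \<open>J\<close> that span an edge, which takes finitely many values.\<close>

lemma induced_count_measurable:
  fixes M :: "'o measure" and f :: "real ^ 'd::{finite, linorder} \<Rightarrow> real"
    and A :: "(real ^ 'd::{finite, linorder}) set"
  assumes PS: "percolated_sample M f X p B" and n: "1 \<le> n" and A: "A \<in> sets borel"
  shows "(\<lambda>\<omega>. real (induced_count \<Gamma> A (percolated_rgg X B r n \<omega>))) \<in> borel_measurable M"
proof -
  interpret percolated_sample M f X p B by (rule PS)
  let ?G = "\<lambda>\<omega>. percolated_rgg X B r n \<omega>"
  let ?x = "\<lambda>\<omega> i. X i \<omega>"
  have X: "(\<lambda>\<omega>. X i \<omega>) \<in> borel_measurable M" if "i \<in> {1..n}" for i
    using points_measurable[of i] that by simp
  have dist_le: "Measurable.pred M (\<lambda>\<omega>. dist (X i \<omega>) (X j \<omega>) \<le> c)" if "i \<in> {1..n}" "j \<in> {1..n}" for i j c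
    using that[THEN X, measurable] by measurable
  define canon where "canon J \<omega> \<longleftrightarrow> (\<forall>j\<in>J. \<forall>i\<in>{1..<j}. \<not> dist (X i \<omega>) (X j \<omega>) \<le> 0)" for J \<omega>
  define pat where "pat J \<omega> = {e. e \<subseteq> J \<and> card e = 2 \<and> ?x \<omega> ` e \<in> edges (?G \<omega>)}" for J \<omega>
  have canon_inj: "inj_on (?x \<omega>) J" if "J \<subseteq> {1..n}" "canon J \<omega>" for J \<omega>
  proof (rule inj_onI)
    fix i j assume ij: "i \<in> J" "j \<in> J" "X i \<omega> = X j \<omega>"
    have "1 \<le> i" "1 \<le> j" using that(1) ij by auto
    then show "i = j" using that(2) ij unfolding canon_def
      by (metis atLeastLessThan_iff dist_eq_0_iff linorder_neqE_nat order_refl)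
  qed
  have "real (induced_count \<Gamma> A (?G \<omega>)) =
     (\<Sum>J\<in>Pow {1..n}. of_bool (canon J \<omega> \<and> (\<exists>D\<in>Pow (Pow J). graph_iso (J, D) \<Gamma> \<and> pat J \<omega> = D) \<and>
        leftmost_in A (?x \<omega> ` J)))" for \<omega>
  proof -
    have v: "verts (?G \<omega>) = ?x \<omega> ` {1..n}" by (simp add: percolated_rgg_def sample_def)
    have c: "canon J \<omega> \<longleftrightarrow> (\<forall>j\<in>J. \<forall>i\<in>{1..<j}. X i \<omega> \<noteq> X j \<omega>)" for J
      by (simp add: canon_def)
    have iso: "graph_iso (induced (?G \<omega>) (?x \<omega> ` J)) \<Gamma> \<longleftrightarrow> (\<exists>D\<in>Pow (Pow J). graph_iso (J, D) \<Gamma> \<and> pat J \<omega> = D)"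
      if J: "J \<subseteq> {1..n}" "canon J \<omega>" for J
    proof -
      have ind: "induced (?G \<omega>) (?x \<omega> ` J) = (?x \<omega> ` J, (`) (?x \<omega>) ` pat J \<omega>)"
        unfolding pat_def by (rule induced_image[OF canon_inj[OF J]]) (rule percolated_edge_card)
      have "graph_iso (induced (?G \<omega>) (?x \<omega> ` J)) \<Gamma> \<longleftrightarrow> graph_iso (J, pat J \<omega>) \<Gamma>"
        unfolding ind by (rule graph_iso_image[OF canon_inj[OF J]]) (simp add: pat_def)
      moreover have "pat J \<omega> \<in> Pow (Pow J)" by (auto simp: pat_def)
      ultimately show ?thesis by blast
    qed
    show ?thesis
      unfolding induced_count_def v card_image_sets_eq_sum c[symmetric]
      by (intro sum.cong refl arg_cong[where f = of_bool]) (use iso in blast)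
  qed
  moreover have "(\<lambda>\<omega>. of_bool (canon J \<omega> \<and> (\<exists>D\<in>Pow (Pow J). graph_iso (J, D) \<Gamma> \<and> pat J \<omega> = D) \<and>
        leftmost_in A (?x \<omega> ` J)) :: real) \<in> borel_measurable M" if J: "J \<in> Pow {1..n}" for J
  proof (rule borel_measurable_of_bool_pred, intro pred_intros_logic)
    have finJ: "finite J" using J by (auto intro: finite_subset)
    show "Measurable.pred M (canon J)"
      unfolding canon_def[abs_def] using J finJ by (intro pred_intros_finite pred_intros_logic dist_le) auto
    show "Measurable.pred M (\<lambda>\<omega>. leftmost_in A (?x \<omega> ` J))"
      using J finJ A X by (intro pred_leftmost_in) auto
    show "Measurable.pred M (\<lambda>\<omega>. \<exists>D\<in>Pow (Pow J). graph_iso (J, D) \<Gamma> \<and> pat J \<omega> = D)"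
    proof (intro pred_intros_finite pred_intros_logic)
      fix D
      let ?E = "{e. e \<subseteq> J \<and> card e = 2}"
      have finE: "finite ?E" using finJ by simp
      have sub: "e \<subseteq> {1..n}" "finite e" if "e \<in> ?E" for e using that J finJ finite_subset by blast+
      have subb: "b \<subseteq> {1..n}" "finite b" if "b \<in> index_pairs n" for b
        using that finite_subset[of b "{1..n}"] by (auto simp: index_pairs_def)
      have edge: "Measurable.pred M (\<lambda>\<omega>. ?x \<omega> ` e \<in> edges (?G \<omega>))" if e: "e \<in> ?E" for e
      proof -
        have e2: "e \<subseteq> {1..n}" "card e = 2" "finite e" using sub[OF e] e by auto
        show ?thesis
          unfolding image_in_percolated_edges_iff[OF e2(1,2)]
          using e2(1,3) subb(2)
          by (intro pred_intros_finite pred_intros_logic dist_le finite_index_pairs marks_measurable n)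
            (auto dest: subsetD subsetD[OF subb(1)])
      qed
      have eq: "pat J \<omega> = D \<longleftrightarrow> D \<subseteq> ?E \<and> (\<forall>e\<in>?E. e \<in> D \<longleftrightarrow> ?x \<omega> ` e \<in> edges (?G \<omega>))" for \<omega>
        unfolding pat_def by blast
      show "Measurable.pred M (\<lambda>\<omega>. pat J \<omega> = D)"
        unfolding eq by (intro pred_intros_logic pred_intros_finite finE edge) auto
    qed (use finJ in auto)
  qed
  ultimately show ?thesis by (simp only:) (intro borel_measurable_sum)
qed

text \<open>Already the first coordinates are almost surely distinct, because hyperplanes are null sets for
  a law with a density.\<close>

lemma AE_points_distinct:
  fixes M :: "'o measure" and f :: "real ^ 'd::{finite, linorder} \<Rightarrow> real"
  assumes PS: "percolated_sample M f X p B" and n: "1 \<le> n"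
  shows "AE \<omega> in M. inj_on (\<lambda>i. X i \<omega>) {1..n}"
proof -
  interpret percolated_sample M f X p B by (rule PS)
  let ?\<nu> = "density lborel (\<lambda>x. ennreal (f x))"
  let ?Z = "\<lambda>\<omega>. \<lambda>i\<in>{1..n}. X i \<omega>"
  have fm[measurable]: "f \<in> borel_measurable borel" by (rule density_measurable)
  have se: "sets (PiM {1..n} (\<lambda>_. ?\<nu>)) = sets (PiM {1..n} (\<lambda>_. borel))" by (intro sets_PiM_cong) auto
  have Z: "?Z \<in> M \<rightarrow>\<^sub>M PiM {1..n} (\<lambda>_. borel)"
    by (intro measurable_restrict points_measurable) auto
  have d: "distr M (PiM {1..n} (\<lambda>_. borel)) ?Z = PiM {1..n} (\<lambda>_. ?\<nu>)"
    using points_joint_distr[of "\<lambda>i. i" n n] n by simp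
  have "AE v in ?\<nu>. first_coord v \<noteq> c" for c
    using AE_first_coord_neq[of c] by (auto simp: AE_density)
  then have "AE z in PiM {1..n} (\<lambda>_. ?\<nu>). inj_on (\<lambda>i. first_coord (z i)) {1..n} \<and> (\<forall>i\<in>{1..n}. first_coord (z i) \<noteq> 0)"
    by (intro AE_PiM_distinct_coords sigma_finite_density_real) auto
  then have "AE z in distr M (PiM {1..n} (\<lambda>_. borel)) ?Z. inj_on (\<lambda>i. first_coord (z i)) {1..n}"
    unfolding d by eventually_elim blast
  then have "AE \<omega> in M. inj_on (\<lambda>i. first_coord (?Z \<omega> i)) {1..n}"
    by (rule AE_distrD[OF Z])
  then show ?thesis
  proof eventually_elim
    case (elim \<omega>)
    show ?case
    proof (rule inj_onI)
      fix i j assume "i \<in> {1..n}" "j \<in> {1..n}" "X i \<omega> = X j \<omega>"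
      then show "i = j" by (intro inj_onD[OF elim]) simp_all
    qed
  qed
qed

text \<open>Almost surely the points are distinct, and then the induced copies correspond to the \<open>k\<close>-element
  index sets that span one. Each index set does so with the same probability.\<close>

lemma expected_induced_count:
  fixes M :: "'o measure" and f :: "real ^ 'd::{finite, linorder} \<Rightarrow> real"
    and A :: "(real ^ 'd::{finite, linorder}) set" and \<Gamma> :: "'v ugraph"
  assumes PS: "percolated_sample M f X p B" and k: "2 \<le> k" and n: "1 \<le> n" and r: "0 < r n"
    and A: "A \<in> sets borel" and \<Gamma>: "card (verts \<Gamma>) = k"
  shows "(LINT \<omega>|M. real (induced_count \<Gamma> A (percolated_rgg X B r n \<omega>))) =
    real (n choose k) * (\<Sum>T\<in>Pow (index_pairs k). (\<Sum>E\<in>Pow (index_pairs k).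
        of_bool (graph_iso ({1..k}, E \<inter> T) \<Gamma>) * (p n ^ card E * (1 - p n) ^ card (index_pairs k - E))) *
        pattern_prob f A k T (r n))" (is "_ = _ * ?V")
proof -
  interpret percolated_sample M f X p B by (rule PS)
  define I where "I = {J. J \<subseteq> {1..n} \<and> card J = k}"
  have finI: "finite I" unfolding I_def by (rule finite_subset[of _ "Pow {1..n}"]) auto
  have "\<exists>\<sigma>. bij_betw \<sigma> {1..k} J" if "J \<in> I" for J
    using ex_bij_betw_nat_finite_1[of J] that finite_subset[of J "{1..n}"] by (auto simp: I_def)
  then obtain \<sigma> where \<sigma>: "\<And>J. J \<in> I \<Longrightarrow> bij_betw (\<sigma> J) {1..k} J" by metis
  have \<sigma>1: "inj_on (\<sigma> J) {1..k}" "\<sigma> J ` {1..k} = J" "\<sigma> J ` {1..k} \<subseteq> {1..n}" if "J \<in> I" for J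
    using \<sigma>[OF that] that by (auto simp: bij_betw_def I_def)
  define W where "W J = {\<omega> \<in> space M. graph_iso ({1..k}, kept_pairs B n (\<sigma> J) k \<omega> \<inter>
      close_pairs k (r n) (\<lambda>i. X (\<sigma> J i) \<omega>)) \<Gamma> \<and> leftmost_in A ((\<lambda>i. X (\<sigma> J i) \<omega>) ` {1..k})}" for J
  have W: "W J \<in> sets M" "prob (W J) = ?V" if "J \<in> I" for J
    unfolding W_def using index_event_prob[OF PS \<sigma>1(1,3)[OF that] k n A, of "r n" \<Gamma>] by simp_all
  have "AE \<omega> in M. real (induced_count \<Gamma> A (percolated_rgg X B r n \<omega>)) = (\<Sum>J\<in>I. indicat_real (W J) \<omega>)"
    using AE_points_distinct[OF PS n] AE_space
  proof eventually_elim
    case (elim \<omega>)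
    let ?x = "\<lambda>i. X i \<omega>" and ?G = "percolated_rgg X B r n \<omega>"
    let ?Q = "\<lambda>S. graph_iso (induced ?G S) \<Gamma> \<and> leftmost_in A S"
    have v: "verts ?G = ?x ` {1..n}" by (simp add: percolated_rgg_def sample_def)
    have "real (induced_count \<Gamma> A ?G) =
        (\<Sum>J\<in>Pow {1..n}. of_bool ((\<forall>j\<in>J. \<forall>i\<in>{1..<j}. ?x i \<noteq> ?x j) \<and> ?Q (?x ` J)))"
      unfolding induced_count_def v by (rule card_image_sets_eq_sum)
    also have "\<dots> = (\<Sum>J\<in>I. indicat_real (W J) \<omega>)"
    proof (rule sum.mono_neutral_cong_right)
      show "\<forall>J\<in>Pow {1..n} - I. of_bool ((\<forall>j\<in>J. \<forall>i\<in>{1..<j}. ?x i \<noteq> ?x j) \<and> ?Q (?x ` J)) = (0 :: real)"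
      proof
        fix J assume J: "J \<in> Pow {1..n} - I"
        then have injJ: "inj_on ?x J" using elim(1) inj_on_subset by blast
        have "\<not> graph_iso (induced ?G (?x ` J)) \<Gamma>"
        proof
          assume "graph_iso (induced ?G (?x ` J)) \<Gamma>"
          from graph_iso_card(1)[OF this] have "card (?x ` J) = k" by (simp add: induced_def \<Gamma>)
          then have "card J = k" using card_image[OF injJ] by simp
          then show False using J by (auto simp: I_def)
        qed
        then show "of_bool ((\<forall>j\<in>J. \<forall>i\<in>{1..<j}. ?x i \<noteq> ?x j) \<and> ?Q (?x ` J)) = (0 :: real)" by simp
      qed
      fix J assume J: "J \<in> I"
      let ?y = "\<lambda>i. X (\<sigma> J i) \<omega>"
      have "?x i \<noteq> ?x j" if "j \<in> J" "i \<in> {1..<j}" for i j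
      proof
        assume e: "?x i = ?x j"
        have "j \<in> {1..n}" "i \<in> {1..n}" using that J by (auto simp: I_def)
        with inj_onD[OF elim(1) e] have "i = j" by simp
        then show False using that(2) by simp
      qed
      moreover have im: "?x ` J = ?y ` {1..k}"
        by (subst \<sigma>1(2)[OF J, symmetric]) (rule image_image)
      moreover have "graph_iso (induced ?G (?y ` {1..k})) \<Gamma> \<longleftrightarrow>
          graph_iso ({1..k}, kept_pairs B n (\<sigma> J) k \<omega> \<inter> close_pairs k (r n) ?y) \<Gamma>"
      proof -
        have "inj_on (?x \<circ> \<sigma> J) {1..k}"
          by (rule comp_inj_on[OF \<sigma>1(1)[OF J] inj_on_subset[OF elim(1) \<sigma>1(3)[OF J]]])
        then have injy: "inj_on ?y {1..k}" by (simp add: comp_def)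
        have ind: "induced ?G (?y ` {1..k}) =
            (?y ` {1..k}, (`) ?y ` (kept_pairs B n (\<sigma> J) k \<omega> \<inter> close_pairs k (r n) ?y))"
          unfolding kept_pairs_def
          by (rule induced_percolated_rgg[where X = X and r = r and n = n, OF elim(1) less_imp_le[OF r] \<sigma>1(1,3)[OF J]])
        show ?thesis
          unfolding ind by (rule graph_iso_image[OF injy]) (auto simp: close_pairs_def index_pairs_def)
      qed
      ultimately show "of_bool ((\<forall>j\<in>J. \<forall>i\<in>{1..<j}. ?x i \<noteq> ?x j) \<and> ?Q (?x ` J)) = indicat_real (W J) \<omega>"
        using elim(2) unfolding W_def by (simp add: indicator_def)
    qed (auto simp: I_def)
    finally show ?case .
  qed
  then have "(LINT \<omega>|M. real (induced_count \<Gamma> A (percolated_rgg X B r n \<omega>))) = (LINT \<omega>|M. (\<Sum>J\<in>I. indicat_real (W J) \<omega>))"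
    using W by (intro integral_cong_AE induced_count_measurable[OF PS n A]) auto
  also have "\<dots> = (\<Sum>J\<in>I. prob (W J))"
  proof (subst Bochner_Integration.integral_sum)
    show "integrable M (indicat_real (W J))" if "J \<in> I" for J
      using W(1)[OF that] by (intro integrable_real_indicator) (auto simp: less_top[symmetric])
    show "(\<Sum>J\<in>I. LINT \<omega>|M. indicat_real (W J) \<omega>) = (\<Sum>J\<in>I. prob (W J))"
      using W by (intro sum.cong) (auto simp: Int_absorb2 sets.sets_into_space)
  qed
  also have "\<dots> = real (card I) * ?V" using W by simp
  also have "card I = n choose k" using n_subsets[of "{1..n}" k] by (simp add: I_def)
  finally show ?thesis .
qed

lemma binomial_over_power_tendsto: "(\<lambda>n. real (n choose k) / real n ^ k) \<longlonglongrightarrow> 1 / fact k"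
proof -
  have "(\<lambda>n. (real n - real i) / real n) \<longlonglongrightarrow> 1" for i
  proof (rule Lim_transform_eventually)
    have "(\<lambda>n. 1 - real i * inverse (real n)) \<longlonglongrightarrow> 1 - real i * 0"
      by (intro tendsto_intros lim_inverse_n)
    then show "(\<lambda>n. 1 - real i * inverse (real n)) \<longlonglongrightarrow> 1" by simp
    show "\<forall>\<^sub>F n in sequentially. 1 - real i * inverse (real n) = (real n - real i) / real n"
      using eventually_gt_at_top[of 0] by eventually_elim (simp add: field_simps)
  qed
  then have lim: "(\<lambda>n. (\<Prod>i\<in>{0..<k}. (real n - real i) / real n) / fact k) \<longlonglongrightarrow> (\<Prod>i\<in>{0..<k}. 1) / fact k"
    by (intro tendsto_intros) auto
  have "real (n choose k) / real n ^ k = (\<Prod>i\<in>{0..<k}. (real n - real i) / real n) / fact k" for n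
    by (simp add: binomial_gbinomial gbinomial_prod_rev prod_dividef)
  then show ?thesis using lim by simp
qed

section \<open>The limit and its lower bound\<close>

lemma sum_indicator_fiber:
  assumes "finite S"
  shows "(\<Sum>T\<in>S. c T * indicat_real {y \<in> Y. Q y \<and> F y = T} y) =
    (if y \<in> Y \<and> Q y \<and> F y \<in> S then c (F y) else (0 :: real))"
proof -
  have "(\<Sum>T\<in>S. c T * indicat_real {y \<in> Y. Q y \<and> F y = T} y) =
      (\<Sum>T\<in>S. if F y = T then (if y \<in> Y \<and> Q y then c T else 0) else 0)"
    by (intro sum.cong) (auto simp: indicator_def)
  also have "\<dots> = (if y \<in> Y \<and> Q y \<and> F y \<in> S then c (F y) else 0)"
    using assms by (simp add: sum.delta')
  finally show ?thesis .
qed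

lemma h_ind_image:
  fixes z :: "nat \<Rightarrow> real ^ 'd::{finite, linorder}"
  assumes "card (verts \<Gamma>) = k"
  shows "h_ind \<Gamma> (z ` {1..k}) =
    of_bool (inj_on z {1..k} \<and> graph_iso ({1..k}, close_pairs k 1 z) \<Gamma>)"
proof (cases "inj_on z {1..k}")
  case True
  have "graph_iso (rgg (z ` {1..k}) 1) \<Gamma> \<longleftrightarrow> graph_iso ({1..k}, close_pairs k 1 z) \<Gamma>"
    unfolding rgg_image[OF True zero_le_one]
    by (rule graph_iso_image[OF True]) (auto simp: close_pairs_def index_pairs_def)
  then show ?thesis using True assms card_image[OF True] by (simp add: h_ind_def)
next
  case False
  then have "card (z ` {1..k}) \<noteq> k" using eq_card_imp_inj_on[of "{1..k}" z] by auto
  then show ?thesis using False assms by (simp add: h_ind_def)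
qed

text \<open>A subgraph isomorphic to \<open>\<Gamma>\<close> has \<open>k\<close> vertices, hence all of them, and is determined by a set of pairs.\<close>

lemma g_ind_image:
  fixes z :: "nat \<Rightarrow> real ^ 'd::{finite, linorder}"
  assumes k: "card (verts \<Gamma>) = k"
  shows "g_ind \<Gamma> (z ` {1..k}) =
    of_bool (inj_on z {1..k} \<and> (\<exists>H. H \<subseteq> close_pairs k 1 z \<and> graph_iso ({1..k}, H) \<Gamma>) \<and>
      \<not> graph_iso ({1..k}, close_pairs k 1 z) \<Gamma>)"
proof (cases "inj_on z {1..k}")
  case True
  let ?Y = "z ` {1..k}" and ?T = "close_pairs k 1 z"
  have rg: "rgg ?Y 1 = (?Y, (`) z ` ?T)" by (rule rgg_image[OF True zero_le_one])
  have sub: "e \<subseteq> {1..k}" "card e = 2" if "e \<in> ?T" for e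
    using that by (auto simp: close_pairs_def index_pairs_def)
  have iso: "graph_iso (?Y, (`) z ` H) \<Gamma> \<longleftrightarrow> graph_iso ({1..k}, H) \<Gamma>" if "H \<subseteq> ?T" for H
    by (rule graph_iso_image[OF True]) (use that sub in blast)
  have cY: "card ?Y = k" using card_image[OF True] by simp
  have "(\<exists>H. subgraph H (rgg ?Y 1) \<and> graph_iso H \<Gamma>) \<longleftrightarrow> (\<exists>H\<subseteq>?T. graph_iso ({1..k}, H) \<Gamma>)"
  proof
    assume "\<exists>H. subgraph H (rgg ?Y 1) \<and> graph_iso H \<Gamma>"
    then obtain H where H: "simple_graph H" "verts H \<subseteq> ?Y" "edges H \<subseteq> (`) z ` ?T" "graph_iso H \<Gamma>"
      unfolding subgraph_def rg fst_conv snd_conv by blast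
    have "card (verts H) = k"
      using graph_iso_card(1)[OF H(4)] H(1) k by (simp add: simple_graph_def)
    then have v: "verts H = ?Y" using H(2) cY by (intro card_subset_eq) auto
    obtain H' where H': "H' \<subseteq> ?T" "edges H = (`) z ` H'" using H(3) by (rule subset_imageE)
    have "H = (?Y, (`) z ` H')" using v H'(2) by (simp add: prod_eq_iff)
    with H(4) iso[OF H'(1)] H'(1) show "\<exists>H\<subseteq>?T. graph_iso ({1..k}, H) \<Gamma>" by auto
  next
    assume "\<exists>H\<subseteq>?T. graph_iso ({1..k}, H) \<Gamma>"
    then obtain H where H: "H \<subseteq> ?T" "graph_iso ({1..k}, H) \<Gamma>" by blast
    have "card (z ` e) = 2" if "e \<in> H" for e
      using sub[of e] that H(1) card_image[OF inj_on_subset[OF True, of e]] by auto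
    moreover have "z ` e \<subseteq> ?Y" if "e \<in> H" for e using sub(1)[of e] that H(1) by blast
    ultimately have "subgraph (?Y, (`) z ` H) (rgg ?Y 1)"
      unfolding subgraph_def simple_graph_def rg fst_conv snd_conv using H(1) by blast
    then show "\<exists>H. subgraph H (rgg ?Y 1) \<and> graph_iso H \<Gamma>"
      using iso[OF H(1)] H(2) by blast
  qed
  note E = this
  have I: "graph_iso (rgg ?Y 1) \<Gamma> \<longleftrightarrow> graph_iso ({1..k}, ?T) \<Gamma>"
    unfolding rg by (rule iso[OF order_refl])
  show ?thesis unfolding g_ind_def E I using True k cY by simp
next
  case False
  then have "card (z ` {1..k}) \<noteq> k" using eq_card_imp_inj_on[of "{1..k}" z] by auto
  then show ?thesis using False k by (simp add: g_ind_def)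
qed

text \<open>A function of the pattern is a finite combination of indicators of the configurations with a
  given pattern. The condition of distinct points is what \<open>h_ind\<close> and \<open>g_ind\<close> impose by their
  cardinality test; it fails only on a null set.\<close>

lemma pattern_function_integral:
  fixes c :: "nat set set \<Rightarrow> real" and k :: nat
  assumes k: "1 \<le> k" and c: "\<And>T. 0 \<le> c T"
    and conn: "\<And>T. T \<subseteq> index_pairs k \<Longrightarrow> \<not> connected_graph ({1..k}, T) \<Longrightarrow> c T = 0"
  defines "L \<equiv> PiM {1..k - 1} (\<lambda>_. lborel :: (real ^ 'd::{finite, linorder}) measure)"
  shows "integrable L (\<lambda>y. of_bool (inj_on (y(k := 0)) {1..k}) * c (close_pairs k 1 (y(k := 0))))" (is "integrable L ?F")
    and "(LINT y|L. of_bool (inj_on (y(k := 0)) {1..k}) * c (close_pairs k 1 (y(k := 0)))) =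
      (\<Sum>T\<in>Pow (index_pairs k). c T * pattern_volume TYPE(real ^ 'd::{finite, linorder}) k T)"
proof -
  let ?A = "\<lambda>y :: nat \<Rightarrow> real ^ 'd::{finite, linorder}. y(k := 0)"
  let ?P = "Pow (index_pairs k)"
  define U where "U T = {y \<in> space L. inj_on (?A y) {1..k} \<and> close_pairs k 1 (?A y) = T}" for T
  have coord: "(\<lambda>y. ?A y i) \<in> borel_measurable L" if "i \<in> {1..k}" for i
    unfolding L_def by (rule rescaled_coordinate_measurable(2)[OF that])
  have dist_le: "Measurable.pred L (\<lambda>y. dist (?A y i) (?A y j) \<le> 0)" if "i \<in> {1..k}" "j \<in> {1..k}" for i j
    using that[THEN coord, measurable] by measurable
  have inj_iff: "inj_on (?A y) {1..k} \<longleftrightarrow> (\<forall>i\<in>{1..k}. \<forall>j\<in>{1..k}. \<not> dist (?A y i) (?A y j) \<le> 0 \<or> i = j)" for y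
    unfolding inj_on_def by (simp del: fun_upd_apply)
  have U_sets: "U T \<in> sets L" for T
    unfolding U_def inj_iff
    by (intro predE pred_intros_logic pred_intros_finite dist_le pred_close_pairs coord) auto
  let ?V = "\<lambda>T. {y \<in> space L. close_pairs k 1 (?A y) = T}"
  have V_sets: "?V T \<in> sets L" for T
    by (intro predE pred_close_pairs coord)
  have vol: "measure L (U T) = pattern_volume TYPE(real ^ 'd::{finite, linorder}) k T" for T
  proof -
    have "AE y in L. inj_on (\<lambda>i. first_coord (y i)) {1..k - 1} \<and> (\<forall>i\<in>{1..k - 1}. first_coord (y i) \<noteq> 0)"
      unfolding L_def
      by (rule AE_PiM_distinct_coords[OF lborel.sigma_finite_measure_axioms]) (auto intro: AE_first_coord_neq)
    then have "AE y in L. inj_on (?A y) {1..k}"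
    proof eventually_elim
      case (elim y)
      from first_coord_extend_inj[OF k elim[THEN conjunct1] elim[THEN conjunct2]] show ?case
        by (rule inj_on_imageI2[of first_coord, unfolded comp_def])
    qed
    then have "AE y in L. y \<in> U T \<longleftrightarrow> y \<in> ?V T"
      by eventually_elim (simp add: U_def del: fun_upd_apply)
    then have "measure L (U T) = measure L (?V T)"
      using U_sets V_sets by (intro measure_eq_AE) auto
    then show ?thesis by (simp add: pattern_volume_def L_def)
  qed
  have int: "integrable L (\<lambda>y. c T * indicat_real (U T) y)" if T: "T \<in> ?P" for T
  proof (cases "connected_graph ({1..k}, T)")
    case True
    have "emeasure L (U T) \<le> emeasure L (?V T)"
      by (rule emeasure_mono[OF _ V_sets]) (auto simp: U_def)
    also have "\<dots> < \<infinity>" unfolding L_def by (rule finite_pattern_volume[OF True k])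
    finally show ?thesis using U_sets by (intro integrable_mult_right integrable_real_indicator)
  next
    case False
    then have "c T = 0" using conn T by blast
    then show ?thesis by simp
  qed
  have F: "?F y = (\<Sum>T\<in>?P. c T * indicat_real (U T) y)" if "y \<in> space L" for y
  proof -
    have "close_pairs k 1 (?A y) \<in> ?P" by (auto simp: close_pairs_def)
    then show ?thesis
      unfolding U_def using that finite_index_pairs
      by (subst sum_indicator_fiber) (auto simp del: fun_upd_apply)
  qed
  have "integrable L (\<lambda>y. \<Sum>T\<in>?P. c T * indicat_real (U T) y)"
    by (rule Bochner_Integration.integrable_sum[OF int])
  then show "integrable L ?F"
    by (subst Bochner_Integration.integrable_cong[OF refl F])
  have "(LINT y|L. ?F y) = (LINT y|L. (\<Sum>T\<in>?P. c T * indicat_real (U T) y))"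
    by (rule Bochner_Integration.integral_cong[OF refl F])
  also have "\<dots> = (\<Sum>T\<in>?P. (LINT y|L. c T * indicat_real (U T) y))"
    by (rule Bochner_Integration.integral_sum[OF int])
  also have "\<dots> = (\<Sum>T\<in>?P. c T * pattern_volume TYPE(real ^ 'd::{finite, linorder}) k T)"
  proof (intro sum.cong refl)
    fix T
    have "U T \<inter> space L = U T" by (auto simp: U_def)
    then show "(LINT y|L. c T * indicat_real (U T) y) = c T * pattern_volume TYPE(real ^ 'd::{finite, linorder}) k T"
      by (simp add: vol)
  qed
  finally show "(LINT y|L. ?F y) = (\<Sum>T\<in>?P. c T * pattern_volume TYPE(real ^ 'd::{finite, linorder}) k T)" .
qed

definition limit_mean ::
  "(real ^ 'd::{finite, linorder} \<Rightarrow> real) \<Rightarrow> 'v ugraph \<Rightarrow> (real ^ 'd::{finite, linorder}) set \<Rightarrow> real \<Rightarrow> real" where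
  "limit_mean f \<Gamma> A q = (let k = card (verts \<Gamma>) in 1 / fact k * (LINT x:A|lborel. f x ^ k) *
     (\<Sum>T\<in>Pow (index_pairs k). percolation_weight \<Gamma> k q T * pattern_volume TYPE(real ^ 'd::{finite, linorder}) k T))"

text \<open>Both \<open>mu\<close> and \<open>mu'\<close> are sums over patterns \<open>T\<close> with coefficients \<open>0\<close> or \<open>1\<close>, and at most one of the two
  coefficients is \<open>1\<close>; the claim then holds pattern by pattern.\<close>

lemma limit_mean_ge:
  fixes f :: "real ^ 'd::{finite, linorder} \<Rightarrow> real" and A :: "(real ^ 'd::{finite, linorder}) set"
    and \<Gamma> :: "'v ugraph"
  assumes f: "\<And>x. 0 \<le> f x" and \<Gamma>: "connected_graph \<Gamma>"
    and card: "card (verts \<Gamma>) = k" "card (edges \<Gamma>) = k - 1" and k: "1 \<le> k" and q: "0 \<le> q" "q \<le> 1"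
  shows "mu f \<Gamma> A + (1 - q) ^ ((k choose 2) - (k - 1)) * mu' f \<Gamma> A \<le> limit_mean f \<Gamma> A q"
    and "0 \<le> mu' f \<Gamma> A"
proof -
  let ?L = "PiM {1..k - 1} (\<lambda>_. lborel :: (real ^ 'd::{finite, linorder}) measure)"
  let ?vol = "pattern_volume TYPE(real ^ 'd::{finite, linorder}) k"
  let ?P = "Pow (index_pairs k)"
  let ?Ia = "LINT x:A|lborel. f x ^ k"
  let ?e = "(1 - q) ^ ((k choose 2) - (k - 1))"
  define a where "a T = (of_bool (graph_iso ({1..k}, T) \<Gamma>) :: real)" for T
  define b where "b T = (of_bool ((\<exists>H. H \<subseteq> T \<and> graph_iso ({1..k}, H) \<Gamma>) \<and> \<not> graph_iso ({1..k}, T) \<Gamma>) :: real)" for T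
  have conn: "connected_graph ({1..k}, T)" if "T \<subseteq> index_pairs k" "H \<subseteq> T" "graph_iso ({1..k}, H) \<Gamma>" for H T
  proof (rule connected_mono[OF graph_iso_connected[OF that(3) _ \<Gamma>] that(2)])
    show "e \<subseteq> verts ({1..k}, H)" if "e \<in> edges ({1..k}, H)" for e
      using that \<open>T \<subseteq> index_pairs k\<close> \<open>H \<subseteq> T\<close> by (auto simp: index_pairs_def)
  qed
  have img: "insert 0 (y ` {1..k - 1}) = (y(k := 0)) ` {1..k}" for y :: "nat \<Rightarrow> real ^ 'd::{finite, linorder}"
  proof -
    have ins: "{1..k} = insert k {1..k - 1}" using k by auto
    have im: "(y(k := 0)) ` {1..k - 1} = y ` {1..k - 1}" by (rule image_cong) (use k in auto)
    show ?thesis unfolding ins image_insert im fun_upd_same ..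
  qed
  have h: "(LINT y|?L. h_ind \<Gamma> (insert 0 (y ` {1..k - 1}))) = (\<Sum>T\<in>?P. a T * ?vol T)"
  proof -
    have "(LINT y|?L. h_ind \<Gamma> (insert 0 (y ` {1..k - 1}))) =
        (LINT y|?L. of_bool (inj_on (y(k := 0)) {1..k}) * a (close_pairs k 1 (y(k := 0))))"
      unfolding img h_ind_image[OF card(1)] a_def of_bool_conj ..
    also have "\<dots> = (\<Sum>T\<in>?P. a T * ?vol T)"
      by (rule pattern_function_integral(2)[OF k]) (use conn in \<open>auto simp: a_def\<close>)
    finally show ?thesis .
  qed
  have g: "(LINT y|?L. g_ind \<Gamma> (insert 0 (y ` {1..k - 1}))) = (\<Sum>T\<in>?P. b T * ?vol T)"
  proof -
    have "(LINT y|?L. g_ind \<Gamma> (insert 0 (y ` {1..k - 1}))) =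
        (LINT y|?L. of_bool (inj_on (y(k := 0)) {1..k}) * b (close_pairs k 1 (y(k := 0))))"
      unfolding img g_ind_image[OF card(1)] b_def of_bool_conj[of "inj_on _ _"] ..
    also have "\<dots> = (\<Sum>T\<in>?P. b T * ?vol T)"
      by (rule pattern_function_integral(2)[OF k]) (use conn in \<open>auto simp: b_def\<close>)
    finally show ?thesis .
  qed
  have vol: "0 \<le> ?vol T" for T by (simp add: pattern_volume_def)
  have Ia: "0 \<le> 1 / fact k * ?Ia"
    using f unfolding set_lebesgue_integral_def by (intro mult_nonneg_nonneg integral_nonneg_AE AE_I2) auto
  have w: "a T + ?e * b T \<le> percolation_weight \<Gamma> k q T" if "T \<in> ?P" for T
  proof -
    have T: "T \<subseteq> index_pairs k" using that by simp
    show ?thesis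
    proof (cases "graph_iso ({1..k}, T) \<Gamma>")
      case True
      then show ?thesis using percolation_weight_iso[OF T True card(2) q] by (simp add: a_def b_def)
    next
      case False
      show ?thesis
      proof (cases "\<exists>H. H \<subseteq> T \<and> graph_iso ({1..k}, H) \<Gamma>")
        case True
        then obtain H where H: "H \<subseteq> T" "graph_iso ({1..k}, H) \<Gamma>" by blast
        have ab: "a T = 0" "b T = 1" unfolding a_def b_def using False True by auto
        show ?thesis using percolation_weight_contains[OF T H card(2) q] unfolding ab by simp
      next
        case no: False
        have ab: "a T = 0" "b T = 0" unfolding a_def b_def using False no by auto
        show ?thesis using percolation_weight_nonneg[OF q] unfolding ab by simp
      qed
    qed
  qed
  have "(\<Sum>T\<in>?P. a T * ?vol T) + ?e * (\<Sum>T\<in>?P. b T * ?vol T) = (\<Sum>T\<in>?P. (a T + ?e * b T) * ?vol T)"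
    by (simp add: sum.distrib sum_distrib_left distrib_right mult.assoc)
  also have "\<dots> \<le> (\<Sum>T\<in>?P. percolation_weight \<Gamma> k q T * ?vol T)"
    by (intro sum_mono mult_right_mono w vol)
  finally have le: "(\<Sum>T\<in>?P. a T * ?vol T) + ?e * (\<Sum>T\<in>?P. b T * ?vol T)
      \<le> (\<Sum>T\<in>?P. percolation_weight \<Gamma> k q T * ?vol T)" .
  have mu: "mu f \<Gamma> A = 1 / fact k * ?Ia * (\<Sum>T\<in>?P. a T * ?vol T)"
    "mu' f \<Gamma> A = 1 / fact k * ?Ia * (\<Sum>T\<in>?P. b T * ?vol T)"
    unfolding mu_def mu'_def Let_def card(1) h g by (rule refl)+
  show "mu f \<Gamma> A + ?e * mu' f \<Gamma> A \<le> limit_mean f \<Gamma> A q"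
    using mult_left_mono[OF le Ia] unfolding mu limit_mean_def Let_def card(1)
    by (simp add: algebra_simps)
  show "0 \<le> mu' f \<Gamma> A"
    unfolding mu by (intro mult_nonneg_nonneg[OF Ia] sum_nonneg mult_nonneg_nonneg vol) (simp add: b_def)
qed

text \<open>The normalisation cancels against \<open>p ^ (k - 1)\<close> from the marks and \<open>r\<close> to the power \<open>dim * (k - 1)\<close>
  from the rescaling, and \<open>n choose k\<close> is asymptotic to \<open>n ^ k / k!\<close>. Disconnected patterns drop
  out since their weight is \<open>0\<close>.\<close>

lemma normalized_mean_tendsto:
  fixes M :: "'o measure" and f :: "real ^ 'd::{finite, linorder} \<Rightarrow> real"
    and A :: "(real ^ 'd::{finite, linorder}) set" and \<Gamma> :: "'v ugraph" and \<theta> :: real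
  assumes PS: "percolated_sample M f X p B"
    and r: "\<And>n. 1 \<le> n \<Longrightarrow> 0 < r n" "r \<longlonglongrightarrow> 0"
    and \<Gamma>: "connected_graph \<Gamma>"
    and k: "2 \<le> k" and card: "card (verts \<Gamma>) = k" "card (edges \<Gamma>) = k - 1"
    and A: "open A" "emeasure lborel (frontier A) = 0" and \<theta>: "\<theta> \<noteq> 0"
    and d: "\<And>n. d n = real n * \<theta> * r n ^ CARD('d) * p n"
    and p: "p \<longlonglongrightarrow> q"
  shows "(\<lambda>n. (LINT \<omega>|M. real (induced_count \<Gamma> A (percolated_rgg X B r n \<omega>))) / real n * (\<theta> / d n) ^ (k - 1))
    \<longlonglongrightarrow> limit_mean f \<Gamma> A q"
proof -
  interpret percolated_sample M f X p B by (rule PS)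
  let ?P = "Pow (index_pairs k)"
  let ?D = "CARD('d) * (k - 1)"
  let ?vol = "pattern_volume TYPE(real ^ 'd::{finite, linorder}) k"
  let ?Ia = "LINT x:A|lborel. f x ^ k"
  have k1: "1 \<le> k" using k by simp
  have Ab: "A \<in> sets borel" using A by simp
  have f: "integrable lborel f"
    using density_integral by (simp add: has_bochner_integral_iff)
  obtain K where K: "1 \<le> K" "\<And>x. f x \<le> K"
  proof -
    from density_bounded obtain b where "\<And>x. norm (f x) \<le> b" unfolding bounded_iff by auto
    then have "f x \<le> max 1 b" for x using abs_le_D1[of "f x" b] by (simp add: max.coboundedI2)
    then show ?thesis using that[of "max 1 b"] by simp
  qed
  have formula: "(LINT \<omega>|M. real (induced_count \<Gamma> A (percolated_rgg X B r n \<omega>))) / real n * (\<theta> / d n) ^ (k - 1) =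
      real (n choose k) / real n ^ k * (\<Sum>T\<in>?P. percolation_weight \<Gamma> k (p n) T * (pattern_prob f A k T (r n) / r n ^ ?D))"
    if n: "1 \<le> n" for n
  proof -
    have p0: "p n \<noteq> 0" and r0: "r n \<noteq> 0" and n0: "real n \<noteq> 0"
      using retention_range[OF n] r(1)[OF n] n by auto
    have "(LINT \<omega>|M. real (induced_count \<Gamma> A (percolated_rgg X B r n \<omega>))) =
        real (n choose k) * (\<Sum>T\<in>?P. (p n ^ (k - 1) * percolation_weight \<Gamma> k (p n) T) * pattern_prob f A k T (r n))"
      unfolding expected_induced_count[where r = r, OF PS k n r(1)[OF n] Ab card(1)]
      by (intro arg_cong2[where f = "(*)"] refl sum.cong sum_percolation_weight card(2)) auto
    also have "\<dots> = real (n choose k) * p n ^ (k - 1) * r n ^ ?D *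
        (\<Sum>T\<in>?P. percolation_weight \<Gamma> k (p n) T * (pattern_prob f A k T (r n) / r n ^ ?D))"
      unfolding sum_distrib_left using r0 by (intro sum.cong refl) (simp add: field_simps)
    finally have e: "(LINT \<omega>|M. real (induced_count \<Gamma> A (percolated_rgg X B r n \<omega>))) =
        real (n choose k) * p n ^ (k - 1) * r n ^ ?D *
        (\<Sum>T\<in>?P. percolation_weight \<Gamma> k (p n) T * (pattern_prob f A k T (r n) / r n ^ ?D))" .
    have td: "(\<theta> / d n) ^ (k - 1) = 1 / (real n ^ (k - 1) * r n ^ ?D * p n ^ (k - 1))"
      using \<theta> unfolding d by (simp add: power_divide power_mult_distrib power_mult field_simps)
    have nk: "real n ^ k = real n * real n ^ (k - 1)"
      using k1 by (simp flip: power_Suc)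
    show ?thesis unfolding e td nk using p0 r0 n0 by (simp add: field_simps)
  qed
  have summand: "(\<lambda>n. percolation_weight \<Gamma> k (p (Suc n)) T * (pattern_prob f A k T (r (Suc n)) / r (Suc n) ^ ?D))
      \<longlonglongrightarrow> percolation_weight \<Gamma> k q T * (?Ia * ?vol T)" if T: "T \<in> ?P" for T
  proof (cases "connected_graph ({1..k}, T)")
    case True
    have "(\<lambda>n. percolation_weight \<Gamma> k (p (Suc n)) T) \<longlonglongrightarrow> percolation_weight \<Gamma> k q T"
      unfolding percolation_weight_def using LIMSEQ_Suc[OF p] by (intro tendsto_intros)
    moreover have "(\<lambda>n. pattern_prob f A k T (r (Suc n)) / r (Suc n) ^ ?D) \<longlonglongrightarrow> ?Ia * ?vol T"
      by (rule pattern_prob_tendsto[OF f density_nonneg K(2,1) A k1 _ LIMSEQ_Suc[OF r(2)] True])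
        (simp add: r(1))
    ultimately show ?thesis by (rule tendsto_mult)
  next
    case False
    then have "percolation_weight \<Gamma> k u T = 0" for u
      using percolation_weight_disconnected[OF \<Gamma>] T by blast
    then show ?thesis by simp
  qed
  \<comment> \<open>The shift to \<open>Suc n\<close> skips the index \<open>0\<close>: \<open>r\<close> is positive from the index \<open>1\<close> on.\<close>
  have "(\<lambda>n. real (Suc n choose k) / real (Suc n) ^ k * (\<Sum>T\<in>?P. percolation_weight \<Gamma> k (p (Suc n)) T *
      (pattern_prob f A k T (r (Suc n)) / r (Suc n) ^ ?D)))
     \<longlonglongrightarrow> 1 / fact k * (\<Sum>T\<in>?P. percolation_weight \<Gamma> k q T * (?Ia * ?vol T))"
    by (intro tendsto_mult tendsto_sum summand LIMSEQ_Suc[OF binomial_over_power_tendsto])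
  also have "1 / fact k * (\<Sum>T\<in>?P. percolation_weight \<Gamma> k q T * (?Ia * ?vol T)) = limit_mean f \<Gamma> A q"
    unfolding limit_mean_def Let_def card(1) by (simp add: sum_distrib_left mult_ac)
  finally have "(\<lambda>n. (LINT \<omega>|M. real (induced_count \<Gamma> A (percolated_rgg X B r (Suc n) \<omega>))) / real (Suc n) *
      (\<theta> / d (Suc n)) ^ (k - 1)) \<longlonglongrightarrow> limit_mean f \<Gamma> A q"
    by (subst formula) simp_all
  then show ?thesis by (rule LIMSEQ_imp_Suc)
qed

theorem corollary2p4:
  fixes M :: "'o measure"
    and f :: "real ^ 'd::{finite, linorder} \<Rightarrow> real"
    and X :: "nat \<Rightarrow> 'o \<Rightarrow> real ^ 'd::{finite, linorder}"
    and B :: "nat \<Rightarrow> nat set \<Rightarrow> 'o \<Rightarrow> bool"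
    and p r d :: "nat \<Rightarrow> real"
    and \<Gamma> :: "'v ugraph"
    and A :: "(real ^ 'd::{finite, linorder}) set"
    and k :: nat
    and \<theta> q \<alpha> :: real
  assumes "percolated_sample M f X p B"
    and "\<And>n. 1 \<le> n \<Longrightarrow> 0 < r n"
    and "r \<longlonglongrightarrow> 0"
    and "simple_graph \<Gamma>" and "connected_graph \<Gamma>"
    and "2 \<le> k" and "card (verts \<Gamma>) = k" and "card (edges \<Gamma>) = k - 1"
    and "open A" and "emeasure lborel (frontier A) = 0"
    and "\<theta> = measure lborel (ball (0 :: real ^ 'd::{finite, linorder}) 1)"
    and "\<And>n. d n = real n * \<theta> * r n ^ CARD('d) * p n"
  defines "normalized_mean \<equiv> (\<lambda>n. (LINT \<omega>|M. real (induced_count \<Gamma> A (percolated_rgg X B r n \<omega>)))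
                / real n * (\<theta> / d n) ^ (k - 1))"
  shows "((\<forall>n\<ge>1. p n = q) \<longrightarrow>
          (\<exists>L. normalized_mean \<longlonglongrightarrow> L \<and>
               L \<ge> mu f \<Gamma> A + (1 - q) ^ ((k choose 2) - (k - 1)) * mu' f \<Gamma> A)) \<and>
         (0 < \<alpha> \<and> (\<lambda>n. real n ^ 2 * p n) \<longlonglongrightarrow> \<alpha> \<longrightarrow>
          (\<exists>L. normalized_mean \<longlonglongrightarrow> L \<and>
               L \<ge> mu f \<Gamma> A + exp (- \<alpha> / 2) * mu' f \<Gamma> A)) \<and>
         ((\<lambda>n. real n ^ 2 * p n) \<longlonglongrightarrow> 0 \<longrightarrow>
          (\<exists>L. normalized_mean \<longlonglongrightarrow> L \<and>
               L \<ge> mu f \<Gamma> A + mu' f \<Gamma> A))"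
proof -
  interpret percolated_sample M f X p B by fact
  have \<theta>: "\<theta> \<noteq> 0"
    using content_ball_pos[of 1 "0 :: real ^ 'd::{finite, linorder}"] assms(11) by simp
  have lim: "normalized_mean \<longlonglongrightarrow> limit_mean f \<Gamma> A u" if "p \<longlonglongrightarrow> u" for u
    unfolding normalized_mean_def
    by (rule normalized_mean_tendsto[OF assms(1-3,5-10) \<theta> assms(12) that])
  have k1: "1 \<le> k" using assms(6) by simp
  note ge = limit_mean_ge[OF density_nonneg assms(5,7,8) k1]
  have nonneg: "0 \<le> mu' f \<Gamma> A" using ge(2)[of 0] by simp
  \<comment> \<open>In both sparse regimes \<open>p\<close> tends to \<open>0\<close>, where the coefficient of \<open>mu'\<close> in the lower bound is \<open>1\<close>.
    As \<open>exp (- \<alpha> / 2)\<close> is at most \<open>1\<close>, the bound with this coefficient follows.\<close>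
  have sparse: "\<exists>L. normalized_mean \<longlonglongrightarrow> L \<and> L \<ge> mu f \<Gamma> A + c * mu' f \<Gamma> A"
    if conv: "(\<lambda>n. real n ^ 2 * p n) \<longlonglongrightarrow> b" and c: "c \<le> 1" for b c
  proof -
    have "(\<lambda>n. real n ^ 2 * p n * inverse (real n) ^ 2) \<longlonglongrightarrow> b * 0 ^ 2"
      by (intro tendsto_intros conv lim_inverse_n)
    moreover have "\<forall>\<^sub>F n in sequentially. real n ^ 2 * p n * inverse (real n) ^ 2 = p n"
      using eventually_gt_at_top[of 0] by eventually_elim (simp add: field_simps)
    ultimately have p0: "p \<longlonglongrightarrow> 0" by (auto intro: Lim_transform_eventually)
    have "mu f \<Gamma> A + c * mu' f \<Gamma> A \<le> mu f \<Gamma> A + 1 * mu' f \<Gamma> A"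
      using nonneg c by (intro add_left_mono mult_right_mono)
    also have "\<dots> \<le> limit_mean f \<Gamma> A 0" using ge(1)[of 0] by simp
    finally show ?thesis using lim[OF p0] by blast
  qed
  show ?thesis
  proof (intro conjI impI)
    assume q: "\<forall>n\<ge>1. p n = q"
    then have q01: "0 \<le> q" "q \<le> 1" using retention_range[of 1] by auto
    have "p \<longlonglongrightarrow> q"
      using q by (intro tendsto_eventually) (auto simp: eventually_at_top_linorder)
    from lim[OF this] ge(1)[OF q01]
    show "\<exists>L. normalized_mean \<longlonglongrightarrow> L \<and> L \<ge> mu f \<Gamma> A + (1 - q) ^ ((k choose 2) - (k - 1)) * mu' f \<Gamma> A"
      by (intro exI conjI)
  next
    assume "0 < \<alpha> \<and> (\<lambda>n. real n ^ 2 * p n) \<longlonglongrightarrow> \<alpha>"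
    then show "\<exists>L. normalized_mean \<longlonglongrightarrow> L \<and> L \<ge> mu f \<Gamma> A + exp (- \<alpha> / 2) * mu' f \<Gamma> A"
      by (intro sparse) auto
  next
    assume "(\<lambda>n. real n ^ 2 * p n) \<longlonglongrightarrow> 0"
    from sparse[OF this order_refl]
    show "\<exists>L. normalized_mean \<longlonglongrightarrow> L \<and> L \<ge> mu f \<Gamma> A + mu' f \<Gamma> A" by simp
  qed
qed

end
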